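(* There exist universal constants $\alpha_1,\alpha_2,\alpha_3>0$ such that the following holds. Let $n\ge 2$ and let $1\le k\leq \alpha_1\sqrt{n}$ be an integer. Let $f:S^{n-1}\to[0,\infty)$ be a measurable function such that $\|f\|_{\infty}\leq e^{\alpha_2\sqrt{n}}$, $\|f\|_1=\int_{S^{n-1}} f\,d\sigma_{n-1}=1$, and $f(x)$ depends only on the first $k$ coordinates $x_1,\ldots,x_k$ of $x$. Then $$\mathbb{P}_H\left(\sqrt{\int_{S_H}f(x)\,d\sigma_H(x)\int_{S_{H^{\perp}}}f(x)\,d\sigma_{H^{\perp}}(x)}\geq 0.9\right) \geq 1-\alpha_3e^{-\sqrt{n}}.$$
   Context: $S^{n-1}\subseteq\mathbb{R}^n$ is the Euclidean unit sphere and $\sigma_{n-1}$ is the uniform (rotation-invariant) probability measure on it. For a linear subspace $H\subseteq\mathbb{R}^n$, $S_H=S^{n-1}\cap H$ and $\sigma_H$ is the rotation-invariant (Haar) probability measure on $S_H$; $H^\perp$ is the orthogonal complement. $\mathbb{P}_H$ denotes probability with respect to a random subspace $H\subseteq\mathbb{R}^n$ of dimension $\lfloor n/2\rfloor$ distributed according to the orthogonally invariant Haar probability measure on the Grassmannian. Universal constants do not depend on $n$, $k$, $f$. *)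

theory Defs
  imports "HOL-Probability.Probability" "HOL-Library.Function_Algebras"
begin

text \<open>
  The dimension \<open>n\<close> is quantified inside the theorem (the constants must not depend on it), so
  \<open>\<real>\<^sup>n\<close> is the carrier of the library's \<^const>\<open>Euclidean_space\<close>: the sequences \<open>nat \<Rightarrow> real\<close> that
  vanish from index \<open>n\<close> on. Its topology is the subspace topology of the product topology
  on \<open>nat \<Rightarrow> real\<close>, so its Borel sets are the traces of \<^const>\<open>borel\<close>. Coordinates are indexed
  from \<open>0\<close>. The instance below makes \<^const>\<open>subspace\<close>, \<^const>\<open>dim\<close> and \<^const>\<open>linear\<close> available.
\<close>

instantiation "fun" :: (type, real_vector) real_vector
begin

definition scaleR_fun :: "real \<Rightarrow> ('a \<Rightarrow> 'b) \<Rightarrow> 'a \<Rightarrow> 'b" where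
  "scaleR_fun c x = (\<lambda>i. c *\<^sub>R x i)"

instance
  by standard (simp_all add: scaleR_fun_def fun_eq_iff scaleR_add_right scaleR_add_left)

end

abbreviation Rn :: "nat \<Rightarrow> (nat \<Rightarrow> real) set" where
  "Rn n \<equiv> topspace (Euclidean_space n)"

definition inner_n :: "nat \<Rightarrow> (nat \<Rightarrow> real) \<Rightarrow> (nat \<Rightarrow> real) \<Rightarrow> real" where
  "inner_n n x y = (\<Sum>i<n. x i * y i)"

text \<open>\<^term>\<open>nsphere m\<close> is the unit sphere of \<open>\<real>\<close> to the power \<open>m + 1\<close>; the next definition is meant
  for \<open>n \<ge> 1\<close>.\<close>

definition sphere_in :: "nat \<Rightarrow> (nat \<Rightarrow> real) set \<Rightarrow> (nat \<Rightarrow> real) set" where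
  "sphere_in n H = topspace (nsphere (n - 1)) \<inter> H"

definition orth_compl :: "nat \<Rightarrow> (nat \<Rightarrow> real) set \<Rightarrow> (nat \<Rightarrow> real) set" where
  "orth_compl n H = {y \<in> Rn n. \<forall>x\<in>H. inner_n n x y = 0}"

text \<open>Elements of \<open>O(n)\<close>; every linear map on \<open>\<real>\<^sup>n\<close> extends to a linear map on all sequences,
  and the values outside \<open>\<real>\<^sup>n\<close> are never used.\<close>

definition orthogonal_map :: "nat \<Rightarrow> ((nat \<Rightarrow> real) \<Rightarrow> (nat \<Rightarrow> real)) \<Rightarrow> bool" where
  "orthogonal_map n U \<longleftrightarrow> linear U \<and> U ` Rn n \<subseteq> Rn n \<and>
     (\<forall>x\<in>Rn n. \<forall>y\<in>Rn n. inner_n n (U x) (U y) = inner_n n x y)"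

text \<open>The unique rotation-invariant Borel probability measure on \<open>S\<^sub>H\<close>, for a subspace \<open>H\<close> of
  positive dimension. Every orthogonal map of \<open>H\<close> extends to one of \<open>\<real>\<^sup>n\<close> that preserves \<open>H\<close>, so
  invariance is under the full orthogonal group of \<open>H\<close>; reflections matter when \<open>dim H = 1\<close>,
  where \<open>S\<^sub>H\<close> consists of two points.\<close>

definition is_uniform_on_sphere :: "nat \<Rightarrow> (nat \<Rightarrow> real) set \<Rightarrow> (nat \<Rightarrow> real) measure \<Rightarrow> bool" where
  "is_uniform_on_sphere n H M \<longleftrightarrow>
     prob_space M \<and> sets M = sets (restrict_space borel (sphere_in n H)) \<and>
     (\<forall>U. orthogonal_map n U \<and> U ` H = H \<longrightarrow> distr M M U = M)"

definition sphere_measure :: "nat \<Rightarrow> (nat \<Rightarrow> real) set \<Rightarrow> (nat \<Rightarrow> real) measure" where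
  "sphere_measure n H = (THE M. is_uniform_on_sphere n H M)"

definition orth_proj :: "nat \<Rightarrow> (nat \<Rightarrow> real) set \<Rightarrow> (nat \<Rightarrow> real) \<Rightarrow> (nat \<Rightarrow> real)" where
  "orth_proj n H x = (THE y. y \<in> H \<and> (\<forall>z\<in>H. inner_n n (x - y) z = 0))"

definition Grassmannian :: "nat \<Rightarrow> nat \<Rightarrow> (nat \<Rightarrow> real) set set" where
  "Grassmannian n m = {H. subspace H \<and> H \<subseteq> Rn n \<and> dim H = m}"

text \<open>The topology of the Grassmannian is the one obtained by identifying a subspace with the matrix
  of the orthogonal projection onto it; the following is its Borel sigma-algebra. The matrix
  entries with an index \<open>\<ge> n\<close> are \<open>0\<close>.\<close>

definition Grassmannian_borel :: "nat \<Rightarrow> nat \<Rightarrow> (nat \<Rightarrow> real) set measure" where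
  "Grassmannian_borel n m =
     vimage_algebra (Grassmannian n m)
       (\<lambda>H i j. orth_proj n H (\<lambda>l. if l = i then 1 else 0) j) (borel :: (nat \<Rightarrow> nat \<Rightarrow> real) measure)"

definition is_Haar_Grassmannian :: "nat \<Rightarrow> nat \<Rightarrow> (nat \<Rightarrow> real) set measure \<Rightarrow> bool" where
  "is_Haar_Grassmannian n m M \<longleftrightarrow>
     prob_space M \<and> sets M = sets (Grassmannian_borel n m) \<and>
     (\<forall>U. orthogonal_map n U \<longrightarrow> distr M M (\<lambda>H. U ` H) = M)"

definition Haar_Grassmannian :: "nat \<Rightarrow> nat \<Rightarrow> (nat \<Rightarrow> real) set measure" where
  "Haar_Grassmannian n m = (THE M. is_Haar_Grassmannian n m M)"

end

theory Submission
  imports Defs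
begin

text \<open>
  Let \<open>P\<close> be the orthogonal projection onto \<open>H\<close>. Its compression to the span of the first \<open>k\<close> coordinates
  is diagonal in some orthonormal basis, with eigenvalues \<open>l i\<close>; for the complement of \<open>H\<close> the same basis
  works, with eigenvalues \<open>1 - l i\<close>. In this basis the first \<open>k\<close> coordinates have densities \<open>p\<^sub>1\<close> and \<open>p\<^sub>2\<close>
  under the uniform measures of the two spheres, of the form \<open>(1 - \<Sum>i<k. (y i)\<^sup>2 / l i) powr a\<close> with \<open>a\<close>
  close to \<open>n / 4\<close>. By Cauchy-Schwarz, the geometric mean of the two integrals of \<open>f\<close> is at least the
  integral of \<open>f\<close> against \<open>sqrt (p\<^sub>1 p\<^sub>2)\<close>. If all \<open>l i\<close> are within \<open>\<epsilon>\<close> of \<open>1 / 2\<close>, with \<open>\<epsilon>\<^sup>2\<close> of order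
  \<open>1 / sqrt n\<close>, then the first-order deviations cancel in the product, and \<open>sqrt (p\<^sub>1 p\<^sub>2)\<close> nearly dominates
  the density under the uniform measure of the whole sphere on the ball where the squared norm is at
  most a small multiple of \<open>1 / sqrt n\<close>; the bound on \<open>f\<close> makes the rest negligible.

  That the \<open>l i\<close> are close to \<open>1 / 2\<close> for most \<open>H\<close> follows from the concentration of the norm of the
  projection of a single vector, averaged over Gaussian vectors of \<open>\<real>\<^sup>k\<close>. All invariant measures are
  realised by Gaussian vectors, and their uniqueness is proved by averaging over small balls.
\<close>

section \<open>Lebesgue measure on finitely many coordinates\<close>

text \<open>The scale 1 / sqrt n is forced from both sides. Against a bound exp (c sqrt n) on
  \<open>f\<close>, the mass outside the ball of squared radius \<open>b\<close> is negligible only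
  if \<open>b\<close> has order at least 1 / sqrt n, while the second-order error of the logarithms,
  of order n b^2, allows no more. The failure probability exp (- sqrt n) forces \<epsilon>^2 to have
  order 1 / sqrt n. A single density would then be off by a factor exp (O (n \<epsilon> b)), which
  is exponential in n^(1/4); hence the geometric mean, in which only n \<epsilon>^2 b survives. That
  quantity is of order 1, and the numerical constants serve to make it small. The bound on k has the
  order at which the normalising constants still agree: their ratio is at least (1 - O (k / n))^k,
  and the factors exp (O (k)) from Gaussian tails and caps remain harmless. As n is a variable
  inside the theorem, all dimensions share one type of sequences. R^n is a subset of it, and maps
  are controlled on that subset only.\<close>

definition trunc :: "nat \<Rightarrow> (nat \<Rightarrow> real) \<Rightarrow> nat \<Rightarrow> real" where
  "trunc n x = (\<lambda>i. if i < n then x i else 0)"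

text \<open>Lebesgue measure of \<open>\<real>\<^sup>n\<close>, carried by the sequences that vanish from index \<open>n\<close> on but defined on
  the Borel sets of all sequences.\<close>

primrec leb :: "nat \<Rightarrow> (nat \<Rightarrow> real) measure" where
  "leb 0 = return borel (\<lambda>_. 0)"
| "leb (Suc n) = distr (lborel \<Otimes>\<^sub>M leb n) borel (\<lambda>(t, x). x(n := t))"

lemma sets_leb [simp, measurable_cong]: "sets (leb n) = sets borel"
  by (cases n) simp_all

lemma space_leb [simp]: "space (leb n) = UNIV"
  using sets_eq_imp_space_eq[OF sets_leb] by simp

lemma measurable_seqI:
  fixes f :: "'a \<Rightarrow> nat \<Rightarrow> 'b :: second_countable_topology"
  assumes "\<And>i. (\<lambda>x. f x i) \<in> borel_measurable M"
  shows "f \<in> borel_measurable M"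
  using assms by (rule measurable_coordinatewise_then_product)

lemma measurable_nth [measurable (raw)]:
  fixes f :: "'a \<Rightarrow> nat \<Rightarrow> real"
  assumes "f \<in> borel_measurable M"
  shows "(\<lambda>x. f x i) \<in> borel_measurable M"
  using assms by (rule measurable_product_then_coordinatewise)

lemma measurable_trunc [measurable]: "trunc n \<in> borel_measurable borel"
  unfolding trunc_def by (rule measurable_seqI) simp

lemma measurable_upd [measurable]:
  "(\<lambda>(t, x). x(n := t)) \<in> borel_measurable (borel \<Otimes>\<^sub>M (borel :: (nat \<Rightarrow> real) measure))"
  by (rule measurable_seqI) (auto simp: fun_upd_def case_prod_beta)

text \<open>The two claims feed each other: the volume of a cube in dimension n + 1 is a product by
  sigma-finiteness in dimension n, and the cubes of integer radius then exhaust the space by sets of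
  finite measure. Only the first \<open>n\<close> coordinates of \<open>x\<close> are constrained,
  as \<open>leb n\<close> is a measure on all sequences.\<close>

lemma emeasure_leb_cube:
  assumes "c \<ge> 0"
  shows "sigma_finite_measure (leb n) \<and> emeasure (leb n) {x. \<forall>i<n. \<bar>x i\<bar> \<le> c} = ennreal ((2 * c) ^ n)"
proof -
  have "sigma_finite_measure (leb n) \<and> (\<forall>c\<ge>0. emeasure (leb n) {x. \<forall>i<n. \<bar>x i\<bar> \<le> c} = ennreal ((2 * c) ^ n))"
  proof (induction n)
    case 0
    interpret prob_space "return borel (\<lambda>_. 0) :: (nat \<Rightarrow> real) measure"
      by (rule prob_space_return) simp
    have "sigma_finite_measure (leb 0)" using sigma_finite_measure_axioms by simp
    then show ?case by simp
  next
    case (Suc n)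
    interpret sigma_finite_measure "leb n" using Suc by simp
    have upd: "(\<lambda>(t, x). x(n := t)) \<in> lborel \<Otimes>\<^sub>M leb n \<rightarrow>\<^sub>M borel"
      by (subst measurable_cong_sets[OF sets_pair_measure_cong[OF sets_lborel sets_leb] refl]) (rule measurable_upd)
    have meas: "{x :: nat \<Rightarrow> real. \<forall>i<m. \<bar>x i\<bar> \<le> c} \<in> sets borel" for c m
      by measurable
    have *: "emeasure (leb (Suc n)) {x. \<forall>i<Suc n. \<bar>x i\<bar> \<le> c} = ennreal ((2 * c) ^ Suc n)" if "c \<ge> 0" for c
    proof -
      have "emeasure (leb (Suc n)) {x. \<forall>i<Suc n. \<bar>x i\<bar> \<le> c} =
          emeasure (lborel \<Otimes>\<^sub>M leb n) ((\<lambda>(t, x). x(n := t)) -` {x. \<forall>i<Suc n. \<bar>x i\<bar> \<le> c} \<inter> space (lborel \<Otimes>\<^sub>M leb n))"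
        unfolding leb.simps by (rule emeasure_distr[OF upd meas])
      also have "(\<lambda>(t, x). x(n := t)) -` {x. \<forall>i<Suc n. \<bar>x i\<bar> \<le> c} \<inter> space (lborel \<Otimes>\<^sub>M leb n)
          = {-c..c} \<times> {x. \<forall>i<n. \<bar>x i\<bar> \<le> c}"
        by (auto simp: space_pair_measure less_Suc_eq abs_le_iff)
      also have "emeasure (lborel \<Otimes>\<^sub>M leb n) \<dots> = emeasure lborel {-c..c} * emeasure (leb n) {x. \<forall>i<n. \<bar>x i\<bar> \<le> c}"
        using meas by (intro emeasure_pair_measure_Times) auto
      also have "\<dots> = ennreal ((2 * c) ^ Suc n)"
        using Suc that by (simp add: ennreal_mult')
      finally show ?thesis .
    qed
    have "sigma_finite_measure (leb (Suc n))"
    proof (rule sigma_finite_measure.intro, intro exI conjI ballI)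
      let ?A = "range (\<lambda>k::nat. {x :: nat \<Rightarrow> real. \<forall>i<Suc n. \<bar>x i\<bar> \<le> real k})"
      show "countable ?A" by simp
      show "?A \<subseteq> sets (leb (Suc n))" using meas by auto
      show "\<Union> ?A = space (leb (Suc n))"
      proof -
        have "\<exists>k::nat. \<forall>i<Suc n. \<bar>x i\<bar> \<le> real k" for x :: "nat \<Rightarrow> real"
        proof -
          obtain k :: nat where "(\<Sum>i<Suc n. \<bar>x i\<bar>) \<le> real k" using real_arch_simple by blast
          moreover have "\<bar>x i\<bar> \<le> (\<Sum>i<Suc n. \<bar>x i\<bar>)" if "i < Suc n" for i
            using that by (intro member_le_sum) auto
          ultimately show ?thesis by (meson order_trans)
        qed
        then show ?thesis unfolding space_leb by blast
      qed
      fix a assume "a \<in> ?A"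
      then show "emeasure (leb (Suc n)) a \<noteq> \<infinity>" using * by auto
    qed
    then show ?case using * by simp
  qed
  then show ?thesis using assms by simp
qed

lemma sigma_finite_leb: "sigma_finite_measure (leb n)"
  using emeasure_leb_cube[of 0 n] by simp

lemma nn_integral_leb_0: "F \<in> borel_measurable borel \<Longrightarrow> (\<integral>\<^sup>+x. F x \<partial>leb 0) = F (\<lambda>_. 0)"
  by (simp add: nn_integral_return)

text \<open>Both orders are recorded because the inductions below alternate between them: the first
  \<open>n\<close> coordinates are changed by the induction hypothesis, the last one by an affine
  substitution on the line.\<close>

lemma nn_integral_leb_Suc:
  assumes [measurable]: "F \<in> borel_measurable borel"
  shows "(\<integral>\<^sup>+x. F x \<partial>leb (Suc n)) = (\<integral>\<^sup>+t. \<integral>\<^sup>+x. F (x(n := t)) \<partial>leb n \<partial>lborel)"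
    and "(\<integral>\<^sup>+x. F x \<partial>leb (Suc n)) = (\<integral>\<^sup>+x. \<integral>\<^sup>+t. F (x(n := t)) \<partial>lborel \<partial>leb n)"
proof -
  interpret sigma_finite_measure "leb n" by (rule sigma_finite_leb)
  interpret P: pair_sigma_finite lborel "leb n"
    by (intro pair_sigma_finite.intro sigma_finite_leb sigma_finite_lborel)
  have *: "(\<integral>\<^sup>+x. F x \<partial>leb (Suc n)) = (\<integral>\<^sup>+p. F ((snd p)(n := fst p)) \<partial>(lborel \<Otimes>\<^sub>M leb n))"
    by (simp add: nn_integral_distr case_prod_beta)
  show "(\<integral>\<^sup>+x. F x \<partial>leb (Suc n)) = (\<integral>\<^sup>+t. \<integral>\<^sup>+x. F (x(n := t)) \<partial>leb n \<partial>lborel)"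
    unfolding * by (subst nn_integral_fst[symmetric]) simp_all
  show "(\<integral>\<^sup>+x. F x \<partial>leb (Suc n)) = (\<integral>\<^sup>+x. \<integral>\<^sup>+t. F (x(n := t)) \<partial>lborel \<partial>leb n)"
    unfolding * by (subst P.nn_integral_snd[symmetric]) simp_all
qed

lemma nn_integral_leb_trunc:
  assumes [measurable]: "F \<in> borel_measurable borel"
  shows "(\<integral>\<^sup>+x. F (trunc n x) \<partial>leb n) = (\<integral>\<^sup>+x. F x \<partial>leb n)"
  using assms
proof (induction n arbitrary: F)
  case 0
  then show ?case by (simp add: nn_integral_leb_0 trunc_def del: leb.simps nn_integral_const)
next
  case (Suc n)
  note [measurable] = Suc.prems
  have eq: "trunc (Suc n) (x(n := t)) = (trunc n x)(n := t)" for x t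
    by (auto simp: trunc_def fun_eq_iff)
  show ?case
    by (subst (1 2) nn_integral_leb_Suc(1)) (simp_all del: leb.simps add: eq Suc.IH[of "\<lambda>x. F (x(n := _))"])
qed

lemma nn_integral_leb_translate:
  assumes [measurable]: "F \<in> borel_measurable borel" and "a \<in> Rn n"
  shows "(\<integral>\<^sup>+x. F (x + a) \<partial>leb n) = (\<integral>\<^sup>+x. F x \<partial>leb n)"
proof -
  have [measurable]: "(\<lambda>x. x + b) \<in> borel_measurable (borel :: (nat \<Rightarrow> real) measure)" for b :: "nat \<Rightarrow> real"
    by (rule measurable_seqI) simp
  \<comment> \<open>Stated for \<open>trunc n a\<close> with \<open>a\<close> fixed, since a vector
    of \<open>Rn (Suc n)\<close> need not lie in \<open>Rn n\<close> when the induction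
    descends.\<close>
  have "(\<integral>\<^sup>+x. F (x + trunc n a) \<partial>leb n) = (\<integral>\<^sup>+x. F x \<partial>leb n)"
    using assms(1)
  proof (induction n arbitrary: F)
    case 0
    then show ?case by (simp add: nn_integral_leb_0 trunc_def plus_fun_def del: leb.simps)
  next
    case (Suc n)
    note [measurable] = Suc.prems
    have eq: "x(n := t) + trunc (Suc n) a = (x + trunc n a)(n := t + a n)" for x t
      by (auto simp: trunc_def fun_eq_iff)
    have "(\<integral>\<^sup>+x. F (x + trunc (Suc n) a) \<partial>leb (Suc n))
        = (\<integral>\<^sup>+t. \<integral>\<^sup>+x. F (x(n := t + a n)) \<partial>leb n \<partial>lborel)"
      by (subst nn_integral_leb_Suc(1)) (simp_all del: leb.simps add: eq Suc.IH[of "\<lambda>x. F (x(n := _))"])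
    also have "\<dots> = (\<integral>\<^sup>+x. \<integral>\<^sup>+t. F (x(n := a n + 1 * t)) \<partial>lborel \<partial>leb n)"
    proof -
      interpret P: pair_sigma_finite lborel "leb n"
        by (intro pair_sigma_finite.intro sigma_finite_leb sigma_finite_lborel)
      show ?thesis by (subst P.Fubini'[symmetric]) (simp_all add: add.commute)
    qed
    also have "\<dots> = (\<integral>\<^sup>+x. \<integral>\<^sup>+t. F (x(n := t)) \<partial>lborel \<partial>leb n)"
      by (subst (2) nn_integral_real_affine[where c=1 and t="a n"]) simp_all
    also have "\<dots> = (\<integral>\<^sup>+x. F x \<partial>leb (Suc n))"
      by (subst nn_integral_leb_Suc(2)) simp_all
    finally show ?case .
  qed
  moreover have "trunc n a = a" using assms(2) by (auto simp: trunc_def topspace_Euclidean_space)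
  ultimately show ?thesis by simp
qed

text \<open>The Jacobian stands on the left as a factor, so that no division of extended reals
  occurs.\<close>

lemma nn_integral_leb_scale:
  assumes [measurable]: "F \<in> borel_measurable borel" and "\<And>i. i < n \<Longrightarrow> c i > 0"
  shows "(\<integral>\<^sup>+x. F (\<lambda>i. c i * x i) \<partial>leb n) * ennreal (\<Prod>i<n. c i) = (\<integral>\<^sup>+x. F x \<partial>leb n)"
proof -
  have meas [measurable]: "(\<lambda>x i. b i * x i) \<in> borel_measurable (borel :: (nat \<Rightarrow> real) measure)" for b :: "nat \<Rightarrow> real"
    by (rule measurable_seqI) simp
  show ?thesis using assms
  proof (induction n arbitrary: F)
    case 0
    then show ?case by (simp add: nn_integral_leb_0 del: leb.simps)
  next
    case (Suc n)
    note [measurable] = Suc.prems(1)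
    have c: "c n > 0" "(\<Prod>i<n. c i) > 0" using Suc.prems(2) by (auto intro: prod_pos)
    have eq: "(\<lambda>i. c i * (x(n := t)) i) = (\<lambda>i. c i * x i)(n := c n * t)" for x t
      by (auto simp: fun_eq_iff)
    interpret P: pair_sigma_finite lborel "leb n"
      by (intro pair_sigma_finite.intro sigma_finite_leb sigma_finite_lborel)
    have "(\<integral>\<^sup>+x. F (\<lambda>i. c i * x i) \<partial>leb (Suc n)) * ennreal (\<Prod>i<Suc n. c i)
      = (\<integral>\<^sup>+t. (\<integral>\<^sup>+x. F ((\<lambda>i. c i * x i)(n := c n * t)) \<partial>leb n) * ennreal (\<Prod>i<n. c i) \<partial>lborel) * ennreal (c n)"
      using c by (subst nn_integral_leb_Suc(1))
        (simp_all del: leb.simps fun_upd_apply add: eq nn_integral_multc ennreal_mult' mult.assoc)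
    also have "\<dots> = (\<integral>\<^sup>+t. (\<integral>\<^sup>+x. F (x(n := c n * t)) \<partial>leb n) \<partial>lborel) * ennreal (c n)"
      using Suc.prems(2) by (subst Suc.IH[of "\<lambda>x. F (x(n := _))"]) simp_all
    also have "\<dots> = (\<integral>\<^sup>+x. ennreal (c n) * (\<integral>\<^sup>+t. F (x(n := 0 + c n * t)) \<partial>lborel) \<partial>leb n)"
      by (subst P.Fubini'[symmetric]) (simp_all add: nn_integral_cmult mult.commute)
    also have "\<dots> = (\<integral>\<^sup>+x. (\<integral>\<^sup>+t. F (x(n := t)) \<partial>lborel) \<partial>leb n)"
      using c by (subst (2) nn_integral_real_affine[where c="c n" and t=0]) simp_all
    also have "\<dots> = (\<integral>\<^sup>+x. F x \<partial>leb (Suc n))"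
      by (subst nn_integral_leb_Suc(2)) simp_all
    finally show ?case .
  qed
qed

lemma nn_integral_leb_prod:
  assumes [measurable]: "\<And>i. i < n \<Longrightarrow> h i \<in> borel_measurable borel"
  shows "(\<integral>\<^sup>+x. (\<Prod>i<n. h i (x i)) \<partial>leb n) = (\<Prod>i<n. \<integral>\<^sup>+t. h i t \<partial>lborel :: ennreal)"
  using assms
proof (induction n)
  case 0
  then show ?case by (simp add: nn_integral_leb_0 del: leb.simps nn_integral_const)
next
  case (Suc n)
  note [measurable] = Suc.prems
  have "(\<integral>\<^sup>+x. (\<Prod>i<Suc n. h i (x i)) \<partial>leb (Suc n)) =
      (\<integral>\<^sup>+t. \<integral>\<^sup>+x. h n t * (\<Prod>i<n. h i (x i)) \<partial>leb n \<partial>lborel)"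
    by (subst nn_integral_leb_Suc(1)) (simp_all del: leb.simps add: mult.commute)
  also have "\<dots> = (\<Prod>i<Suc n. \<integral>\<^sup>+t. h i t \<partial>lborel)"
    using Suc by (simp add: nn_integral_cmult nn_integral_multc mult.commute del: leb.simps)
  finally show ?case .
qed

definition append_n :: "nat \<Rightarrow> (nat \<Rightarrow> real) \<Rightarrow> (nat \<Rightarrow> real) \<Rightarrow> nat \<Rightarrow> real" where
  "append_n k x y = (\<lambda>i. if i < k then x i else y (i - k))"

lemma measurable_append_n [measurable (raw)]:
  assumes [measurable]: "f \<in> borel_measurable M" "g \<in> borel_measurable M"
  shows "(\<lambda>x. append_n k (f x) (g x)) \<in> borel_measurable M"
  unfolding append_n_def by (rule measurable_seqI) simp

lemma nn_integral_leb_add: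
  assumes [measurable]: "F \<in> borel_measurable borel"
  shows "(\<integral>\<^sup>+x. F x \<partial>leb (k + j)) = (\<integral>\<^sup>+x. \<integral>\<^sup>+y. F (append_n k x y) \<partial>leb j \<partial>leb k)"
  using assms
proof (induction j arbitrary: F)
  case 0
  have "append_n k x (\<lambda>_. 0) = trunc k x" for x by (auto simp: append_n_def trunc_def fun_eq_iff)
  with 0 show ?case by (simp add: nn_integral_leb_0 nn_integral_leb_trunc del: leb.simps)
next
  case (Suc j)
  note [measurable] = Suc.prems
  have eq: "(append_n k x y)(k + j := t) = append_n k x (y(j := t))" for x y t
    by (auto simp: append_n_def fun_eq_iff)
  interpret sigma_finite_measure "leb j" by (rule sigma_finite_leb)
  have [measurable]: "case_prod append_n' \<in> borel_measurable (borel \<Otimes>\<^sub>M borel)"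
    if "append_n' = append_n k" for append_n' unfolding that by measurable
  have "(\<integral>\<^sup>+x. F x \<partial>leb (k + Suc j)) = (\<integral>\<^sup>+x. \<integral>\<^sup>+y. \<integral>\<^sup>+t. F (append_n k x (y(j := t))) \<partial>lborel \<partial>leb j \<partial>leb k)"
    by (simp add: nn_integral_leb_Suc(2) Suc.IH eq del: leb.simps)
  also have "\<dots> = (\<integral>\<^sup>+x. \<integral>\<^sup>+y. F (append_n k x y) \<partial>leb (Suc j) \<partial>leb k)"
    by (intro nn_integral_cong, subst nn_integral_leb_Suc(2)) (simp_all del: leb.simps)
  finally show ?case .
qed

section \<open>Orthonormal families and orthogonal projections\<close>

text \<open>Sequences are added as vectors from here on; these two rules would make the simplifier eta-expand
  such sums.\<close>

declare plus_fun_apply [simp del] zero_fun_apply [simp del]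

lemmas fun_simps = plus_fun_apply zero_fun_apply scaleR_fun_def minus_apply

section \<open>Coordinates and the inner product\<close>

lemma Rn_iff: "x \<in> Rn n \<longleftrightarrow> (\<forall>i\<ge>n. x i = 0)"
  by (auto simp: topspace_Euclidean_space)

lemma trunc_Rn: "trunc n x \<in> Rn n" "x \<in> Rn n \<Longrightarrow> trunc n x = x"
  by (auto simp: trunc_def Rn_iff fun_eq_iff)

lemma Rn_mono: "k \<le> n \<Longrightarrow> x \<in> Rn k \<Longrightarrow> x \<in> Rn n"
  by (auto simp: Rn_iff)

lemma subspace_Rn: "subspace (Rn n)"
  by (auto simp: subspace_def Rn_iff fun_simps)

lemma inner_n_commute: "inner_n n x y = inner_n n y x"
  by (simp add: inner_n_def mult.commute)

lemma inner_n_add: "inner_n n (x + y) z = inner_n n x z + inner_n n y z"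
    "inner_n n z (x + y) = inner_n n z x + inner_n n z y"
  by (simp_all add: inner_n_def fun_simps algebra_simps sum.distrib)

lemma inner_n_diff: "inner_n n (x - y) z = inner_n n x z - inner_n n y z"
    "inner_n n z (x - y) = inner_n n z x - inner_n n z y"
  by (simp_all add: inner_n_def fun_simps algebra_simps sum_subtractf)

lemma inner_n_scale: "inner_n n (c *\<^sub>R x) z = c * inner_n n x z"
    "inner_n n z (c *\<^sub>R x) = c * inner_n n z x"
  by (simp_all add: inner_n_def scaleR_fun_def sum_distrib_left mult_ac)

lemma inner_n_zero: "inner_n n 0 x = 0" "inner_n n x 0 = 0"
  by (simp_all add: inner_n_def fun_simps)

lemma inner_n_nonneg: "inner_n n x x \<ge> 0"
  by (simp add: inner_n_def sum_nonneg)

lemma inner_n_eq_0: "x \<in> Rn n \<Longrightarrow> inner_n n x x = 0 \<longleftrightarrow> x = 0"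
  by (auto simp: inner_n_def sum_nonneg_eq_0_iff Rn_iff fun_eq_iff fun_simps)
    (metis lessThan_iff not_le)

lemma inner_n_trunc: "inner_n n (trunc n x) y = inner_n n x y" "inner_n n y (trunc n x) = inner_n n y x"
  by (simp_all add: inner_n_def trunc_def)

lemma inner_n_Rn:
  assumes "x \<in> Rn k" "k \<le> n"
  shows "inner_n n x y = inner_n k x y" "inner_n n y x = inner_n k y x"
proof -
  show "inner_n n x y = inner_n k x y" unfolding inner_n_def
    using assms by (intro sum.mono_neutral_right) (auto simp: Rn_iff)
  then show "inner_n n y x = inner_n k y x" by (simp add: inner_n_commute)
qed

definition ev :: "nat \<Rightarrow> nat \<Rightarrow> real" where
  "ev i = (\<lambda>j. if j = i then 1 else 0)"

lemma inner_n_ev: "inner_n n (ev i) x = (if i < n then x i else 0)" "inner_n n x (ev i) = (if i < n then x i else 0)"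
proof -
  have "inner_n n (ev i) x = (\<Sum>j<n. if j = i then x j else 0)"
    unfolding inner_n_def ev_def by (intro sum.cong) auto
  then show "inner_n n (ev i) x = (if i < n then x i else 0)" by simp
  then show "inner_n n x (ev i) = (if i < n then x i else 0)" by (simp add: inner_n_commute)
qed

lemma ev_Rn: "i < n \<Longrightarrow> ev i \<in> Rn n"
  by (auto simp: ev_def Rn_iff)

section \<open>Orthonormal families and bases of subspaces\<close>

definition onf :: "nat \<Rightarrow> nat \<Rightarrow> (nat \<Rightarrow> nat \<Rightarrow> real) \<Rightarrow> bool" where
  "onf n m u \<longleftrightarrow> (\<forall>i<m. u i \<in> Rn n) \<and> (\<forall>i<m. \<forall>j<m. inner_n n (u i) (u j) = (if i = j then 1 else 0))"

text \<open>Defined on all coefficient sequences, of which only the first \<open>m\<close> entries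
  matter. It is a linear map on the whole type, so its range is a subspace, and for a full
  orthonormal family \<open>lc n u\<close> is also the rotation that takes the standard basis to
  \<open>u\<close>.\<close>

definition lc :: "nat \<Rightarrow> (nat \<Rightarrow> nat \<Rightarrow> real) \<Rightarrow> (nat \<Rightarrow> real) \<Rightarrow> nat \<Rightarrow> real" where
  "lc m u a = (\<lambda>l. \<Sum>i<m. a i * u i l)"

definition onb :: "nat \<Rightarrow> nat \<Rightarrow> (nat \<Rightarrow> nat \<Rightarrow> real) \<Rightarrow> (nat \<Rightarrow> real) set \<Rightarrow> bool" where
  "onb n m u H \<longleftrightarrow> onf n m u \<and> H = range (lc m u)"

lemma lc_cong: "(\<And>i. i < m \<Longrightarrow> u i = v i) \<Longrightarrow> (\<And>i. i < m \<Longrightarrow> a i = b i) \<Longrightarrow> lc m u a = lc m v b"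
  by (auto simp: lc_def)

lemma onf_ev: "k \<le> n \<Longrightarrow> onf n k ev"
  by (auto simp: onf_def inner_n_ev ev_Rn) (auto simp: ev_def)

lemma lc_ev: "lc n ev x = trunc n x"
proof
  fix l
  have "lc n ev x l = (\<Sum>i<n. if i = l then x i else 0)"
    unfolding lc_def ev_def by (intro sum.cong) auto
  then show "lc n ev x l = trunc n x l" by (simp add: trunc_def)
qed

lemma lc_Suc: "lc (Suc m) u a = lc m u a + a m *\<^sub>R u m"
  by (auto simp: lc_def fun_simps fun_eq_iff)

lemma lc_0: "lc 0 u a = 0"
  by (auto simp: lc_def fun_simps fun_eq_iff)

lemma lc_add: "lc m u (a + b) = lc m u a + lc m u b"
  by (auto simp: lc_def fun_simps fun_eq_iff algebra_simps sum.distrib)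

lemma lc_scale: "lc m u (c *\<^sub>R a) = c *\<^sub>R lc m u a"
  by (auto simp: lc_def fun_simps fun_eq_iff sum_distrib_left mult_ac)

lemma lc_linear: "linear (lc m u)"
  by (rule linearI) (auto simp: lc_add lc_scale)

lemma lc_in_subspace: "subspace H \<Longrightarrow> (\<And>i. i < m \<Longrightarrow> u i \<in> H) \<Longrightarrow> lc m u a \<in> H"
  by (induction m) (auto simp: lc_Suc lc_0 subspace_0 subspace_add subspace_scale)

lemma subspace_range_lc: "subspace (range (lc m u))"
  using linear_subspace_image[OF lc_linear subspace_UNIV] by simp

lemma lc_ev_app: "i < m \<Longrightarrow> lc m u (ev i) = u i"
proof
  fix l assume "i < m"
  have "lc m u (ev i) l = (\<Sum>j<m. if j = i then u j l else 0)"
    unfolding lc_def ev_def by (intro sum.cong) auto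
  then show "lc m u (ev i) l = u i l" using \<open>i < m\<close> by simp
qed

lemma in_range_lc: "i < m \<Longrightarrow> u i \<in> range (lc m u)"
  by (metis lc_ev_app rangeI)

lemma inner_n_lc: "inner_n n (lc m u a) x = (\<Sum>i<m. a i * inner_n n (u i) x)"
  by (induction m) (simp_all add: lc_0 lc_Suc inner_n_zero inner_n_add inner_n_scale)

lemma linear_lc: "linear T \<Longrightarrow> T (lc m u a) = lc m (\<lambda>i. T (u i)) a"
  by (induction m) (simp_all add: lc_0 lc_Suc linear_0 linear_add linear_scale)

lemma onf_inner_lc:
  assumes "onf n m u"
  shows "i < m \<Longrightarrow> inner_n n (lc m u a) (u i) = a i"
    and "inner_n n (lc m u a) (lc m u b) = (\<Sum>i<m. a i * b i)"
proof -
  show *: "inner_n n (lc m u a) (u i) = a i" if "i < m" for i a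
  proof -
    have "inner_n n (lc m u a) (u i) = (\<Sum>j<m. if j = i then a j else 0)"
      unfolding inner_n_lc using assms that by (intro sum.cong) (auto simp: onf_def)
    then show ?thesis using that by simp
  qed
  have "inner_n n (lc m u a) (lc m u b) = (\<Sum>i<m. a i * inner_n n (lc m u b) (u i))"
    unfolding inner_n_lc[of n m u a] by (simp add: inner_n_commute)
  then show "inner_n n (lc m u a) (lc m u b) = (\<Sum>i<m. a i * b i)"
    using * by (simp cong: sum.cong_simp)
qed

lemma onf_lc_Rn: "onf n m u \<Longrightarrow> lc m u a \<in> Rn n"
  by (intro lc_in_subspace subspace_Rn) (auto simp: onf_def)

text \<open>The identity behind Bessel's inequality, which follows because the left side is
  nonnegative.\<close>

lemma onf_Bessel:
  assumes "onf n m u"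
  shows "inner_n n (x - lc m u (\<lambda>i. inner_n n x (u i))) (x - lc m u (\<lambda>i. inner_n n x (u i)))
           = inner_n n x x - (\<Sum>i<m. (inner_n n x (u i))\<^sup>2)"
proof -
  have "inner_n n x (lc m u (\<lambda>i. inner_n n x (u i))) = (\<Sum>i<m. (inner_n n x (u i))\<^sup>2)"
    unfolding inner_n_commute[of n x "lc _ _ _"] inner_n_lc by (simp add: inner_n_commute power2_eq_square)
  moreover have "inner_n n (lc m u (\<lambda>i. inner_n n x (u i))) (lc m u (\<lambda>i. inner_n n x (u i))) = (\<Sum>i<m. (inner_n n x (u i))\<^sup>2)"
    using onf_inner_lc(2)[OF assms] by (simp add: power2_eq_square)
  ultimately show ?thesis
    by (simp add: inner_n_diff inner_n_commute)
qed

text \<open>Double counting of the squared entries of the family: each member has squared entries of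
  sum 1, and for a fixed coordinate \<open>l\<close> Bessel's inequality for \<open>ev l\<close>
  bounds the sum over the members by 1.\<close>

lemma onf_card_le:
  assumes "onf n m u"
  shows "m \<le> n"
proof -
  have 1: "(\<Sum>i<m. (u i l)\<^sup>2) \<le> 1" if "l < n" for l
  proof -
    have "0 \<le> inner_n n (ev l) (ev l) - (\<Sum>i<m. (inner_n n (ev l) (u i))\<^sup>2)"
      using onf_Bessel[OF assms, of "ev l"] inner_n_nonneg by metis
    moreover have "inner_n n (ev l) (ev l) = 1" using that by (subst inner_n_ev) (simp add: ev_def)
    ultimately show ?thesis using that by (simp add: inner_n_ev)
  qed
  have "real m = (\<Sum>i<m. inner_n n (u i) (u i))" using assms by (simp add: onf_def)
  also have "\<dots> = (\<Sum>l<n. \<Sum>i<m. (u i l)\<^sup>2)"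
    unfolding inner_n_def by (subst sum.swap) (simp add: power2_eq_square)
  also have "\<dots> \<le> (\<Sum>l<n. 1)" using 1 by (intro sum_mono) auto
  finally show ?thesis by simp
qed

text \<open>Ties the explicit families to \<open>dim\<close>, on which the Grassmannian is based. A
  member is independent of the others because their span lies in its orthogonal hyperplane.\<close>

lemma onb_dim:
  assumes "onb n m u H"
  shows "dim H = m"
proof (rule dim_unique)
  have o: "onf n m u" and H: "H = range (lc m u)" using assms by (auto simp: onb_def)
  let ?B = "u ` {..<m}"
  show "?B \<subseteq> H" unfolding H by (auto intro: in_range_lc)
  show "H \<subseteq> span ?B" unfolding H by (auto intro!: lc_in_subspace[OF subspace_span] intro: span_base)
  have inj: "inj_on u {..<m}"
  proof (rule inj_onI)
    fix i j assume *: "i \<in> {..<m}" "j \<in> {..<m}" "u i = u j"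
    have "inner_n n (u i) (u j) = 1" using o * by (auto simp: onf_def)
    then show "i = j" using o * unfolding onf_def by (metis lessThan_iff zero_neq_one)
  qed
  then show "card ?B = m" by (simp add: card_image)
  show "independent ?B" unfolding dependent_def
  proof safe
    fix i assume i: "i < m" and "u i \<in> span (?B - {u i})"
    moreover have "span (?B - {u i}) \<subseteq> {y. inner_n n y (u i) = 0}"
    proof (rule span_minimal)
      show "subspace {y. inner_n n y (u i) = 0}"
        by (auto simp: subspace_def inner_n_zero inner_n_add inner_n_scale)
      show "?B - {u i} \<subseteq> {y. inner_n n y (u i) = 0}" using o i by (auto simp: onf_def)
    qed
    ultimately have "inner_n n (u i) (u i) = 0" by auto
    then show False using o i by (auto simp: onf_def)
  qed
qed

lemma onb_expand:
  assumes "onb n m u H" "x \<in> H"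
  shows "lc m u (\<lambda>i. inner_n n x (u i)) = x"
proof -
  obtain a where x: "x = lc m u a" and o: "onf n m u" using assms by (auto simp: onb_def)
  show ?thesis unfolding x using onf_inner_lc(1)[OF o] by (intro lc_cong) auto
qed

lemma onb_Parseval:
  assumes "onb n m u H" "x \<in> H"
  shows "inner_n n x y = (\<Sum>i<m. inner_n n x (u i) * inner_n n y (u i))"
proof -
  have "inner_n n x y = inner_n n (lc m u (\<lambda>i. inner_n n x (u i))) y"
    using onb_expand[OF assms] by simp
  then show ?thesis unfolding inner_n_lc by (simp add: inner_n_commute)
qed

text \<open>Gram-Schmidt. The induction on \<open>n - j\<close> terminates since
  \<open>onf_card_le\<close> bounds the length of any orthonormal family. Existence of bases, finite
  dimension of \<open>H\<close> and extension to a full basis of \<open>Rn n\<close> all come from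
  here.\<close>

lemma onf_extend:
  assumes "subspace H" "H \<subseteq> Rn n" "onf n j u" "\<And>i. i < j \<Longrightarrow> u i \<in> H"
  shows "\<exists>v. onb n (dim H) v H \<and> (\<forall>i<j. v i = u i) \<and> j \<le> dim H"
  using assms(3,4)
proof (induction "n - j" arbitrary: j u rule: less_induct)
  case less
  have sub: "range (lc j u) \<subseteq> H" using lc_in_subspace[OF assms(1)] less.prems by auto
  show ?case
  proof (cases "range (lc j u) = H")
    case True
    then have "onb n j u H" using less.prems by (simp add: onb_def)
    then show ?thesis using onb_dim by blast
  next
    case False
    then obtain x where x: "x \<in> H" "x \<notin> range (lc j u)" using sub by auto
    define w where "w = x - lc j u (\<lambda>i. inner_n n x (u i))"
    have wH: "w \<in> H" unfolding w_def using x sub assms(1) by (intro subspace_diff) auto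
    have "w \<noteq> 0" using x by (auto simp: w_def)
    then have ww: "inner_n n w w > 0" using inner_n_eq_0[of w n] inner_n_nonneg[of n w] wH assms(2) by fastforce
    have wu: "inner_n n w (u i) = 0" if "i < j" for i
      using onf_inner_lc(1)[OF less.prems(1) that] by (simp add: w_def inner_n_diff)
    define v where "v = u(j := (1 / sqrt (inner_n n w w)) *\<^sub>R w)"
    have vH: "v i \<in> H" if "i < Suc j" for i
      using less.prems that wH assms(1) by (auto simp: v_def less_Suc_eq intro: subspace_scale)
    have vo: "onf n (Suc j) v" unfolding onf_def
    proof (intro conjI allI impI)
      fix i assume "i < Suc j" then show "v i \<in> Rn n" using vH assms(2) by auto
    next
      fix i i' assume i: "i < Suc j" "i' < Suc j"
      have "inner_n n (v j) (v j) = 1" using ww by (simp add: v_def inner_n_scale divide_simps)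
      moreover have "inner_n n (v j) (v i) = 0" "inner_n n (v i) (v j) = 0" if "i < j" for i
        using that wu[OF that] by (simp_all add: v_def inner_n_scale inner_n_commute[of n "u i"])
      moreover have "inner_n n (v i) (v i') = (if i = i' then 1 else 0)" if "i < j" "i' < j" for i i'
        using that less.prems(1) by (simp add: v_def onf_def)
      ultimately show "inner_n n (v i) (v i') = (if i = i' then 1 else 0)"
        using i by (elim less_SucE) simp_all
    qed
    have "Suc j \<le> n" using onf_card_le[OF vo] .
    then obtain v' where v': "onb n (dim H) v' H" "\<forall>i<Suc j. v' i = v i" "Suc j \<le> dim H"
      using less.hyps[of "Suc j" v] vo vH by (metis Suc_le_lessD diff_less_mono2 lessI)
    moreover have "v' i = u i" if "i < j" for i using v'(2) that by (simp add: v_def less_Suc_eq)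
    ultimately show ?thesis using Suc_leD by blast
  qed
qed

lemma onb_exists:
  assumes "subspace H" "H \<subseteq> Rn n"
  obtains u where "onb n (dim H) u H"
  using onf_extend[OF assms, of 0] by (auto simp: onf_def)

lemma onb_ev: "k \<le> n \<Longrightarrow> onb n k ev (Rn k)"
proof -
  have "range (trunc k) = Rn k" using trunc_Rn[where n=k] by (auto simp: set_eq_iff image_iff) metis
  moreover have "lc k ev = trunc k" using lc_ev by (rule ext)
  moreover assume "k \<le> n"
  ultimately show ?thesis by (simp add: onb_def onf_ev)
qed

lemma dim_Rn: "dim (Rn n) = n"
  using onb_dim[OF onb_ev[of n n]] by simp

lemma onf_full: "onf n n u \<Longrightarrow> onb n n u (Rn n)"
proof -
  assume o: "onf n n u"
  then obtain v where v: "onb n n v (Rn n)" "\<forall>i<n. v i = u i"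
    using onf_extend[OF subspace_Rn order_refl o] by (auto simp: onf_def dim_Rn)
  then have "lc n v = lc n u" by (intro ext lc_cong) auto
  with v o show ?thesis by (auto simp: onb_def)
qed

lemma onf_extend_full:
  assumes "onf n m u"
  obtains v where "onf n n v" "\<And>i. i < m \<Longrightarrow> v i = u i"
  using onf_extend[OF subspace_Rn order_refl assms] assms by (auto simp: onf_def dim_Rn onb_def)

lemma dim_le_n: "subspace H \<Longrightarrow> H \<subseteq> Rn n \<Longrightarrow> dim H \<le> n"
  by (meson onb_def onb_exists onf_card_le)

lemma inner_n_lc2: "inner_n n x (lc m u a) = (\<Sum>i<m. a i * inner_n n x (u i))"
  by (simp add: inner_n_commute[of n x] inner_n_lc)

section \<open>Orthogonal projections\<close>

lemma orth_proj_unique: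
  assumes "subspace H" "H \<subseteq> Rn n" "y \<in> H" "\<And>z. z \<in> H \<Longrightarrow> inner_n n (x - y) z = 0"
  shows "orth_proj n H x = y"
  unfolding orth_proj_def
proof (rule the_equality)
  show "y \<in> H \<and> (\<forall>z\<in>H. inner_n n (x - y) z = 0)" using assms by simp
  fix y' assume y': "y' \<in> H \<and> (\<forall>z\<in>H. inner_n n (x - y') z = 0)"
  have d: "y - y' \<in> H" using assms y' by (intro subspace_diff) auto
  then have "inner_n n (x - y') (y - y') - inner_n n (x - y) (y - y') = 0" using y' assms(4) by simp
  then have "inner_n n (y - y') (y - y') = 0" by (simp add: inner_n_diff)
  then have "y - y' = 0" using inner_n_eq_0 d assms(2) by blast
  then show "y' = y" by simp
qed

lemma onb_subspace: "onb n m u H \<Longrightarrow> subspace H" "onb n m u H \<Longrightarrow> H \<subseteq> Rn n"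
  using subspace_range_lc onf_lc_Rn by (auto simp: onb_def)

lemma onb_in: "onb n m u H \<Longrightarrow> i < m \<Longrightarrow> u i \<in> H"
  by (auto simp: onb_def in_range_lc)

lemma orth_proj_onb:
  assumes "onb n m u H"
  shows "orth_proj n H x = lc m u (\<lambda>i. inner_n n x (u i))"
proof (rule orth_proj_unique[OF onb_subspace[OF assms]])
  have o: "onf n m u" and H: "H = range (lc m u)" using assms by (auto simp: onb_def)
  show "lc m u (\<lambda>i. inner_n n x (u i)) \<in> H" by (simp add: H)
  fix z assume "z \<in> H"
  then obtain a where z: "z = lc m u a" by (auto simp: H)
  have "inner_n n x (lc m u a) = inner_n n (lc m u (\<lambda>i. inner_n n x (u i))) (lc m u a)"
    unfolding onf_inner_lc(2)[OF o] inner_n_lc2[of n x] by (simp add: mult.commute)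
  then show "inner_n n (x - lc m u (\<lambda>i. inner_n n x (u i))) z = 0"
    by (simp add: z inner_n_diff)
qed

context
  fixes n H
  assumes H: "subspace H" "H \<subseteq> Rn n"
begin

lemma orth_proj_in: "orth_proj n H x \<in> H"
  using orth_proj_onb onb_exists[OF H] by (metis onb_def rangeI)

lemma orth_proj_in_Rn: "orth_proj n H x \<in> Rn n"
  using orth_proj_in H by auto

lemma inner_orth_proj: "z \<in> H \<Longrightarrow> inner_n n (orth_proj n H x) z = inner_n n x z"
proof -
  assume "z \<in> H"
  obtain u where u: "onb n (dim H) u H" using onb_exists[OF H] .
  show ?thesis unfolding orth_proj_onb[OF u] inner_n_lc inner_n_commute[of n x z] onb_Parseval[OF u \<open>z \<in> H\<close>, of x]
    by (simp add: inner_n_commute[of n "u _"] mult.commute)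
qed

lemma orth_proj_self: "x \<in> H \<Longrightarrow> orth_proj n H x = x"
  by (rule orth_proj_unique[OF H]) (simp_all add: inner_n_zero)

lemma orth_proj_linear: "linear (orth_proj n H)"
  by (rule linearI; rule orth_proj_unique[OF H])
    (auto simp: orth_proj_in inner_orth_proj inner_n_diff inner_n_add inner_n_scale
      intro!: subspace_add subspace_scale H orth_proj_in)

lemma orth_proj_trunc: "orth_proj n H (trunc n x) = orth_proj n H x"
  by (rule orth_proj_unique[OF H]) (simp_all add: orth_proj_in inner_n_trunc inner_n_diff inner_orth_proj)

text \<open>The coefficients on the right are the matrix entries that generate the sigma-algebra of
  the Grassmannian, so measurability in \<open>H\<close> and continuity in \<open>x\<close> reduce
  to a finite sum.\<close>

lemma orth_proj_coord: "orth_proj n H x j = (\<Sum>i<n. x i * orth_proj n H (ev i) j)"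
proof -
  have "orth_proj n H x = orth_proj n H (lc n ev x)" by (simp add: lc_ev orth_proj_trunc)
  also have "\<dots> = lc n (\<lambda>i. orth_proj n H (ev i)) x" by (rule linear_lc[OF orth_proj_linear])
  finally show ?thesis by (simp add: lc_def)
qed

lemma orth_proj_adjoint: "inner_n n (orth_proj n H x) y = inner_n n x (orth_proj n H y)"
  using inner_orth_proj[OF orth_proj_in, of x y] inner_orth_proj[OF orth_proj_in, of y x]
  by (simp add: inner_n_commute)

lemma orth_proj_norm: "inner_n n (orth_proj n H x) (orth_proj n H x) = inner_n n x (orth_proj n H x)"
  using inner_orth_proj[OF orth_proj_in, of x x] .

end

section \<open>Orthogonal maps of R^n and their transitivity\<close>

lemma orthogonal_mapD:
  assumes "orthogonal_map n U"
  shows "linear U" "x \<in> Rn n \<Longrightarrow> U x \<in> Rn n" "x \<in> Rn n \<Longrightarrow> y \<in> Rn n \<Longrightarrow> inner_n n (U x) (U y) = inner_n n x y"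
  using assms by (auto simp: orthogonal_map_def)

lemma orthogonal_map_lc: "onf n n u \<Longrightarrow> orthogonal_map n (lc n u)"
  unfolding orthogonal_map_def using onf_lc_Rn[of n n u]
  by (simp add: lc_linear onf_inner_lc(2) inner_n_def[symmetric] image_subset_iff)

lemma orthogonal_map_onf: "orthogonal_map n U \<Longrightarrow> onf n m u \<Longrightarrow> onf n m (\<lambda>i. U (u i))"
  by (auto simp: onf_def orthogonal_map_def)

lemma orthogonal_map_onb: "orthogonal_map n U \<Longrightarrow> onb n m u H \<Longrightarrow> onb n m (\<lambda>i. U (u i)) (U ` H)"
  unfolding onb_def using orthogonal_map_onf by (auto simp: linear_lc[OF orthogonal_mapD(1), symmetric])

lemma orthogonal_map_eq_lc:
  assumes "orthogonal_map n U" "x \<in> Rn n"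
  shows "U x = lc n (\<lambda>i. U (ev i)) x"
proof -
  have "U x = U (lc n ev x)" using assms(2) by (simp add: lc_ev trunc_Rn)
  then show ?thesis using linear_lc[OF orthogonal_mapD(1)[OF assms(1)]] by simp
qed

lemma orthogonal_map_inverse:
  assumes U: "orthogonal_map n U"
  obtains V where "orthogonal_map n V" "\<And>x. x \<in> Rn n \<Longrightarrow> V (U x) = x" "\<And>x. x \<in> Rn n \<Longrightarrow> U (V x) = x"
proof
  \<comment> \<open>The adjoint of \<open>U\<close>. The images of the standard basis form a full
    orthonormal basis by counting, which makes it an inverse on both sides.\<close>
  define V where "V = (\<lambda>y. trunc n (\<lambda>i. inner_n n y (U (ev i))))"
  have b: "onb n n (\<lambda>i. U (ev i)) (Rn n)" using onf_full[OF orthogonal_map_onf[OF U onf_ev[OF order_refl]]] .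
  show UV: "U (V x) = x" if "x \<in> Rn n" for x
  proof -
    have "U (V x) = lc n (\<lambda>i. U (ev i)) (V x)" by (rule orthogonal_map_eq_lc[OF U]) (simp add: V_def trunc_Rn)
    also have "\<dots> = lc n (\<lambda>i. U (ev i)) (\<lambda>i. inner_n n x (U (ev i)))"
      by (rule lc_cong) (auto simp: V_def trunc_def)
    also have "\<dots> = x" by (rule onb_expand[OF b that])
    finally show ?thesis .
  qed
  show "V (U x) = x" if "x \<in> Rn n" for x
  proof -
    have "inner_n n (U x) (U (ev i)) = x i" if "i < n" for i
      using orthogonal_mapD(3)[OF U \<open>x \<in> Rn n\<close> ev_Rn[OF that]] that by (simp add: inner_n_ev)
    then show ?thesis using that by (auto simp: V_def trunc_def fun_eq_iff Rn_iff)
  qed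
  have VR: "V x \<in> Rn n" for x by (simp add: V_def trunc_Rn)
  have "linear V"
    by (rule linearI) (simp_all add: V_def inner_n_add inner_n_scale, simp_all add: trunc_def fun_eq_iff fun_simps)
  moreover have "inner_n n (V x) (V y) = inner_n n x y" if "x \<in> Rn n" "y \<in> Rn n" for x y
    using orthogonal_mapD(3)[OF U VR VR, of x y] UV that by simp
  ultimately show "orthogonal_map n V" using VR by (auto simp: orthogonal_map_def)
qed

lemma orthogonal_map_comp: "orthogonal_map n U \<Longrightarrow> orthogonal_map n V \<Longrightarrow> orthogonal_map n (\<lambda>x. U (V x))"
  unfolding orthogonal_map_def using linear_compose[of V U] by (auto simp: comp_def image_subset_iff)

lemma orthogonal_map_basis_change:
  assumes "onf n n u" "onf n n v"
  obtains U where "orthogonal_map n U" "\<And>i. i < n \<Longrightarrow> U (u i) = v i"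
proof -
  obtain V where V: "orthogonal_map n V" "\<And>x. x \<in> Rn n \<Longrightarrow> V (lc n u x) = x"
    using orthogonal_map_inverse[OF orthogonal_map_lc[OF assms(1)]] by metis
  have "lc n v (V (u i)) = v i" if "i < n" for i
  proof -
    have "V (u i) = ev i" using V(2)[OF ev_Rn[OF that]] lc_ev_app[OF that] by metis
    then show ?thesis using lc_ev_app[OF that] by metis
  qed
  then show ?thesis using that orthogonal_map_comp[OF orthogonal_map_lc[OF assms(2)] V(1)] by blast
qed

lemma orth_proj_image:
  assumes U: "orthogonal_map n U" and H: "subspace H" "H \<subseteq> Rn n" and x: "x \<in> Rn n"
  shows "orth_proj n (U ` H) (U x) = U (orth_proj n H x)"
proof -
  obtain u where u: "onb n (dim H) u H" using onb_exists[OF H] .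
  have "orth_proj n (U ` H) (U x) = lc (dim H) (\<lambda>i. U (u i)) (\<lambda>i. inner_n n x (u i))"
    unfolding orth_proj_onb[OF orthogonal_map_onb[OF U u]]
    by (rule lc_cong) (use u in \<open>auto simp: orthogonal_mapD(3)[OF U x] onb_def onf_def\<close>)
  also have "\<dots> = U (orth_proj n H x)"
    unfolding orth_proj_onb[OF u] linear_lc[OF orthogonal_mapD(1)[OF U]] ..
  finally show ?thesis .
qed

text \<open>The reflection in the hyperplane orthogonal to \<open>x - y\<close>. It moves every
  vector along \<open>x - y\<close> only and so preserves each subspace that contains
  \<open>x\<close> and \<open>y\<close>; the spheres of all subspaces are thereby treated at
  once.\<close>

lemma orthogonal_map_transitive:
  assumes "x \<in> Rn n" "y \<in> Rn n" "inner_n n x x = inner_n n y y"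
  obtains U where "orthogonal_map n U" "U x = y" "\<And>H. subspace H \<Longrightarrow> x \<in> H \<Longrightarrow> y \<in> H \<Longrightarrow> U ` H = H"
proof (cases "x = y")
  case True
  have "orthogonal_map n (\<lambda>x. x)" by (auto simp: orthogonal_map_def linear_id[unfolded id_def])
  then show ?thesis using that True by auto
next
  case False
  define w where "w = x - y"
  have w: "w \<in> Rn n" unfolding w_def using assms by (intro subspace_diff subspace_Rn)
  have "w \<noteq> 0" using False by (simp add: w_def)
  then have ww: "inner_n n w w \<noteq> 0" using inner_n_eq_0 w by blast
  define U where "U = (\<lambda>z. z - (2 * inner_n n z w / inner_n n w w) *\<^sub>R w)"
  have lin: "linear U" unfolding U_def
    by (rule linearI) (auto simp: inner_n_add inner_n_scale add_divide_distrib scaleR_add_left scaleR_diff_right algebra_simps)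
  have Uw: "inner_n n (U z) w = - inner_n n z w" for z
    using ww by (simp add: U_def inner_n_diff inner_n_scale)
  have UU: "U (U z) = z" for z
    unfolding U_def[of ] using Uw[of z] ww by (simp add: U_def)
  have "inner_n n (U z) (U z') = inner_n n z z'" for z z'
  proof -
    have "inner_n n (U z) (U z') = inner_n n (U z) z' - (2 * inner_n n z' w / inner_n n w w) * inner_n n (U z) w"
      by (simp add: U_def[THEN fun_cong, of z'] inner_n_diff inner_n_scale)
    then show ?thesis unfolding Uw
      by (simp add: U_def inner_n_diff inner_n_scale inner_n_commute[of n w z'])
  qed
  moreover have UH: "U z \<in> H" if "subspace H" "x \<in> H" "y \<in> H" "z \<in> H" for H z
    unfolding U_def w_def using that by (intro subspace_diff subspace_scale) auto
  ultimately have "orthogonal_map n U"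
    unfolding orthogonal_map_def using lin subspace_Rn assms by blast
  moreover have "U x = y"
  proof -
    \<comment> \<open>Equality of the norms enters here; it makes the coefficient of the reflection
      at \<open>x\<close> equal to 1.\<close>
    have "inner_n n w w = 2 * inner_n n x w"
      using assms(3) by (simp add: w_def inner_n_diff inner_n_commute)
    then have "2 * inner_n n x w / inner_n n w w = 1" using ww by simp
    then show ?thesis by (simp add: U_def w_def)
  qed
  moreover have "U ` H = H" if "subspace H" "x \<in> H" "y \<in> H" for H
  proof -
    have "z \<in> U ` H" if "z \<in> H" for z
      using UU[of z, symmetric] UH[OF \<open>subspace H\<close> \<open>x \<in> H\<close> \<open>y \<in> H\<close> that] by (rule image_eqI)
    then show ?thesis using UH[OF that] by blast
  qed
  ultimately show ?thesis using that by blast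
qed

section \<open>Orthogonal complements\<close>

lemma lc_append: "lc (m + j) v a = lc m v a + lc j (\<lambda>i. v (m + i)) (\<lambda>i. a (m + i))"
  by (induction j) (auto simp: lc_Suc lc_0)

lemma onb_orth_compl:
  assumes u: "onb n m u H" and v: "onf n n v" "\<And>i. i < m \<Longrightarrow> v i = u i"
  shows "onb n (n - m) (\<lambda>i. v (m + i)) (orth_compl n H)"
proof -
  have m: "m \<le> n" using u onf_card_le by (auto simp: onb_def)
  have o: "onf n (n - m) (\<lambda>i. v (m + i))" using v by (auto simp: onf_def)
  have "orth_compl n H = range (lc (n - m) (\<lambda>i. v (m + i)))"
  proof (intro antisym subsetI)
    fix x assume x: "x \<in> orth_compl n H"
    then have "lc n v (\<lambda>i. inner_n n x (v i)) = x"
      by (intro onb_expand[OF onf_full[OF v(1)]]) (auto simp: orth_compl_def)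
    moreover have "lc m v (\<lambda>i. inner_n n x (v i)) = 0"
    proof -
      have "inner_n n x (v i) = 0" if "i < m" for i
        using x onb_in[OF u that] v(2)[OF that] by (auto simp: orth_compl_def inner_n_commute)
      then have "lc m v (\<lambda>i. inner_n n x (v i)) = lc m v (\<lambda>i. 0)" by (intro lc_cong) auto
      then show ?thesis by (simp add: lc_def zero_fun_def)
    qed
    ultimately have "x = lc (n - m) (\<lambda>i. v (m + i)) (\<lambda>i. inner_n n x (v (m + i)))"
      using lc_append[of m "n - m" v "\<lambda>i. inner_n n x (v i)"] m by simp
    then show "x \<in> range (lc (n - m) (\<lambda>i. v (m + i)))" by (metis rangeI)
  next
    fix x assume "x \<in> range (lc (n - m) (\<lambda>i. v (m + i)))"
    then obtain a where x: "x = lc (n - m) (\<lambda>i. v (m + i)) a" by auto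
    have "inner_n n z x = 0" if "z \<in> H" for z
    proof -
      have z: "z = lc m u (\<lambda>i. inner_n n z (u i))" using onb_expand[OF u that] by simp
      have "inner_n n (u i) x = 0" if "i < m" for i
      proof -
        have "inner_n n (v (m + l)) (v i) = 0" if "l < n - m" for l
          using v(1) that \<open>i < m\<close> m by (simp add: onf_def)
        then show ?thesis unfolding x inner_n_lc2 v(2)[OF \<open>i < m\<close>, symmetric]
          by (simp add: inner_n_commute[of n "v i"])
      qed
      then show ?thesis by (subst z) (simp add: inner_n_lc)
    qed
    then show "x \<in> orth_compl n H" using onf_lc_Rn[OF o] by (auto simp: orth_compl_def x)
  qed
  with o show ?thesis by (simp add: onb_def)
qed

lemma orth_compl_facts:
  assumes H: "subspace H" "H \<subseteq> Rn n"
  shows "subspace (orth_compl n H)" "orth_compl n H \<subseteq> Rn n" "dim (orth_compl n H) = n - dim H"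
    "orth_proj n (orth_compl n H) x = trunc n x - orth_proj n H x"
proof -
  obtain u where u: "onb n (dim H) u H" using onb_exists[OF H] .
  obtain v where v: "onf n n v" "\<And>i. i < dim H \<Longrightarrow> v i = u i"
    using onf_extend_full u unfolding onb_def by metis
  note b = onb_orth_compl[OF u v]
  show s: "subspace (orth_compl n H)" and r: "orth_compl n H \<subseteq> Rn n" using onb_subspace[OF b] by auto
  show "dim (orth_compl n H) = n - dim H" using onb_dim[OF b] .
  show "orth_proj n (orth_compl n H) x = trunc n x - orth_proj n H x"
  proof (rule orth_proj_unique[OF s r])
    show "trunc n x - orth_proj n H x \<in> orth_compl n H"
      unfolding orth_compl_def
    proof (intro CollectI conjI ballI)
      show "trunc n x - orth_proj n H x \<in> Rn n"
        by (rule subspace_diff[OF subspace_Rn trunc_Rn(1) orth_proj_in_Rn[OF H]])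
      fix z assume "z \<in> H"
      then show "inner_n n z (trunc n x - orth_proj n H x) = 0"
        unfolding inner_n_commute[of n z] by (simp add: inner_n_diff inner_n_trunc inner_orth_proj[OF H])
    qed
    fix z assume "z \<in> orth_compl n H"
    then show "inner_n n (x - (trunc n x - orth_proj n H x)) z = 0"
      using orth_proj_in[OF H] by (auto simp: inner_n_diff inner_n_trunc orth_compl_def)
  qed
qed

section \<open>Principal vectors of a subspace relative to R^k\<close>

lemma continuous_on_nth:
  fixes f :: "'a :: topological_space \<Rightarrow> nat \<Rightarrow> real"
  shows "continuous_on S f \<Longrightarrow> continuous_on S (\<lambda>x. f x i)"
  by (rule continuous_on_product_then_coordinatewise)

lemma continuous_on_inner_n:
  fixes f :: "'a :: topological_space \<Rightarrow> nat \<Rightarrow> real"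
  shows "continuous_on S f \<Longrightarrow> continuous_on S g \<Longrightarrow> continuous_on S (\<lambda>x. inner_n n (f x) (g x))"
  unfolding inner_n_def by (intro continuous_on_sum continuous_on_mult) (rule continuous_on_nth, assumption)+

lemma continuous_on_orth_proj:
  assumes "subspace H" "H \<subseteq> Rn n"
  shows "continuous_on S (orth_proj n H)"
proof (rule continuous_on_coordinatewise_then_product)
  fix j
  show "continuous_on S (\<lambda>x. orth_proj n H x j)"
    by (subst orth_proj_coord[OF assms]) (intro continuous_on_sum continuous_on_mult continuous_on_const continuous_on_nth[OF continuous_on_id])
qed

lemma closed_Rn: "closed (Rn k)"
proof -
  have "Rn k = (\<Inter>i\<in>{k..}. {x. x i = 0})" by (auto simp: Rn_iff)
  moreover have "closed {x :: nat \<Rightarrow> real. x i = 0}" for i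
    by (intro closed_Collect_eq continuous_on_const continuous_on_product_coordinates)
  ultimately show ?thesis by auto
qed

text \<open>Unit vectors of \<open>Rn k\<close> have all entries between -1 and 1, so this closed
  set sits in a product of intervals, which is compact by Tychonoff's theorem.\<close>

lemma compact_sphere_section:
  "compact {x \<in> Rn k. inner_n n x x = 1 \<and> (\<forall>l<j. inner_n n x (v l) = 0)}" if "k \<le> n"
proof -
  let ?S = "{x \<in> Rn k. inner_n n x x = 1 \<and> (\<forall>l<j. inner_n n x (v l) = 0)}"
  let ?B = "PiE (UNIV :: nat set) (\<lambda>_. {-1..1 :: real})"
  have "compactin (product_topology (\<lambda>_. euclidean) UNIV) ?B"
    unfolding compactin_PiE by simp
  then have "compact ?B"
    unfolding euclidean_product_topology compactin_euclidean_iff .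
  moreover have "closed ?S"
  proof -
    have "?S = Rn k \<inter> {x. inner_n n x x = 1} \<inter> (\<Inter>l\<in>{..<j}. {x. inner_n n x (v l) = 0})" by auto
    moreover have "closed {x. inner_n n x x = 1}" "closed {x. inner_n n x (v l) = 0}" for l
      by (intro closed_Collect_eq continuous_on_inner_n continuous_on_const continuous_on_id)+
    ultimately show ?thesis using closed_Rn by (simp add: closed_Int closed_INT)
  qed
  moreover have "?S \<subseteq> ?B"
  proof
    fix x assume x: "x \<in> ?S"
    have "\<bar>x i\<bar> \<le> 1" for i
    proof (cases "i < n")
      case True
      have "(x i)\<^sup>2 \<le> (\<Sum>i<n. (x i)\<^sup>2)" using True by (intro member_le_sum) auto
      also have "\<dots> = 1" using x by (simp add: inner_n_def power2_eq_square)
      finally show ?thesis by (simp add: abs_square_le_1)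
    next
      case False then show ?thesis using x that by (auto simp: Rn_iff)
    qed
    then show "x \<in> ?B" by (auto simp: abs_le_iff minus_le_iff)
  qed
  ultimately show ?thesis using compact_Int_closed[of ?B ?S] by (simp only: Int_absorb1)
qed

text \<open>The first-order condition at a maximum, without derivatives: for small \<open>t\<close>
  the linear term would win unless \<open>b = 0\<close>.\<close>

lemma linear_le_quadratic_imp_0:
  assumes "\<And>t :: real. 2 * t * b \<le> t\<^sup>2 * c"
  shows "b = 0"
proof (rule ccontr)
  assume "b \<noteq> 0"
  define d where "d = \<bar>c\<bar> + 1"
  have d: "d > 0" "c < d" by (auto simp: d_def)
  have "2 * (b / d) * b \<le> (b / d)\<^sup>2 * c" by (rule assms)
  also have "\<dots> \<le> (b / d)\<^sup>2 * d" using d by (intro mult_left_mono) auto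
  also have "\<dots> = b * b / d" using d by (simp add: power2_eq_square)
  finally have "b * b / d \<le> 0" by simp
  moreover have "b * b > 0" using \<open>b \<noteq> 0\<close> by (metis not_real_square_gt_zero)
  ultimately show False using d by (simp add: divide_le_0_iff)
qed

text \<open>The vectors diagonalise the compression to \<open>\<real>\<^sup>k\<close> of the projection onto \<open>H\<close>. They are found one after
  the other by maximising the quadratic form on the unit vectors orthogonal to the previous ones.\<close>

lemma principal_vectors:
  assumes H: "subspace H" "H \<subseteq> Rn n" and k: "k \<le> n"
  obtains v where "onb n k v (Rn k)" "\<And>i j. i < k \<Longrightarrow> j < k \<Longrightarrow> i \<noteq> j \<Longrightarrow> inner_n n (orth_proj n H (v i)) (v j) = 0"
proof -
  define B where "B x y = inner_n n (orth_proj n H x) y" for x y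
  have Bc: "B x y = B y x" for x y
    using orth_proj_adjoint[OF H, of x y] by (simp add: B_def inner_n_commute)
  have Badd: "B (x + y) z = B x z + B y z" "B z (x + y) = B z x + B z y"
    and Bsc: "B (c *\<^sub>R x) z = c * B x z" "B z (c *\<^sub>R x) = c * B z x" for x y z c
    by (simp_all add: B_def linear_add[OF orth_proj_linear[OF H]] linear_scale[OF orth_proj_linear[OF H]]
        inner_n_add inner_n_scale)
  define V where "V j v = {x \<in> Rn k. \<forall>l<j. inner_n n x (v l) = 0}" for j :: nat and v
  have Vs: "subspace (V j v)" for j v
    unfolding V_def using subspace_Rn[of k]
    by (auto simp: subspace_def inner_n_zero inner_n_add inner_n_scale)
  \<comment> \<open>The third conjunct carries the induction: the next vector is chosen in
    \<open>V j v\<close> and is therefore \<open>B\<close>-orthogonal to all earlier ones.\<close>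
  have "\<exists>v. onf n j v \<and> (\<forall>i<j. v i \<in> Rn k) \<and> (\<forall>i<j. \<forall>x\<in>V j v. B (v i) x = 0) \<and>
      (\<forall>i<j. \<forall>l<j. i \<noteq> l \<longrightarrow> B (v i) (v l) = 0)" if "j \<le> k" for j
    using that
  proof (induction j)
    case 0
    then show ?case by (auto simp: onf_def)
  next
    case (Suc j)
    then obtain v where v: "onf n j v" "\<And>i. i < j \<Longrightarrow> v i \<in> Rn k"
      "\<And>i x. i < j \<Longrightarrow> x \<in> V j v \<Longrightarrow> B (v i) x = 0"
      "\<And>i l. i < j \<Longrightarrow> l < j \<Longrightarrow> i \<noteq> l \<Longrightarrow> B (v i) (v l) = 0"
      by (metis Suc_leD)
    define S where "S = {x \<in> Rn k. inner_n n x x = 1 \<and> (\<forall>l<j. inner_n n x (v l) = 0)}"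
    have SV: "x \<in> S \<longleftrightarrow> x \<in> V j v \<and> inner_n n x x = 1" for x by (auto simp: S_def V_def)
    have cS: "compact S" unfolding S_def by (rule compact_sphere_section[OF k])
    have Rk: "Rn k \<subseteq> Rn n" using k by simp
    obtain v' where v': "onb n k v' (Rn k)" "\<forall>i<j. v' i = v i"
      using onf_extend[OF subspace_Rn Rk v(1,2)] by (auto simp: dim_Rn)
    have "v' j \<in> S"
    proof -
      have jk: "j < k" using Suc.prems by simp
      have "inner_n n (v' j) (v' l) = 0" if "l < j" for l
        using v'(1) jk that by (simp add: onb_def onf_def)
      then show ?thesis unfolding S_def using v' jk onb_in[OF v'(1) jk] by (auto simp: onb_def onf_def)
    qed
    moreover have "continuous_on S (\<lambda>x. B x x)"
      unfolding B_def by (intro continuous_on_inner_n continuous_on_orth_proj[OF H] continuous_on_id)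
    ultimately have "\<exists>w\<in>S. \<forall>y\<in>S. B y y \<le> B w w"
      by (intro continuous_attains_sup cS) auto
    then obtain w where w: "w \<in> S" "\<And>y. y \<in> S \<Longrightarrow> B y y \<le> B w w" by blast
    \<comment> \<open>By homogeneity the maximum over unit vectors becomes an inequality for all
      vectors of \<open>V j v\<close>, in which one may move away from \<open>w\<close> along a
      line.\<close>
    have max: "B y y \<le> B w w * inner_n n y y" if "y \<in> V j v" for y
    proof (cases "y = 0")
      case True then show ?thesis by (simp add: B_def inner_n_zero)
    next
      case False
      have yR: "y \<in> Rn n" using that Rn_mono[OF k] by (auto simp: V_def)
      have p: "inner_n n y y > 0" using inner_n_eq_0[OF yR] inner_n_nonneg[of n y] False by simp
      define c where "c = 1 / sqrt (inner_n n y y)"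
      have c: "c * c * inner_n n y y = 1" using p by (simp add: c_def)
      have "c *\<^sub>R y \<in> S" unfolding SV using subspace_scale[OF Vs that] c by (simp add: inner_n_scale mult.assoc)
      from w(2)[OF this] have "c * c * B y y \<le> B w w" by (simp add: Bsc mult.assoc)
      then have "(c * c * B y y) * inner_n n y y \<le> B w w * inner_n n y y" using p by simp
      then show ?thesis using c by (metis mult.assoc mult.commute mult.right_neutral)
    qed
    have crit: "B w x = 0" if x: "x \<in> V j v" "inner_n n x w = 0" for x
    proof (rule linear_le_quadratic_imp_0)
      fix t :: real
      have "w + t *\<^sub>R x \<in> V j v" using w(1) x SV Vs by (intro subspace_add subspace_scale) auto
      from max[OF this] have "B w w + 2 * t * B w x + t\<^sup>2 * B x x \<le> B w w * (1 + t\<^sup>2 * inner_n n x x)"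
        using x(2) w(1) by (simp add: Badd Bsc SV inner_n_add inner_n_scale inner_n_commute[of n w x] Bc[of x w] power2_eq_square algebra_simps)
      then show "2 * t * B w x \<le> t\<^sup>2 * (B w w * inner_n n x x - B x x)"
        by (simp add: algebra_simps)
    qed
    define v1 where "v1 = v(j := w)"
    have wV: "w \<in> V j v" "inner_n n w w = 1" using w SV by auto
    have V1: "x \<in> V (Suc j) v1 \<longleftrightarrow> x \<in> V j v \<and> inner_n n x w = 0" for x
      by (auto simp: V_def v1_def less_Suc_eq)
    have a: "onf n (Suc j) v1"
      unfolding onf_def
    proof (intro conjI allI impI)
      fix i assume "i < Suc j" then show "v1 i \<in> Rn n" using wV Rn_mono[OF k] v(1) by (auto simp: V_def v1_def onf_def)
    next
      fix i l assume il: "i < Suc j" "l < Suc j"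
      have 1: "inner_n n (v1 j) (v1 j) = 1" using wV by (simp add: v1_def)
      have 2: "inner_n n (v1 j) (v1 i) = 0" "inner_n n (v1 i) (v1 j) = 0" if "i < j" for i
        using wV that by (auto simp: v1_def V_def inner_n_commute[of n "v i"])
      have 3: "inner_n n (v1 i) (v1 l) = (if i = l then 1 else 0)" if "i < j" "l < j" for i l
        using v(1) that by (simp add: v1_def onf_def)
      show "inner_n n (v1 i) (v1 l) = (if i = l then 1 else 0)"
        using il by (elim less_SucE) (simp_all add: 1 2 3)
    qed
    have b: "\<forall>i<Suc j. v1 i \<in> Rn k" using wV v(2) by (auto simp: V_def v1_def less_Suc_eq)
    have c: "\<forall>i<Suc j. \<forall>x\<in>V (Suc j) v1. B (v1 i) x = 0"
    proof (intro allI impI ballI)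
      fix i x assume i: "i < Suc j" and "x \<in> V (Suc j) v1"
      then have "x \<in> V j v" "inner_n n x w = 0" unfolding V1 by auto
      then show "B (v1 i) x = 0" using crit v(3) i by (cases "i = j") (auto simp: v1_def)
    qed
    have d: "\<forall>i<Suc j. \<forall>l<Suc j. i \<noteq> l \<longrightarrow> B (v1 i) (v1 l) = 0"
    proof -
      have "B (v i) w = 0" "B w (v i) = 0" if "i < j" for i
        using v(3)[OF that wV(1)] Bc[of w "v i"] by simp_all
      then show ?thesis using v(4) by (auto simp: v1_def less_Suc_eq)
    qed
    show ?case using a b c d by blast
  qed
  from this[OF order_refl] obtain v where v: "onf n k v" "\<And>i. i < k \<Longrightarrow> v i \<in> Rn k"
      "\<And>i l. i < k \<Longrightarrow> l < k \<Longrightarrow> i \<noteq> l \<Longrightarrow> B (v i) (v l) = 0" by auto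
  have Rk: "Rn k \<subseteq> Rn n" using k by simp
  obtain v' where v': "onb n k v' (Rn k)" "\<forall>i<k. v' i = v i"
      using onf_extend[OF subspace_Rn Rk v(1,2)] by (auto simp: dim_Rn)
  then have "inner_n n (orth_proj n H (v' i)) (v' j) = 0" if "i < k" "j < k" "i \<noteq> j" for i j
    using v(3) that by (simp add: B_def)
  with v'(1) that show ?thesis by blast
qed

section \<open>Gaussian measures\<close>

definition gden :: "nat \<Rightarrow> (nat \<Rightarrow> real) \<Rightarrow> real" where
  "gden n x = (\<Prod>i<n. std_normal_density (x i))"

lemma gden_eq: "gden n x = (1 / sqrt (2 * pi)) ^ n * exp (- inner_n n x x / 2)"
proof -
  have "gden n x = (1 / sqrt (2 * pi)) ^ n * (\<Prod>i<n. exp (- (x i)\<^sup>2 / 2))"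
    by (simp add: gden_def std_normal_density_def prod.distrib prod_constant power_divide prod_dividef)
  also have "(\<Prod>i<n. exp (- (x i)\<^sup>2 / 2)) = exp (- inner_n n x x / 2)"
    by (simp add: exp_sum[symmetric] inner_n_def power2_eq_square sum_negf sum_divide_distrib)
  finally show ?thesis .
qed

lemma gden_nonneg: "gden n x \<ge> 0"
  by (simp add: gden_eq)

lemma measurable_inner_n [measurable (raw)]:
  assumes [measurable]: "f \<in> borel_measurable M" "g \<in> borel_measurable M"
  shows "(\<lambda>x. inner_n n (f x) (g x)) \<in> borel_measurable M"
  unfolding inner_n_def by measurable

lemma measurable_gden [measurable]: "gden n \<in> borel_measurable borel"
  unfolding gden_eq by measurable

lemma measurable_lc [measurable (raw)]:
  assumes [measurable]: "f \<in> borel_measurable M"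
  shows "(\<lambda>x. lc m u (f x)) \<in> borel_measurable M"
  unfolding lc_def by (rule measurable_seqI) measurable

lemma measurable_add_seq [measurable (raw)]:
  fixes f g :: "'a \<Rightarrow> nat \<Rightarrow> real"
  assumes [measurable]: "f \<in> borel_measurable M" "g \<in> borel_measurable M"
  shows "(\<lambda>x. f x + g x) \<in> borel_measurable M" "(\<lambda>x. f x - g x) \<in> borel_measurable M"
  by (rule measurable_seqI; simp add: fun_simps)+

lemma measurable_scaleR_seq [measurable (raw)]:
  fixes g :: "'a \<Rightarrow> nat \<Rightarrow> real"
  assumes [measurable]: "f \<in> borel_measurable M" "g \<in> borel_measurable M"
  shows "(\<lambda>x. f x *\<^sub>R g x) \<in> borel_measurable M"
  by (rule measurable_seqI) (simp add: fun_simps)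

lemma nn_integral_gden: "(\<integral>\<^sup>+x. gden n x \<partial>leb n) = 1"
proof -
  have "(\<integral>\<^sup>+x. gden n x \<partial>leb n) = (\<integral>\<^sup>+x. (\<Prod>i<n. ennreal (std_normal_density (x i))) \<partial>leb n)"
    by (simp add: gden_def prod_ennreal)
  also have "\<dots> = (\<Prod>i<n. \<integral>\<^sup>+t. ennreal (std_normal_density t) \<partial>lborel)"
    by (rule nn_integral_leb_prod) measurable
  also have "(\<integral>\<^sup>+t. ennreal (std_normal_density t) \<partial>lborel) = 1"
    by (subst nn_integral_eq_integral) (use integral_normal_density[of 1 0] integrable_normal_density[of 1 0] in auto)
  finally show ?thesis by simp
qed

lemma borel_Rn [measurable]: "Rn n \<in> sets borel"
  using closed_Rn by (rule borel_closed)

lemma AE_leb_Rn: "AE x in leb n. x \<in> Rn n"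
proof (rule AE_I')
  have "emeasure (leb n) (- Rn n) = (\<integral>\<^sup>+x. indicator (- Rn n) (trunc n x) \<partial>leb n)"
    by (subst nn_integral_leb_trunc) auto
  then show "- Rn n \<in> null_sets (leb n)" by (auto simp: trunc_Rn null_sets_def)
qed auto

text \<open>As in the proof that Haar measure is unique: insert a translated Gaussian density of mass 1, which
  orthogonal maps preserve, and exchange the integrals. No determinants are needed.\<close>

lemma nn_integral_leb_orthogonal:
  assumes u: "onf n n u" and [measurable]: "F \<in> borel_measurable borel"
  shows "(\<integral>\<^sup>+x. F (lc n u x) \<partial>leb n) = (\<integral>\<^sup>+x. F x \<partial>leb n)"
proof -
  interpret P: pair_sigma_finite "leb n" "leb n"
    by (intro pair_sigma_finite.intro sigma_finite_leb)
  let ?g = "\<lambda>x. ennreal (gden n x)"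
  have g_lc: "gden n (- lc n u x) = gden n x" for x
    using inner_n_scale[of n "-1"] onf_inner_lc(2)[OF u] by (simp add: gden_eq) (simp add: inner_n_def)
  have "(\<integral>\<^sup>+x. F (lc n u x) \<partial>leb n) = (\<integral>\<^sup>+x. F (lc n u x) * (\<integral>\<^sup>+y. ?g (y + - lc n u x) \<partial>leb n) \<partial>leb n)"
    by (subst nn_integral_leb_translate) (auto simp: nn_integral_gden intro: subspace_neg[OF subspace_Rn] onf_lc_Rn[OF u])
  also have "\<dots> = (\<integral>\<^sup>+x. \<integral>\<^sup>+y. F (lc n u x) * ?g (y - lc n u x) \<partial>leb n \<partial>leb n)"
    by (intro nn_integral_cong) (simp add: nn_integral_cmult)
  also have "\<dots> = (\<integral>\<^sup>+y. \<integral>\<^sup>+x. F (lc n u x) * ?g (y - lc n u x) \<partial>leb n \<partial>leb n)"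
    by (subst P.Fubini') simp_all
  also have "\<dots> = (\<integral>\<^sup>+y. \<integral>\<^sup>+x. F (y + lc n u x) * ?g x \<partial>leb n \<partial>leb n)"
  proof (intro nn_integral_cong_AE, use AE_leb_Rn[of n] in eventually_elim)
    fix y assume y: "y \<in> Rn n"
    \<comment> \<open>The preimage of \<open>y\<close>: shifting \<open>x\<close> by
      \<open>a\<close> turns \<open>y - lc n u x\<close> into \<open>- lc n u x\<close>.\<close>
    define a where "a = trunc n (\<lambda>i. inner_n n y (u i))"
    have a: "a \<in> Rn n" "lc n u a = y"
      using onb_expand[OF onf_full[OF u] y] lc_cong[of n u u a "\<lambda>i. inner_n n y (u i)"] by (simp_all only: a_def trunc_Rn) (simp add: trunc_def)
    have "(\<integral>\<^sup>+x. F (lc n u x) * ?g (y - lc n u x) \<partial>leb n) = (\<integral>\<^sup>+x. F (lc n u (x + a)) * ?g (y - lc n u (x + a)) \<partial>leb n)"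
      by (subst nn_integral_leb_translate[OF _ a(1), symmetric]) simp_all
    also have "\<dots> = (\<integral>\<^sup>+x. F (y + lc n u x) * ?g x \<partial>leb n)"
      by (simp add: lc_add a g_lc add.commute)
    finally show "(\<integral>\<^sup>+x. F (lc n u x) * ?g (y - lc n u x) \<partial>leb n) = (\<integral>\<^sup>+x. F (y + lc n u x) * ?g x \<partial>leb n)" .
  qed
  also have "\<dots> = (\<integral>\<^sup>+x. \<integral>\<^sup>+y. F (y + lc n u x) * ?g x \<partial>leb n \<partial>leb n)"
    by (subst P.Fubini') simp_all
  also have "\<dots> = (\<integral>\<^sup>+x. (\<integral>\<^sup>+y. F y \<partial>leb n) * ?g x \<partial>leb n)"
    by (simp add: nn_integral_multc nn_integral_leb_translate onf_lc_Rn[OF u])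
  also have "\<dots> = (\<integral>\<^sup>+x. F x \<partial>leb n)"
    by (simp add: nn_integral_cmult nn_integral_gden)
  finally show ?thesis .
qed

definition gauss :: "nat \<Rightarrow> (nat \<Rightarrow> real) measure" where
  "gauss n = density (leb n) (\<lambda>x. ennreal (gden n x))"

lemma sets_gauss [simp, measurable_cong]: "sets (gauss n) = sets borel"
  and space_gauss [simp]: "space (gauss n) = UNIV"
  by (simp_all add: gauss_def)

lemma nn_integral_gauss:
  fixes F :: "_ \<Rightarrow> ennreal"
  shows "F \<in> borel_measurable borel \<Longrightarrow> (\<integral>\<^sup>+x. F x \<partial>gauss n) = (\<integral>\<^sup>+x. gden n x * F x \<partial>leb n)"
  unfolding gauss_def by (subst nn_integral_density) simp_all

lemma prob_space_gauss: "prob_space (gauss n)"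
proof
  have "emeasure (gauss n) (space (gauss n)) = (\<integral>\<^sup>+x. 1 \<partial>gauss n)" by simp
  also have "\<dots> = 1" by (subst nn_integral_gauss) (simp_all add: nn_integral_gden)
  finally show "emeasure (gauss n) (space (gauss n)) = 1" .
qed

lemma AE_gauss_Rn: "AE x in gauss n. x \<in> Rn n"
  unfolding gauss_def by (subst AE_density) (use AE_leb_Rn[of n] in auto)

lemma nn_integral_gauss_orthogonal:
  assumes u: "onf n n u" and [measurable]: "F \<in> borel_measurable borel"
  shows "(\<integral>\<^sup>+x. F (lc n u x) \<partial>gauss n) = (\<integral>\<^sup>+x. F x \<partial>gauss n)"
proof -
  have "gden n (lc n u x) = gden n x" for x
    using onf_inner_lc(2)[OF u] by (simp add: gden_eq) (simp add: inner_n_def)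
  then show ?thesis
    using nn_integral_leb_orthogonal[OF u, of "\<lambda>x. gden n x * F x"] by (simp add: nn_integral_gauss)
qed

lemma nn_integral_gauss_add:
  assumes [measurable]: "F \<in> borel_measurable borel"
  shows "(\<integral>\<^sup>+x. F x \<partial>gauss (k + j)) = (\<integral>\<^sup>+x. \<integral>\<^sup>+y. F (append_n k x y) \<partial>gauss j \<partial>gauss k)"
proof -
  have *: "gden (k + j) (append_n k x y) = gden k x * gden j y" for x y
    unfolding gden_def append_n_def by (induction j) simp_all
  interpret prob_space "gauss j" by (rule prob_space_gauss)
  interpret L: sigma_finite_measure "leb j" by (rule sigma_finite_leb)
  show ?thesis
    by (simp add: nn_integral_gauss nn_integral_leb_add * ennreal_mult gden_nonneg mult.assoc nn_integral_cmult)
qed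

lemma nn_integral_gauss_prod:
  fixes h :: "nat \<Rightarrow> real \<Rightarrow> ennreal"
  assumes [measurable]: "\<And>i. i < n \<Longrightarrow> h i \<in> borel_measurable borel"
  shows "(\<integral>\<^sup>+x. (\<Prod>i<n. h i (x i)) \<partial>gauss n) = (\<Prod>i<n. \<integral>\<^sup>+t. std_normal_density t * h i t \<partial>lborel)"
proof -
  have "(\<integral>\<^sup>+x. (\<Prod>i<n. h i (x i)) \<partial>gauss n) = (\<integral>\<^sup>+x. (\<Prod>i<n. ennreal (std_normal_density (x i)) * h i (x i)) \<partial>leb n)"
    by (subst nn_integral_gauss) (simp_all add: gden_def prod_ennreal prod.distrib)
  also have "\<dots> = (\<Prod>i<n. \<integral>\<^sup>+t. std_normal_density t * h i t \<partial>lborel)"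
  proof (rule nn_integral_leb_prod)
    fix i assume "i < n"
    then have [measurable]: "h i \<in> borel_measurable borel" by (rule assms)
    show "(\<lambda>t. ennreal (std_normal_density t) * h i t) \<in> borel_measurable borel" by measurable
  qed
  finally show ?thesis .
qed

lemma nn_integral_std_normal_exp_square:
  assumes "c < 1 / 2"
  shows "(\<integral>\<^sup>+t. ennreal (std_normal_density t) * ennreal (exp (c * t\<^sup>2)) \<partial>lborel) = ennreal (1 / sqrt (1 - 2 * c))"
proof -
  \<comment> \<open>Multiplied by \<open>exp (c * t\<^sup>2)\<close>, the standard normal density
    becomes \<open>s\<close> times the centred normal density of standard deviation
    \<open>s\<close>.\<close>
  define s where "s = 1 / sqrt (1 - 2 * c)"
  have s: "s > 0" "s\<^sup>2 = 1 / (1 - 2 * c)" using assms by (auto simp: s_def power_divide)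
  have "std_normal_density t * exp (c * t\<^sup>2) = s * normal_density 0 s t" for t
  proof -
    have "exp (- t\<^sup>2 / 2) * exp (c * t\<^sup>2) = exp (- t\<^sup>2 / (2 * s\<^sup>2))"
      unfolding exp_add[symmetric] s(2) using assms by (simp add: field_simps)
    then show ?thesis using s(1)
      by (simp add: std_normal_density_def normal_density_def real_sqrt_mult)
  qed
  then have "(\<integral>\<^sup>+t. ennreal (std_normal_density t) * ennreal (exp (c * t\<^sup>2)) \<partial>lborel) = (\<integral>\<^sup>+t. ennreal s * ennreal (normal_density 0 s t) \<partial>lborel)"
    using s by (simp add: ennreal_mult[symmetric])
  also have "\<dots> = ennreal s * 1"
    using s by (subst nn_integral_cmult) (auto simp: nn_integral_eq_integral integrable_normal_density integral_normal_density)
  finally show ?thesis by (simp add: s_def)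
qed

lemma nn_integral_gauss_exp_square:
  assumes "\<And>i. i < n \<Longrightarrow> c i < 1 / 2"
  shows "(\<integral>\<^sup>+x. ennreal (exp (\<Sum>i<n. c i * (x i)\<^sup>2)) \<partial>gauss n) = ennreal (\<Prod>i<n. 1 / sqrt (1 - 2 * c i))"
proof -
  have "(\<integral>\<^sup>+x. ennreal (exp (\<Sum>i<n. c i * (x i)\<^sup>2)) \<partial>gauss n) = (\<integral>\<^sup>+x. (\<Prod>i<n. ennreal (exp (c i * (x i)\<^sup>2))) \<partial>gauss n)"
    by (simp add: exp_sum prod_ennreal)
  also have "\<dots> = (\<Prod>i<n. ennreal (1 / sqrt (1 - 2 * c i)))"
    by (subst nn_integral_gauss_prod, measurable)
      (intro prod.cong refl nn_integral_std_normal_exp_square assms, simp)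
  also have "\<dots> = ennreal (\<Prod>i<n. 1 / sqrt (1 - 2 * c i))"
  proof (rule prod_ennreal)
    fix i assume "i \<in> {..<n}"
    then show "0 \<le> 1 / sqrt (1 - 2 * c i)" using assms[of i] by simp
  qed
  finally show ?thesis .
qed

text \<open>By rotation invariance \<open>v\<close> may be taken to be the first basis vector; the
  exceptional set then confines one coordinate to a point, which is a null set of the line.\<close>

lemma AE_gauss_inner_nonzero:
  assumes v: "v \<in> Rn n" "inner_n n v v = 1"
  shows "AE x in gauss n. inner_n n x v \<noteq> 0"
proof -
  have n: "0 < n" using v(2) by (cases n) (auto simp: inner_n_def)
  have "onf n 1 (\<lambda>_. v)" using v by (auto simp: onf_def)
  then obtain u where u: "onf n n u" "u 0 = v" using onf_extend_full by (metis less_one)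
  have meas: "{x. inner_n n x v = 0} \<in> sets borel" by measurable
  have "emeasure (gauss n) {x. inner_n n x v = 0} = (\<integral>\<^sup>+x. indicator {x. inner_n n x v = 0} (lc n u x) \<partial>gauss n)"
    using meas by (subst nn_integral_gauss_orthogonal[OF u(1)]) simp_all
  also have "\<dots> = (\<integral>\<^sup>+x. (\<Prod>i<n. if i = 0 then indicator {0} (x i) else 1 :: ennreal) \<partial>gauss n)"
  proof (intro nn_integral_cong)
    fix x
    show "indicator {x. inner_n n x v = 0} (lc n u x) = (\<Prod>i<n. if i = 0 then indicator {0} (x i) else 1 :: ennreal)"
      using onf_inner_lc(1)[OF u(1) n, of x] n by (simp add: u(2) prod.If_cases indicator_def)
  qed
  also have "\<dots> = (\<Prod>i<n. \<integral>\<^sup>+t. std_normal_density t * (if i = 0 then indicator {0} t else 1 :: ennreal) \<partial>lborel)"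
    by (rule nn_integral_gauss_prod) simp
  also have "\<dots> = 0"
  proof (rule prod_zero)
    have "(\<integral>\<^sup>+t. ennreal (std_normal_density t) * indicator {0} t \<partial>lborel) = 0"
      by (subst nn_integral_indicator_singleton) simp_all
    then show "\<exists>i\<in>{..<n}. (\<integral>\<^sup>+t. std_normal_density t * (if i = 0 then indicator {0} t else 1 :: ennreal) \<partial>lborel) = 0"
      using n by (intro bexI[of _ 0]) auto
  qed simp
  finally show ?thesis using meas by (subst AE_iff_null) (auto simp: null_sets_def)
qed

section \<open>Uniqueness of invariant probability measures\<close>

text \<open>The sigma-algebra on \<open>X\<close> is pulled back along the embedding \<open>\<iota>\<close>; \<open>D\<close> plays the role of an invariant
  metric, which has to dominate the metric of the ambient space only up to the factor \<open>L\<close>.\<close>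

locale transitive_isometries =
  fixes X :: "'a set" and \<iota> :: "'a \<Rightarrow> 'b :: {metric_space, second_countable_topology}"
    and D :: "'b \<Rightarrow> 'b \<Rightarrow> real" and \<T> :: "('a \<Rightarrow> 'a) set" and L :: real
  assumes D_cont: "continuous_on UNIV (\<lambda>p. D (fst p) (snd p))"
    and D_sym: "D a b = D b a" and D_self: "D a a = 0" and D_nonneg: "D a b \<ge> 0"
    and D_dist: "x \<in> X \<Longrightarrow> y \<in> X \<Longrightarrow> dist (\<iota> x) (\<iota> y) \<le> L * D (\<iota> x) (\<iota> y)" and L_pos: "L > 0"
    and isom_measurable: "T \<in> \<T> \<Longrightarrow> T \<in> vimage_algebra X \<iota> borel \<rightarrow>\<^sub>M vimage_algebra X \<iota> borel"
    and isom: "T \<in> \<T> \<Longrightarrow> x \<in> X \<Longrightarrow> y \<in> X \<Longrightarrow> D (\<iota> (T x)) (\<iota> (T y)) = D (\<iota> x) (\<iota> y)"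
    and transitive: "x \<in> X \<Longrightarrow> y \<in> X \<Longrightarrow> \<exists>T\<in>\<T>. T x = y"
begin

definition invariant_prob :: "'a measure \<Rightarrow> bool" where
  "invariant_prob M \<longleftrightarrow> prob_space M \<and> sets M = sets (vimage_algebra X \<iota> borel) \<and> (\<forall>T\<in>\<T>. distr M M T = M)"

lemma invariant_probD:
  assumes "invariant_prob M"
  shows "prob_space M" "sets M = sets (vimage_algebra X \<iota> borel)" "T \<in> \<T> \<Longrightarrow> distr M M T = M"
    "space M = X" "\<iota> \<in> borel_measurable M" "T \<in> \<T> \<Longrightarrow> T \<in> M \<rightarrow>\<^sub>M M"
proof -
  show *: "prob_space M" "sets M = sets (vimage_algebra X \<iota> borel)" "T \<in> \<T> \<Longrightarrow> distr M M T = M"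
    using assms by (auto simp: invariant_prob_def)
  show "space M = X" using sets_eq_imp_space_eq[OF *(2)] by simp
  have "\<iota> \<in> borel_measurable (vimage_algebra X \<iota> borel)" by (rule measurable_vimage_algebra1) simp
  then show "\<iota> \<in> borel_measurable M" using measurable_cong_sets[OF *(2) refl] by blast
  show "T \<in> \<T> \<Longrightarrow> T \<in> M \<rightarrow>\<^sub>M M"
    using isom_measurable measurable_cong_sets[OF *(2) *(2)] by blast
qed

text \<open>Integrals of the kernel over an invariant measure do not depend on the centre and vanish for no
  \<open>\<epsilon> > 0\<close>. Averaging a Lipschitz function over small balls with this kernel therefore compares any
  two invariant measures.\<close>

definition K :: "real \<Rightarrow> 'a \<Rightarrow> 'a \<Rightarrow> ennreal" where
  "K \<epsilon> x y = ennreal (max 0 (\<epsilon> - D (\<iota> x) (\<iota> y)))"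

lemma K_sym: "K \<epsilon> x y = K \<epsilon> y x"
  by (simp add: K_def D_sym)

lemma measurable_K:
  assumes "f \<in> borel_measurable M" "g \<in> borel_measurable M"
  shows "(\<lambda>p. ennreal (max 0 (\<epsilon> - D (f p) (g p)))) \<in> borel_measurable M"
proof -
  have "(\<lambda>p. D (fst p) (snd p)) \<in> borel_measurable (borel \<Otimes>\<^sub>M borel)"
    unfolding borel_prod by (rule borel_measurable_continuous_onI[OF D_cont])
  from measurable_compose[OF measurable_Pair[OF assms] this]
  have [measurable]: "(\<lambda>p. D (f p) (g p)) \<in> borel_measurable M" by simp
  show ?thesis by measurable
qed

lemma K_integral_const:
  assumes M: "invariant_prob M" and x: "x \<in> X" "y \<in> X"
  shows "(\<integral>\<^sup>+z. K \<epsilon> z y \<partial>M) = (\<integral>\<^sup>+z. K \<epsilon> z x \<partial>M)"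
proof -
  note [measurable] = invariant_probD(5)[OF M]
  obtain T where T: "T \<in> \<T>" "T x = y" using transitive x by blast
  note [measurable] = invariant_probD(6)[OF M T(1)]
  have [measurable]: "(\<lambda>z. K \<epsilon> z y) \<in> borel_measurable M" unfolding K_def by (intro measurable_K) measurable
  have "(\<integral>\<^sup>+z. K \<epsilon> z y \<partial>M) = (\<integral>\<^sup>+z. K \<epsilon> z y \<partial>distr M M T)"
    using invariant_probD(3)[OF M T(1)] by simp
  also have "\<dots> = (\<integral>\<^sup>+z. K \<epsilon> (T z) (T x) \<partial>M)"
    by (subst nn_integral_distr) (simp_all add: T(2))
  also have "\<dots> = (\<integral>\<^sup>+z. K \<epsilon> z x \<partial>M)"
    using isom[OF T(1)] x invariant_probD(4)[OF M] by (intro nn_integral_cong) (simp add: K_def)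
  finally show ?thesis .
qed

text \<open>If one ball were null, all would be, since the integral does not depend on the centre.
  By Lindelof's theorem countably many balls cover \<open>X\<close>, which has measure 1.\<close>

lemma K_integral_pos:
  assumes M: "invariant_prob M" and x: "x \<in> X" and \<epsilon>: "\<epsilon> > 0"
  shows "(\<integral>\<^sup>+z. K \<epsilon> z x \<partial>M) \<noteq> 0"
proof
  interpret prob_space M by (rule invariant_probD[OF M])
  note [measurable] = invariant_probD(5)[OF M] and sp = invariant_probD(4)[OF M]
  have meas: "(\<lambda>z. K \<epsilon> z y) \<in> borel_measurable M" for y unfolding K_def by (intro measurable_K) measurable
  assume "(\<integral>\<^sup>+z. K \<epsilon> z x \<partial>M) = 0"
  then have 0: "AE z in M. K \<epsilon> z y = 0" if "y \<in> X" for y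
    using K_integral_const[OF M x that, of \<epsilon>] nn_integral_0_iff_AE[OF meas, of y] by simp
  define O' where "O' y = {b. D b (\<iota> y) < \<epsilon>}" for y
  have op: "open B" if "B \<in> O' ` X" for B
  proof -
    obtain y where B: "B = O' y" using \<open>B \<in> O' ` X\<close> by (rule imageE)
    have "continuous_on UNIV (\<lambda>b. D b (\<iota> y))"
      using continuous_on_compose2[OF D_cont, of UNIV "\<lambda>b. (b, \<iota> y)"]
      by (simp add: continuous_on_Pair)
    then show ?thesis unfolding B O'_def by (intro open_Collect_less) auto
  qed
  obtain \<F> where \<F>: "\<F> \<subseteq> O' ` X" "countable \<F>" "\<Union>\<F> = \<Union>(O' ` X)"
    by (rule Lindelof[of "O' ` X", OF op]) (assumption, rule that)
  have "AE z in M. \<iota> z \<notin> B" if "B \<in> \<F>" for B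
  proof -
    obtain y where y: "y \<in> X" "B = O' y" using \<open>B \<in> \<F>\<close> \<F>(1) by auto
    from 0[OF y(1)] show ?thesis by eventually_elim (auto simp: y O'_def K_def max_def split: if_splits)
  qed
  then have "AE z in M. \<forall>B\<in>\<F>. \<iota> z \<notin> B" using \<F>(2) by (simp add: AE_ball_countable)
  moreover have "AE z in M. z \<in> X" using sp by (intro AE_I2) simp
  ultimately have "AE z in M. False"
  proof eventually_elim
    case (elim z)
    have "\<iota> z \<in> O' z" using D_self \<epsilon> by (simp add: O'_def)
    with elim(2) have "\<iota> z \<in> \<Union>\<F>" unfolding \<F>(3) by (rule UN_I)
    with elim(1) show ?case by blast
  qed
  then show False by simp
qed

text \<open>On the support of the kernel \<open>g\<close> varies by at most
  \<open>C * L * \<epsilon>\<close>, so its value at \<open>x\<close> may be replaced by its value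
  at \<open>y\<close> under the double integral. Both partial integrals of the kernel are the same
  constant \<open>c\<close>, which is cancelled at the end.\<close>

lemma nn_integral_invariant_le:
  assumes M: "invariant_prob M" and N: "invariant_prob N" and \<epsilon>: "\<epsilon> > 0"
    and g: "\<And>a b. \<bar>g a - g b\<bar> \<le> C * dist a b" "\<And>a. g a \<ge> 0" "g \<in> borel_measurable borel" "C > 0"
  shows "(\<integral>\<^sup>+x. ennreal (g (\<iota> x)) \<partial>M) \<le> (\<integral>\<^sup>+x. ennreal (g (\<iota> x)) \<partial>N) + ennreal (C * L * \<epsilon>)"
proof -
  interpret M: prob_space M by (rule invariant_probD[OF M])
  interpret N: prob_space N by (rule invariant_probD[OF N])
  interpret P: pair_sigma_finite M N by unfold_locales
  note [measurable] = invariant_probD(5)[OF M] invariant_probD(5)[OF N] g(3)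
  note sp = invariant_probD(4)[OF M] invariant_probD(4)[OF N]
  obtain x0 where x0: "x0 \<in> X" using M.not_empty sp by auto
  define c where "c = (\<integral>\<^sup>+z. K \<epsilon> z x0 \<partial>M)"
  have Kmeas [measurable]: "(\<lambda>p. K \<epsilon> (fst p) (snd p)) \<in> borel_measurable (M \<Otimes>\<^sub>M N)"
    unfolding K_def by (intro measurable_K) measurable
  have Kmeas2 [measurable]: "(\<lambda>z. K \<epsilon> x z) \<in> borel_measurable N" "(\<lambda>z. K \<epsilon> z x) \<in> borel_measurable M" for x
    unfolding K_def by (intro measurable_K; measurable)+
  have cM: "(\<integral>\<^sup>+z. K \<epsilon> z y \<partial>M) = c" if "y \<in> X" for y unfolding c_def by (rule K_integral_const[OF M x0 that])
  \<comment> \<open>The constants of \<open>M\<close> and \<open>N\<close> agree because each equals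
    the double integral of the symmetric kernel over \<open>M\<close> and \<open>N\<close>.\<close>
  have cN: "(\<integral>\<^sup>+z. K \<epsilon> y z \<partial>N) = c" if y: "y \<in> X" for y
  proof -
    have N1: "(\<integral>\<^sup>+z. K \<epsilon> x z \<partial>N) = (\<integral>\<^sup>+z. K \<epsilon> y z \<partial>N)" if "x \<in> X" for x
      using K_integral_const[OF N y that, of \<epsilon>] by (simp add: K_sym)
    have "c = (\<integral>\<^sup>+y. c \<partial>N)" by (simp add: N.emeasure_space_1)
    also have "\<dots> = (\<integral>\<^sup>+y. \<integral>\<^sup>+z. K \<epsilon> z y \<partial>M \<partial>N)"
      by (intro nn_integral_cong cM[symmetric]) (simp add: sp)
    also have "\<dots> = (\<integral>\<^sup>+z. \<integral>\<^sup>+y. K \<epsilon> z y \<partial>N \<partial>M)"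
      using P.Fubini'[of "\<lambda>z y. K \<epsilon> z y"] Kmeas by (simp add: case_prod_beta')
    also have "\<dots> = (\<integral>\<^sup>+z. (\<integral>\<^sup>+z. K \<epsilon> y z \<partial>N) \<partial>M)"
      by (intro nn_integral_cong N1) (simp add: sp)
    also have "\<dots> = (\<integral>\<^sup>+z. K \<epsilon> y z \<partial>N)" by (simp add: M.emeasure_space_1)
    finally show ?thesis by simp
  qed
  have c0: "c \<noteq> 0" unfolding c_def by (rule K_integral_pos[OF M x0 \<epsilon>])
  have "c \<le> (\<integral>\<^sup>+z. ennreal \<epsilon> \<partial>M)" unfolding c_def K_def using D_nonneg \<epsilon>
    by (intro nn_integral_mono) (auto intro!: ennreal_leI simp: algebra_simps)
  then have cfin: "c \<noteq> top" by (auto simp: M.emeasure_space_1 top_unique)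
  let ?g = "\<lambda>x. ennreal (g (\<iota> x))" and ?\<eta> = "ennreal (C * L * \<epsilon>)"
  have "c * (\<integral>\<^sup>+x. ?g x \<partial>M) = (\<integral>\<^sup>+x. ?g x * c \<partial>M)"
    by (subst nn_integral_multc) (simp_all add: mult.commute)
  also have "\<dots> = (\<integral>\<^sup>+x. ?g x * (\<integral>\<^sup>+y. K \<epsilon> x y \<partial>N) \<partial>M)"
    by (intro nn_integral_cong) (simp add: sp cN)
  also have "\<dots> = (\<integral>\<^sup>+x. \<integral>\<^sup>+y. ?g x * K \<epsilon> x y \<partial>N \<partial>M)"
    by (simp add: nn_integral_cmult)
  also have "\<dots> \<le> (\<integral>\<^sup>+x. \<integral>\<^sup>+y. (?g y + ?\<eta>) * K \<epsilon> x y \<partial>N \<partial>M)"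
  proof (intro nn_integral_mono)
    fix x y assume "x \<in> space M" "y \<in> space N"
    then have xy: "x \<in> X" "y \<in> X" using sp by auto
    show "?g x * K \<epsilon> x y \<le> (?g y + ?\<eta>) * K \<epsilon> x y"
    proof (cases "D (\<iota> x) (\<iota> y) < \<epsilon>")
      case True
      have "g (\<iota> x) \<le> g (\<iota> y) + C * dist (\<iota> x) (\<iota> y)" using g(1)[of "\<iota> x" "\<iota> y"] by simp
      also have "C * dist (\<iota> x) (\<iota> y) \<le> C * (L * \<epsilon>)"
      proof (intro mult_left_mono)
        have "L * D (\<iota> x) (\<iota> y) \<le> L * \<epsilon>" using True L_pos by simp
        then show "dist (\<iota> x) (\<iota> y) \<le> L * \<epsilon>" using D_dist[OF xy] by linarith
      qed (use g in simp)
      finally have "g (\<iota> x) \<le> g (\<iota> y) + C * L * \<epsilon>" by (simp add: mult.assoc)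
      moreover have "0 \<le> C * L * \<epsilon>" using g(4) L_pos \<epsilon> by simp
      ultimately have "?g x \<le> ?g y + ?\<eta>"
        using ennreal_leI[of "g (\<iota> x)" "g (\<iota> y) + C * L * \<epsilon>"] g(2)[of "\<iota> y"] by (simp add: ennreal_plus)
      then show ?thesis by (intro mult_right_mono) auto
    next
      case False then show ?thesis by (simp add: K_def max_def)
    qed
  qed
  also have "\<dots> = (\<integral>\<^sup>+y. \<integral>\<^sup>+x. (?g y + ?\<eta>) * K \<epsilon> x y \<partial>M \<partial>N)"
  proof -
    have "(\<lambda>p. (?g (snd p) + ?\<eta>) * K \<epsilon> (fst p) (snd p)) \<in> borel_measurable (M \<Otimes>\<^sub>M N)"
      by (intro borel_measurable_times_ennreal Kmeas) measurable
    then show ?thesis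
      using P.Fubini'[of "\<lambda>x y. (?g y + ?\<eta>) * K \<epsilon> x y"] by (simp add: case_prod_beta')
  qed
  also have "\<dots> = (\<integral>\<^sup>+y. (?g y + ?\<eta>) * (\<integral>\<^sup>+x. K \<epsilon> x y \<partial>M) \<partial>N)"
    by (simp add: nn_integral_cmult)
  also have "\<dots> = (\<integral>\<^sup>+y. (?g y + ?\<eta>) * c \<partial>N)"
    by (intro nn_integral_cong) (simp add: sp cM)
  also have "\<dots> = c * ((\<integral>\<^sup>+x. ?g x \<partial>N) + ?\<eta>)"
  proof -
    have "(\<integral>\<^sup>+y. (?g y + ?\<eta>) * c \<partial>N) = (\<integral>\<^sup>+y. ?g y + ?\<eta> \<partial>N) * c"
      by (rule nn_integral_multc) measurable
    also have "(\<integral>\<^sup>+y. ?g y + ?\<eta> \<partial>N) = (\<integral>\<^sup>+x. ?g x \<partial>N) + ?\<eta>"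
      by (subst nn_integral_add) (simp_all add: N.emeasure_space_1)
    finally show ?thesis by (simp only: mult.commute)
  qed
  finally show ?thesis using c0 cfin by (simp add: ennreal_mult_le_mult_iff)
qed

text \<open>Letting \<epsilon> tend to 0 gives equal integrals of Lipschitz functions, hence equal
  measure of open sets and of Borel sets. The sigma-algebra on \<open>X\<close> consists of the
  preimages of these.\<close>

lemma invariant_prob_unique:
  assumes M: "invariant_prob M" and N: "invariant_prob N"
  shows "M = N"
proof -
  note [measurable] = invariant_probD(5)[OF M] invariant_probD(5)[OF N]
  interpret M: prob_space M by (rule invariant_probD[OF M])
  interpret N: prob_space N by (rule invariant_probD[OF N])
  have le: "(\<integral>\<^sup>+x. ennreal (g (\<iota> x)) \<partial>M) \<le> (\<integral>\<^sup>+x. ennreal (g (\<iota> x)) \<partial>N)"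
    if MN: "invariant_prob M" "invariant_prob N"
      and g: "\<And>a b. \<bar>g a - g b\<bar> \<le> C * dist a b" "\<And>a. g a \<ge> 0" "g \<in> borel_measurable borel" "C > 0"
    for M N and g :: "'b \<Rightarrow> real" and C
  proof (rule ennreal_le_epsilon)
    fix e :: real assume e: "e > 0"
    have "(\<integral>\<^sup>+x. ennreal (g (\<iota> x)) \<partial>M) \<le> (\<integral>\<^sup>+x. ennreal (g (\<iota> x)) \<partial>N) + ennreal (C * L * (e / (C * L)))"
      using e L_pos g(4) by (intro nn_integral_invariant_le[OF MN _ g]) auto
    then show "(\<integral>\<^sup>+x. ennreal (g (\<iota> x)) \<partial>M) \<le> (\<integral>\<^sup>+x. ennreal (g (\<iota> x)) \<partial>N) + ennreal e"
      using L_pos g(4) by simp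
  qed
  have opens: "emeasure (distr M borel \<iota>) S = emeasure (distr N borel \<iota>) S" if S: "open S" for S
  proof (cases "S = UNIV")
    \<comment> \<open>The whole space is treated separately because \<open>infdist\<close> to the
      empty set is 0.\<close>
    case True
    then show ?thesis using M.prob_space_distr[of \<iota> borel] N.prob_space_distr[of \<iota> borel]
      by (metis invariant_probD(5)[OF M] invariant_probD(5)[OF N] prob_space.emeasure_space_1 space_borel space_distr)
  next
    case False
    \<comment> \<open>Lipschitz functions that increase to the indicator of
      \<open>S\<close>.\<close>
    define g where "g t b = min 1 (real (Suc t) * infdist b (- S))" for t :: nat and b
    have [measurable]: "(\<lambda>b. infdist b (- S)) \<in> borel_measurable borel"
      by (intro borel_measurable_continuous_onI continuous_intros)
    have g: "\<bar>g t a - g t b\<bar> \<le> real (Suc t) * dist a b" "g t a \<ge> 0" "g t \<in> borel_measurable borel" for t a b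
    proof -
      have "\<bar>g t a - g t b\<bar> \<le> \<bar>real (Suc t) * infdist a (- S) - real (Suc t) * infdist b (- S)\<bar>"
      proof -
        have "\<bar>min 1 a - min 1 b\<bar> \<le> \<bar>a - b\<bar>" for a b :: real by (auto simp: min_def abs_if)
        then show ?thesis by (simp add: g_def)
      qed
      also have "\<dots> = real (Suc t) * \<bar>infdist a (- S) - infdist b (- S)\<bar>"
        by (simp add: right_diff_distrib[symmetric] abs_mult del: of_nat_Suc)
      also have "\<dots> \<le> real (Suc t) * dist a b" by (intro mult_left_mono infdist_triangle_abs) simp
      finally show "\<bar>g t a - g t b\<bar> \<le> real (Suc t) * dist a b" .
      show "g t a \<ge> 0" by (simp add: g_def infdist_nonneg)
      show "g t \<in> borel_measurable borel" unfolding g_def by measurable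
    qed
    have sup: "indicator S b = (SUP t. ennreal (g t b))" for b
    proof (cases "b \<in> S")
      case True
      then have "infdist b (- S) > 0"
        using S False by (intro infdist_pos_not_in_closed) auto
      then obtain t where "1 < real t * infdist b (- S)" by (metis reals_Archimedean3)
      then have "g t b = 1" using infdist_nonneg[of b "- S"] by (simp add: g_def min_def algebra_simps)
      then have "1 \<le> (SUP t. ennreal (g t b))" by (intro SUP_upper2[of t]) auto
      moreover have "(SUP t. ennreal (g t b)) \<le> 1" by (intro SUP_least) (simp add: g_def)
      ultimately show ?thesis using True by simp
    next
      case False
      then have "g t b = 0" for t by (simp add: g_def)
      then show ?thesis using False by simp
    qed
    have inc: "incseq (\<lambda>t x. ennreal (g t (\<iota> x)))"
      by (auto simp: incseq_def le_fun_def g_def intro!: ennreal_leI min.mono mult_right_mono infdist_nonneg)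
    have eq: "emeasure (distr M' borel \<iota>) S = (SUP t. \<integral>\<^sup>+x. ennreal (g t (\<iota> x)) \<partial>M')"
      if M': "invariant_prob M'" for M'
    proof -
      note [measurable] = invariant_probD(5)[OF M'] g(3)
      have "emeasure (distr M' borel \<iota>) S = (\<integral>\<^sup>+b. indicator S b \<partial>distr M' borel \<iota>)"
        using S by (subst nn_integral_indicator) auto
      also have "\<dots> = (\<integral>\<^sup>+x. indicator S (\<iota> x) \<partial>M')"
        using S by (subst nn_integral_distr) auto
      also have "\<dots> = (SUP t. \<integral>\<^sup>+x. ennreal (g t (\<iota> x)) \<partial>M')"
        unfolding sup using inc by (subst nn_integral_monotone_convergence_SUP) auto
      finally show ?thesis .
    qed
    have "(\<integral>\<^sup>+x. ennreal (g t (\<iota> x)) \<partial>M) = (\<integral>\<^sup>+x. ennreal (g t (\<iota> x)) \<partial>N)" for t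
      by (intro antisym le[OF M N g] le[OF N M g]) auto
    then show ?thesis by (simp add: eq[OF M] eq[OF N])
  qed
  have d: "distr M borel \<iota> = distr N borel \<iota>"
  proof (rule measure_eqI_generator_eq[where E="{S. open S}" and \<Omega>=UNIV and A="\<lambda>_. UNIV"])
    show "Int_stable {S :: 'b set. open S}" by (auto simp: Int_stable_def)
    show "emeasure (distr M borel \<iota>) UNIV \<noteq> \<infinity>"
      using M.emeasure_space_1 by (simp add: emeasure_distr invariant_probD(4)[OF M, symmetric])
    show "emeasure (distr M borel \<iota>) S = emeasure (distr N borel \<iota>) S" if "S \<in> {S. open S}" for S
      using that opens by simp
  qed (simp_all add: borel_def)
  show "M = N"
  proof (rule measure_eqI)
    show "sets M = sets N" by (simp add: invariant_probD[OF M] invariant_probD[OF N])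
    fix A assume "A \<in> sets M"
    then obtain B where B: "B \<in> sets borel" "A = \<iota> -` B \<inter> X"
      unfolding invariant_probD(2)[OF M] by (subst (asm) sets_vimage_algebra2) auto
    have "emeasure (distr M borel \<iota>) B = emeasure (distr N borel \<iota>) B" by (simp add: d)
    then show "emeasure M A = emeasure N A"
      using B by (simp add: emeasure_distr invariant_probD(4)[OF M] invariant_probD(4)[OF N])
  qed
qed

end

section \<open>The uniform measure on a sphere\<close>

text \<open>The product metric sums the coordinate distances, cut off at 1, with geometric weights
  of total 2. This is the origin of the factor 2 for spheres and 4 for matrices, which are sequences
  of sequences.\<close>

lemma dist_seq_le:
  fixes x y :: "nat \<Rightarrow> 'a :: metric_space"
  assumes "\<And>i. dist (x i) (y i) \<le> d"
  shows "dist x y \<le> 2 * d"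
proof (rule field_le_epsilon)
  fix e :: real assume "e > 0"
  then obtain N where N: "(1 / 2) ^ N < e" using real_arch_pow_inv[of e "1 / 2"] by auto
  have "Max {dist (x (from_nat n)) (y (from_nat n)) |n. n \<le> N} \<le> d"
    using assms by (subst Max_le_iff) auto
  then show "dist x y \<le> 2 * d + e" using dist_fun_le_dist_first_terms[of x y N] N by linarith
qed

lemma sphere_in_iff:
  assumes "n \<ge> 1"
  shows "x \<in> sphere_in n H \<longleftrightarrow> x \<in> Rn n \<and> inner_n n x x = 1 \<and> x \<in> H"
proof -
  have "{..n - 1} = {..<n}" "\<And>i. n - 1 < i \<longleftrightarrow> n \<le> i" using assms by auto
  then show ?thesis
    by (auto simp: sphere_in_def nsphere Rn_iff inner_n_def power2_eq_square)
qed

lemma measurable_orth_proj_fixed: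
  "subspace H \<Longrightarrow> H \<subseteq> Rn n \<Longrightarrow> orth_proj n H \<in> borel_measurable borel"
  by (rule borel_measurable_continuous_onI[OF continuous_on_orth_proj])

lemma borel_subspace:
  assumes "subspace H" "H \<subseteq> Rn n"
  shows "H \<in> sets borel"
proof -
  have "H = {x. orth_proj n H x = x}"
    using orth_proj_self[OF assms] orth_proj_in[OF assms] by auto metis
  moreover have "closed {x. orth_proj n H x = x}"
    by (intro closed_Collect_eq continuous_on_orth_proj assms continuous_on_id)
  ultimately show ?thesis by (metis borel_closed)
qed

lemma borel_sphere_in:
  assumes "subspace H" "H \<subseteq> Rn n" "n \<ge> 1"
  shows "sphere_in n H \<in> sets borel"
proof -
  have "sphere_in n H = H \<inter> {x. inner_n n x x = 1}"
    using assms by (auto simp: sphere_in_iff)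
  then show ?thesis using borel_subspace[OF assms(1,2)] by simp
qed

text \<open>The direction of the projection of \<open>g\<close> to \<open>H\<close>; it is \<open>0\<close>, hence not on the sphere, if the projection
  vanishes.\<close>

definition sph :: "nat \<Rightarrow> (nat \<Rightarrow> real) set \<Rightarrow> (nat \<Rightarrow> real) \<Rightarrow> nat \<Rightarrow> real" where
  "sph n H g = (1 / sqrt (inner_n n (orth_proj n H g) (orth_proj n H g))) *\<^sub>R orth_proj n H g"

lemma measurable_sph: "subspace H \<Longrightarrow> H \<subseteq> Rn n \<Longrightarrow> sph n H \<in> borel_measurable borel"
proof -
  assume "subspace H" "H \<subseteq> Rn n"
  note [measurable] = measurable_orth_proj_fixed[OF this]
  show ?thesis unfolding sph_def by measurable
qed

lemma sph_in_sphere: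
  assumes H: "subspace H" "H \<subseteq> Rn n" and n: "n \<ge> 1" and g: "orth_proj n H g \<noteq> 0"
  shows "sph n H g \<in> sphere_in n H"
proof -
  have "sph n H g \<in> H" unfolding sph_def by (intro subspace_scale H orth_proj_in[OF H])
  moreover have "inner_n n (orth_proj n H g) (orth_proj n H g) > 0"
    using inner_n_eq_0[OF orth_proj_in_Rn[OF H]] inner_n_nonneg[of n "orth_proj n H g"] g by (simp add: less_le)
  ultimately show ?thesis
    using H n by (auto simp: sphere_in_iff sph_def inner_n_scale)
qed

lemma unit_vector_exists:
  assumes "subspace H" "H \<subseteq> Rn n" "dim H \<ge> 1"
  obtains v where "v \<in> H" "inner_n n v v = 1"
proof -
  obtain u where u: "onb n (dim H) u H" using onb_exists[OF assms(1,2)] .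
  then show ?thesis using that[of "u 0"] onb_in[OF u, of 0] assms(3) by (auto simp: onb_def onf_def)
qed

lemma AE_orth_proj_nonzero:
  assumes "subspace H" "H \<subseteq> Rn n" "dim H \<ge> 1"
  shows "AE g in gauss n. orth_proj n H g \<noteq> 0"
proof -
  obtain v where v: "v \<in> H" "inner_n n v v = 1" using unit_vector_exists[OF assms] .
  then have "AE g in gauss n. inner_n n g v \<noteq> 0" using assms(2) by (intro AE_gauss_inner_nonzero) auto
  then show ?thesis
  proof eventually_elim
    case (elim g)
    then show ?case using inner_orth_proj[OF assms(1,2) v(1), of g] by (auto simp: inner_n_zero)
  qed
qed

text \<open>Outside \<open>Rn n\<close> an orthogonal map is only known to be linear and may fail to
  be measurable; on \<open>A\<close> it agrees with a finite linear combination.\<close>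

lemma orthogonal_map_measurable:
  assumes "orthogonal_map n U" "A \<subseteq> Rn n"
  shows "U \<in> restrict_space borel A \<rightarrow>\<^sub>M borel"
proof -
  have "lc n (\<lambda>i. U (ev i)) \<in> restrict_space borel A \<rightarrow>\<^sub>M borel"
    by (intro measurable_restrict_space1) measurable
  then show ?thesis
    by (rule measurable_cong[THEN iffD1, rotated]) (use orthogonal_map_eq_lc[OF assms(1)] assms(2) in \<open>auto simp: space_restrict_space\<close>)
qed

lemma orthogonal_map_sphere:
  assumes "orthogonal_map n U" "U ` H = H" "x \<in> sphere_in n H" "n \<ge> 1"
  shows "U x \<in> sphere_in n H"
  using assms orthogonal_mapD[OF assms(1)] by (auto simp: sphere_in_iff)

text \<open>\<open>D\<close> is the Euclidean distance. Transitivity under maps that preserve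
  \<open>H\<close> comes from reflections, so the argument also covers the two-point sphere of a
  line.\<close>

lemma sphere_uniform_unique:
  assumes H: "subspace H" "H \<subseteq> Rn n" and n: "n \<ge> 1"
    and M: "is_uniform_on_sphere n H M" and N: "is_uniform_on_sphere n H N"
  shows "M = N"
proof -
  let ?X = "sphere_in n H" and ?D = "\<lambda>x y. sqrt (inner_n n (x - y) (x - y))"
  let ?T = "{U. orthogonal_map n U \<and> U ` H = H}"
  have XR: "?X \<subseteq> Rn n" using n by (auto simp: sphere_in_iff)
  have sets_eq: "sets (vimage_algebra ?X (\<lambda>x. x) borel) = sets (restrict_space borel ?X)"
    by (subst sets_vimage_algebra2) (auto simp: sets_restrict_space)
  interpret transitive_isometries ?X "\<lambda>x. x" ?D ?T 2
  proof
    show "continuous_on UNIV (\<lambda>p. ?D (fst p) (snd p))"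
    proof -
      have c: "continuous_on UNIV (\<lambda>p. (fst p - snd p) :: nat \<Rightarrow> real)"
        by (rule continuous_on_coordinatewise_then_product)
          (simp add: fun_simps, intro continuous_on_diff continuous_on_nth continuous_on_fst continuous_on_snd continuous_on_id)
      show ?thesis by (intro continuous_on_real_sqrt continuous_on_inner_n c)
    qed
    show "?D a b = ?D b a" for a b by (simp add: inner_n_diff)
    show "?D a a = 0" for a by (simp add: inner_n_zero)
    show "?D a b \<ge> 0" for a b by (simp add: inner_n_nonneg)
    show "dist x y \<le> 2 * ?D x y" if "x \<in> ?X" "y \<in> ?X" for x y
    proof (rule dist_seq_le)
      fix i
      show "dist (x i) (y i) \<le> ?D x y"
      proof (cases "i < n")
        case True
        have "((x - y) i)\<^sup>2 \<le> (\<Sum>i<n. ((x - y) i)\<^sup>2)" using True by (intro member_le_sum) auto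
        then have "(x i - y i)\<^sup>2 \<le> inner_n n (x - y) (x - y)" by (simp add: inner_n_def power2_eq_square fun_simps)
        then show ?thesis unfolding dist_real_def by (simp add: real_le_rsqrt abs_le_square_iff)
      next
        case False
        then have "x i = 0" "y i = 0" using that XR by (auto simp: Rn_iff subset_iff not_less)
        then show ?thesis by (simp add: inner_n_nonneg)
      qed
    qed
    show "(0 :: real) < 2" by simp
    fix T assume T: "T \<in> ?T"
    then have oT: "orthogonal_map n T" "T ` H = H" by auto
    show "T \<in> vimage_algebra ?X (\<lambda>x. x) borel \<rightarrow>\<^sub>M vimage_algebra ?X (\<lambda>x. x) borel"
      unfolding measurable_cong_sets[OF sets_eq sets_eq]
      using orthogonal_map_measurable[OF oT(1) XR] orthogonal_map_sphere[OF oT _ n]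
      by (intro measurable_restrict_space2) (auto simp: space_restrict_space)
    show "?D (T x) (T y) = ?D x y" if "x \<in> ?X" "y \<in> ?X" for x y
    proof -
      have "T x - T y = T (x - y)" using linear_diff[OF orthogonal_mapD(1)[OF oT(1)]] by simp
      moreover have "x - y \<in> Rn n" using that XR by (intro subspace_diff subspace_Rn) auto
      ultimately show ?thesis using orthogonal_mapD(3)[OF oT(1)] by simp
    qed
  next
    fix x y assume "x \<in> ?X" "y \<in> ?X"
    then have xy: "x \<in> Rn n" "y \<in> Rn n" "x \<in> H" "y \<in> H" "inner_n n x x = inner_n n y y" using n by (auto simp: sphere_in_iff)
    obtain U where "orthogonal_map n U" "U x = y" "\<And>H. subspace H \<Longrightarrow> x \<in> H \<Longrightarrow> y \<in> H \<Longrightarrow> U ` H = H"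
      using orthogonal_map_transitive[OF xy(1,2,5)] by blast
    then show "\<exists>T\<in>?T. T x = y" using H xy by blast
  qed
  have "invariant_prob M" "invariant_prob N"
    using M N unfolding invariant_prob_def is_uniform_on_sphere_def sets_eq by auto
  then show ?thesis by (rule invariant_prob_unique)
qed

text \<open>Existence, together with a realisation of these measures for all \<open>H\<close> by one
  Gaussian vector of \<open>Rn n\<close>. From it come the densities and also measurability in
  \<open>H\<close>, because \<open>H\<close> enters through the projection alone.\<close>

lemma sphere_measure_facts:
  assumes H: "subspace H" "H \<subseteq> Rn n" "dim H \<ge> 1"
  shows "is_uniform_on_sphere n H (sphere_measure n H)"
    and "F \<in> borel_measurable borel \<Longrightarrow> (\<integral>\<^sup>+x. F x \<partial>sphere_measure n H) = (\<integral>\<^sup>+g. F (sph n H g) \<partial>gauss n)"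
proof -
  have n: "n \<ge> 1" using dim_le_n[OF H(1,2)] H(3) by linarith
  let ?X = "sphere_in n H"
  obtain v where v: "v \<in> H" "inner_n n v v = 1" using unit_vector_exists[OF H] .
  then have vX: "v \<in> ?X" using n H by (auto simp: sphere_in_iff)
  \<comment> \<open>A fixed value on the sphere replaces \<open>sph n H g\<close> where the
    projection vanishes, so that the push-forward is a measure on the sphere.\<close>
  define nz where "nz g = (if orth_proj n H g = 0 then v else sph n H g)" for g
  have [measurable]: "orth_proj n H \<in> borel_measurable borel" "sph n H \<in> borel_measurable borel"
    using measurable_orth_proj_fixed measurable_sph H by auto
  have z: "x = 0 \<longleftrightarrow> (\<forall>i. x i = 0)" for x :: "nat \<Rightarrow> real" by (auto simp: fun_eq_iff fun_simps)
  have nz_meas: "nz \<in> borel_measurable borel" unfolding nz_def z by measurable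
  have nzX: "nz g \<in> ?X" for g unfolding nz_def using vX sph_in_sphere[OF H(1,2) n] by auto
  have nz [measurable]: "nz \<in> gauss n \<rightarrow>\<^sub>M restrict_space borel ?X"
    by (rule measurable_restrict_space2) (use nzX nz_meas in \<open>auto simp: measurable_cong_sets[OF sets_gauss refl]\<close>)
  have nz_AE: "AE g in gauss n. nz g = sph n H g"
    using AE_orth_proj_nonzero[OF H] by eventually_elim (simp add: nz_def)
  define \<sigma> where "\<sigma> = distr (gauss n) (restrict_space borel ?X) nz"
  have F\<sigma>: "(\<integral>\<^sup>+x. F x \<partial>\<sigma>) = (\<integral>\<^sup>+g. F (sph n H g) \<partial>gauss n)"
    if "F \<in> borel_measurable (restrict_space borel ?X)" for F
  proof -
    have "(\<integral>\<^sup>+x. F x \<partial>\<sigma>) = (\<integral>\<^sup>+g. F (nz g) \<partial>gauss n)"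
      unfolding \<sigma>_def using that by (intro nn_integral_distr nz) auto
    also have "\<dots> = (\<integral>\<^sup>+g. F (sph n H g) \<partial>gauss n)"
      using nz_AE by (intro nn_integral_cong_AE) auto
    finally show ?thesis .
  qed
  have XR: "?X \<subseteq> Rn n" using n by (auto simp: sphere_in_iff)
  have ps: "prob_space \<sigma>" unfolding \<sigma>_def by (rule prob_space.prob_space_distr[OF prob_space_gauss nz])
  have ss: "sets \<sigma> = sets (restrict_space borel ?X)" by (simp add: \<sigma>_def)
  have sub: "A \<in> sets borel" if "A \<in> sets (restrict_space borel ?X)" for A
    using that borel_sphere_in[OF H(1,2) n] by (auto simp: sets_restrict_space)
  have "distr \<sigma> \<sigma> U = \<sigma>" if U: "orthogonal_map n U" "U ` H = H" for U
  proof (rule measure_eqI)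
    show "sets (distr \<sigma> \<sigma> U) = sets \<sigma>" by simp
    have UM: "U \<in> restrict_space borel ?X \<rightarrow>\<^sub>M restrict_space borel ?X"
      using orthogonal_map_measurable[OF U(1) XR] orthogonal_map_sphere[OF U _ n]
      by (intro measurable_restrict_space2) (auto simp: space_restrict_space)
    fix A assume "A \<in> sets (distr \<sigma> \<sigma> U)"
    then have A': "A \<in> sets (restrict_space borel ?X)" by (simp add: ss)
    then have [measurable]: "A \<in> sets borel" by (rule sub)
    have o: "onf n n (\<lambda>i. U (ev i))" using orthogonal_map_onf[OF U(1) onf_ev] by simp
    have "emeasure (distr \<sigma> \<sigma> U) A = (\<integral>\<^sup>+x. indicator A x \<partial>distr \<sigma> \<sigma> U)"
      using A' ss by (subst nn_integral_indicator) auto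
    also have "\<dots> = (\<integral>\<^sup>+x. indicator A (U x) \<partial>\<sigma>)"
    proof (rule nn_integral_distr)
      show "U \<in> \<sigma> \<rightarrow>\<^sub>M \<sigma>" using UM measurable_cong_sets[OF ss ss] by blast
      show "(indicator A :: _ \<Rightarrow> ennreal) \<in> borel_measurable (distr \<sigma> \<sigma> U)" using A' ss by (intro borel_measurable_indicator) simp
    qed
    also have "\<dots> = (\<integral>\<^sup>+g. indicator A (U (sph n H g)) \<partial>gauss n)"
      by (rule F\<sigma>) (use UM A' in \<open>auto intro!: measurable_compose[OF UM] borel_measurable_indicator\<close>)
    \<comment> \<open>As \<open>U\<close> preserves \<open>H\<close>, it commutes with
      \<open>orth_proj n H\<close>, and the Gaussian vector may be rotated instead.\<close>
    also have "\<dots> = (\<integral>\<^sup>+g. indicator A (sph n H (lc n (\<lambda>i. U (ev i)) g)) \<partial>gauss n)"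
    proof (intro nn_integral_cong_AE, use AE_gauss_Rn[of n] in eventually_elim)
      fix g assume g: "g \<in> Rn n"
      have "orth_proj n H (U g) = U (orth_proj n H g)"
        using orth_proj_image[OF U(1) H(1,2) g] U(2) by simp
      then have "sph n H (U g) = U (sph n H g)"
        unfolding sph_def using orthogonal_mapD(3)[OF U(1) orth_proj_in_Rn[OF H(1,2)] orth_proj_in_Rn[OF H(1,2)]]
        by (simp add: linear_scale[OF orthogonal_mapD(1)[OF U(1)]])
      then show "indicator A (U (sph n H g)) = (indicator A (sph n H (lc n (\<lambda>i. U (ev i)) g)) :: ennreal)"
        using orthogonal_map_eq_lc[OF U(1) g] by simp
    qed
    also have "\<dots> = (\<integral>\<^sup>+g. indicator A (sph n H g) \<partial>gauss n)"
      by (rule nn_integral_gauss_orthogonal[OF o]) measurable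
    also have "\<dots> = (\<integral>\<^sup>+x. indicator A x \<partial>\<sigma>)"
      by (rule F\<sigma>[symmetric]) (use A' in \<open>auto intro!: borel_measurable_indicator\<close>)
    also have "\<dots> = emeasure \<sigma> A" using A' ss by (subst nn_integral_indicator) auto
    finally show "emeasure (distr \<sigma> \<sigma> U) A = emeasure \<sigma> A" .
  qed
  then have u: "is_uniform_on_sphere n H \<sigma>"
    unfolding is_uniform_on_sphere_def using ps ss by auto
  then have eq: "sphere_measure n H = \<sigma>"
    unfolding sphere_measure_def using sphere_uniform_unique[OF H(1,2) n] by (intro the_equality) auto
  show "is_uniform_on_sphere n H (sphere_measure n H)" using u eq by simp
  show "(\<integral>\<^sup>+x. F x \<partial>sphere_measure n H) = (\<integral>\<^sup>+g. F (sph n H g) \<partial>gauss n)" if "F \<in> borel_measurable borel"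
    unfolding eq by (rule F\<sigma>) (use that in \<open>rule measurable_restrict_space1\<close>)
qed

section \<open>The Haar measure on the Grassmannian\<close>

lemma Grassmannian_borel_ev:
  "Grassmannian_borel n m = vimage_algebra (Grassmannian n m) (\<lambda>H i j. orth_proj n H (ev i) j) borel"
  by (simp add: Grassmannian_borel_def ev_def)

lemma space_Grassmannian_borel [simp]: "space (Grassmannian_borel n m) = Grassmannian n m"
  by (simp add: Grassmannian_borel_def)

lemma GrassmannianD:
  assumes "H \<in> Grassmannian n m"
  shows "subspace H" "H \<subseteq> Rn n" "dim H = m"
  using assms by (auto simp: Grassmannian_def)

lemma onb_Grassmannian: "onb n m u H \<Longrightarrow> H \<in> Grassmannian n m"
  using onb_subspace onb_dim by (auto simp: Grassmannian_def)

lemma Grassmannian_onb: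
  assumes "H \<in> Grassmannian n m" obtains u where "onb n m u H"
  using onb_exists GrassmannianD[OF assms] by metis

lemma Rn_Grassmannian: "m \<le> n \<Longrightarrow> Rn m \<in> Grassmannian n m"
  by (rule onb_Grassmannian[OF onb_ev])

lemma orth_proj_Rn: "m \<le> n \<Longrightarrow> orth_proj n (Rn m) x = trunc m x"
  unfolding orth_proj_onb[OF onb_ev] lc_ev by (auto simp: trunc_def inner_n_ev fun_eq_iff)

lemma measurable_Grassmannian_entry:
  "(\<lambda>H. orth_proj n H (ev i) j) \<in> borel_measurable (Grassmannian_borel n m)"
proof -
  have "(\<lambda>H i j. orth_proj n H (ev i) j) \<in> borel_measurable (Grassmannian_borel n m)"
    unfolding Grassmannian_borel_ev by (rule measurable_vimage_algebra1) simp
  from measurable_product_then_coordinatewise[OF measurable_product_then_coordinatewise[OF this]]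
  show ?thesis .
qed

lemma measurable_GrassmannianI:
  assumes "f \<in> space N \<rightarrow> Grassmannian n m" "\<And>i j. i < n \<Longrightarrow> (\<lambda>x. orth_proj n (f x) (ev i) j) \<in> borel_measurable N"
  shows "f \<in> N \<rightarrow>\<^sub>M Grassmannian_borel n m"
  unfolding Grassmannian_borel_ev
proof (rule measurable_vimage_algebra2[OF assms(1)])
  have "(\<lambda>x. orth_proj n (f x) (ev i) j) \<in> borel_measurable N" for i j
  proof (cases "i < n")
    case False
    have "orth_proj n (f x) (ev i) j = 0" if "x \<in> space N" for x
    proof -
      have H: "f x \<in> Grassmannian n m" using assms(1) that by auto
      show ?thesis
        using orth_proj_trunc[OF GrassmannianD(1,2)[OF H], of "ev i"] False linear_0[OF orth_proj_linear[OF GrassmannianD(1,2)[OF H]]]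
        by (simp add: trunc_def ev_def zero_fun_def[symmetric] cong: if_cong) (metis fun_simps(2) less_irrefl)
    qed
    then show ?thesis by (simp cong: measurable_cong)
  qed (rule assms(2))
  then show "(\<lambda>x i j. orth_proj n (f x) (ev i) j) \<in> borel_measurable N"
    by (intro measurable_seqI)
qed

lemma measurable_orth_proj:
  assumes f: "f \<in> N \<rightarrow>\<^sub>M Grassmannian_borel n m" and [measurable]: "g \<in> borel_measurable N"
  shows "(\<lambda>x. orth_proj n (f x) (g x)) \<in> borel_measurable N"
proof (rule measurable_seqI)
  fix j
  have [measurable]: "(\<lambda>x. orth_proj n (f x) (ev i) j) \<in> borel_measurable N" for i
    by (rule measurable_compose[OF f measurable_Grassmannian_entry])
  have "(\<lambda>x. \<Sum>i<n. g x i * orth_proj n (f x) (ev i) j) \<in> borel_measurable N" by measurable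
  moreover have "(\<Sum>i<n. g x i * orth_proj n (f x) (ev i) j) = orth_proj n (f x) (g x) j" if "x \<in> space N" for x
    using orth_proj_coord[of "f x" n "g x" j] GrassmannianD measurable_space[OF f that] by auto
  ultimately show "(\<lambda>x. orth_proj n (f x) (g x) j) \<in> borel_measurable N"
    by (simp cong: measurable_cong)
qed

lemma orthogonal_map_Grassmannian:
  assumes "orthogonal_map n U" "H \<in> Grassmannian n m"
  shows "U ` H \<in> Grassmannian n m"
  using orthogonal_map_onb[OF assms(1)] onb_Grassmannian Grassmannian_onb[OF assms(2)] by metis

lemma measurable_Grassmannian_image:
  assumes U: "orthogonal_map n U"
  shows "(\<lambda>H. U ` H) \<in> Grassmannian_borel n m \<rightarrow>\<^sub>M Grassmannian_borel n m"
proof (rule measurable_GrassmannianI)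
  show "(`) U \<in> space (Grassmannian_borel n m) \<rightarrow> Grassmannian n m"
    using orthogonal_map_Grassmannian[OF U] by auto
  fix i j assume i: "i < n"
  \<comment> \<open>The projection onto the image of \<open>H\<close> is the projection onto
    \<open>H\<close> conjugated by \<open>U\<close>, so its matrix entries are measurable in
    \<open>H\<close>.\<close>
  obtain V where V: "orthogonal_map n V" "\<And>x. x \<in> Rn n \<Longrightarrow> U (V x) = x" using orthogonal_map_inverse[OF U] by metis
  have "(\<lambda>H. lc n (\<lambda>i. U (ev i)) (orth_proj n H (V (ev i))) j) \<in> borel_measurable (Grassmannian_borel n m)"
    by (intro measurable_nth measurable_lc measurable_orth_proj[where m=m] measurable_const) auto
  moreover have "lc n (\<lambda>i. U (ev i)) (orth_proj n H (V (ev i))) j = orth_proj n (U ` H) (ev i) j"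
    if "H \<in> space (Grassmannian_borel n m)" for H
  proof -
    have H: "subspace H" "H \<subseteq> Rn n" using that GrassmannianD by auto
    have "orth_proj n (U ` H) (U (V (ev i))) = U (orth_proj n H (V (ev i)))"
      by (rule orth_proj_image[OF U H]) (rule orthogonal_mapD(2)[OF V(1) ev_Rn[OF i]])
    then show ?thesis
      using orthogonal_map_eq_lc[OF U orth_proj_in_Rn[OF H]] V(2)[OF ev_Rn[OF i]] by simp
  qed
  ultimately show "(\<lambda>H. orth_proj n (U ` H) (ev i) j) \<in> borel_measurable (Grassmannian_borel n m)"
    by (rule measurable_cong[THEN iffD1, rotated])
qed

text \<open>The squared Hilbert-Schmidt norm of a symmetric operator, computed in two orthonormal
  bases. Applied to the difference of two projections, this makes the matrix distance on the
  Grassmannian invariant.\<close>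

lemma Frobenius_basis_independent:
  assumes T: "\<And>x. T x \<in> Rn n" "\<And>x y. inner_n n (T x) y = inner_n n x (T y)" and u: "onf n n u"
  shows "(\<Sum>i<n. inner_n n (T (ev i)) (T (ev i))) = (\<Sum>i<n. inner_n n (T (u i)) (T (u i)))"
proof -
  have "(\<Sum>i<n. inner_n n (T (ev i)) (T (ev i))) = (\<Sum>i<n. \<Sum>j<n. (T (u j) i)\<^sup>2)"
  proof (rule sum.cong[OF refl])
    fix i assume "i \<in> {..<n}"
    then show "inner_n n (T (ev i)) (T (ev i)) = (\<Sum>j<n. (T (u j) i)\<^sup>2)"
      using onb_Parseval[OF onf_full[OF u] T(1), of "ev i" "T (ev i)"] by (simp add: T(2) inner_n_ev power2_eq_square)
  qed
  also have "\<dots> = (\<Sum>j<n. \<Sum>i<n. (T (u j) i)\<^sup>2)" by (rule sum.swap)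
  finally show ?thesis by (simp add: inner_n_def power2_eq_square)
qed

lemma orthogonal_map_transitive_Grassmannian:
  assumes "H \<in> Grassmannian n m" "H' \<in> Grassmannian n m"
  obtains U where "orthogonal_map n U" "U ` H = H'"
proof -
  obtain u v where uv: "onb n m u H" "onb n m v H'" using assms Grassmannian_onb by metis
  then obtain u' v' where e: "onf n n u'" "onf n n v'" "\<And>i. i < m \<Longrightarrow> u' i = u i" "\<And>i. i < m \<Longrightarrow> v' i = v i"
    using onf_extend_full unfolding onb_def by metis
  obtain U where U: "orthogonal_map n U" "\<And>i. i < n \<Longrightarrow> U (u' i) = v' i"
    using orthogonal_map_basis_change[OF e(1,2)] by metis
  have "m \<le> n" using uv onf_card_le by (auto simp: onb_def)
  then have "U (u i) = v i" if "i < m" for i using that e(3,4)[OF that] U(2)[of i] by simp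
  then have "lc m (\<lambda>i. U (u i)) = lc m v" by (intro ext lc_cong) auto
  then have "U ` H = H'" using orthogonal_map_onb[OF U(1) uv(1)] uv(2) by (simp add: onb_def)
  then show ?thesis using that U(1) by blast
qed

text \<open>The locale is used with the Hilbert-Schmidt distance of the projection matrices as
  \<open>D\<close>.\<close>

lemma Haar_Grassmannian_unique:
  assumes M: "is_Haar_Grassmannian n m M" and N: "is_Haar_Grassmannian n m N"
  shows "M = N"
proof -
  let ?X = "Grassmannian n m" and ?i = "\<lambda>H i j. orth_proj n H (ev i) j"
  let ?D = "\<lambda>p q. sqrt (\<Sum>i<n. inner_n n (p i - q i) (p i - q i))"
  let ?T = "{(`) U | U. orthogonal_map n U}"
  \<comment> \<open>Entries outside the n by n block vanish, so the finite sum in \<open>?D\<close>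
    controls the metric on infinite matrices.\<close>
  have zero: "?i H i j = 0" if "H \<in> ?X" "i \<ge> n \<or> j \<ge> n" for H i j
  proof (cases "j \<ge> n")
    case True then show ?thesis using orth_proj_in_Rn[OF GrassmannianD(1,2)[OF that(1)]] by (auto simp: Rn_iff)
  next
    case False
    then show ?thesis using that by (subst orth_proj_coord[OF GrassmannianD(1,2)[OF that(1)]]) (auto simp: ev_def intro!: sum.neutral)
  qed
  interpret transitive_isometries ?X ?i ?D ?T 4
  proof
    have c: "continuous_on UNIV (\<lambda>p. (fst p i - snd p i) :: nat \<Rightarrow> real)" for i :: nat
      by (rule continuous_on_coordinatewise_then_product)
        (simp add: fun_simps, intro continuous_on_diff continuous_on_nth continuous_on_product_then_coordinatewise[of _ "fst"]
          continuous_on_product_then_coordinatewise[of _ "snd"] continuous_on_fst continuous_on_snd continuous_on_id)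
    show "continuous_on UNIV (\<lambda>p. ?D (fst p) (snd p))"
      by (intro continuous_on_real_sqrt continuous_on_sum continuous_on_inner_n c)
    show "?D a b = ?D b a" for a b by (simp add: inner_n_diff algebra_simps)
    show "?D a a = 0" for a by (simp add: inner_n_zero)
    show "?D a b \<ge> 0" for a b by (simp add: inner_n_nonneg sum_nonneg)
    show "dist (?i x) (?i y) \<le> 4 * ?D (?i x) (?i y)" if xy: "x \<in> ?X" "y \<in> ?X" for x y
    proof -
      have "dist (?i x) (?i y) \<le> 2 * (2 * ?D (?i x) (?i y))"
      proof (rule dist_seq_le, rule dist_seq_le)
        fix i j
        show "dist (?i x i j) (?i y i j) \<le> ?D (?i x) (?i y)"
        proof (cases "i < n \<and> j < n")
          case True
          have "(?i x i j - ?i y i j)\<^sup>2 \<le> (\<Sum>j<n. (?i x i j - ?i y i j)\<^sup>2)" using True by (intro member_le_sum) auto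
          also have "\<dots> = inner_n n (?i x i - ?i y i) (?i x i - ?i y i)"
            by (simp add: inner_n_def power2_eq_square fun_simps)
          also have "\<dots> \<le> (\<Sum>i<n. inner_n n (?i x i - ?i y i) (?i x i - ?i y i))"
            using True by (intro member_le_sum[of i "{..<n}" "\<lambda>i. inner_n n (?i x i - ?i y i) (?i x i - ?i y i)"]) (auto simp: inner_n_nonneg)
          finally show ?thesis unfolding dist_real_def by (simp add: real_le_rsqrt abs_le_square_iff)
        next
          case False
          then have "?i x i j = 0" "?i y i j = 0" using zero xy by (auto simp: not_less)
          then show ?thesis by (simp add: inner_n_nonneg sum_nonneg)
        qed
      qed
      then show ?thesis by simp
    qed
    show "(0 :: real) < 4" by simp
    fix T assume "T \<in> ?T"
    then obtain U where U: "orthogonal_map n U" "T = (`) U" by auto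
    show "T \<in> vimage_algebra ?X ?i borel \<rightarrow>\<^sub>M vimage_algebra ?X ?i borel"
      using measurable_Grassmannian_image[OF U(1), of m] unfolding U(2) Grassmannian_borel_ev .
    show "?D (?i (T H)) (?i (T H')) = ?D (?i H) (?i H')" if "H \<in> ?X" "H' \<in> ?X" for H H'
    proof -
      have HH: "subspace H" "H \<subseteq> Rn n" "subspace H'" "H' \<subseteq> Rn n" using that GrassmannianD by auto
      have UH: "subspace (U ` H)" "U ` H \<subseteq> Rn n" "subspace (U ` H')" "U ` H' \<subseteq> Rn n"
        using GrassmannianD[OF orthogonal_map_Grassmannian[OF U(1) that(1)]]
          GrassmannianD[OF orthogonal_map_Grassmannian[OF U(1) that(2)]] by auto
      define S where "S x = orth_proj n (U ` H) x - orth_proj n (U ` H') x" for x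
      have "(\<Sum>i<n. inner_n n (S (ev i)) (S (ev i))) = (\<Sum>i<n. inner_n n (S (U (ev i))) (S (U (ev i))))"
      proof (rule Frobenius_basis_independent[of S n "\<lambda>i. U (ev i)"])
        show "S x \<in> Rn n" for x unfolding S_def
          by (intro subspace_diff subspace_Rn orth_proj_in_Rn UH)
        show "inner_n n (S x) y = inner_n n x (S y)" for x y
          by (simp add: S_def inner_n_diff orth_proj_adjoint UH)
        show "onf n n (\<lambda>i. U (ev i))" using orthogonal_map_onf[OF U(1) onf_ev] by simp
      qed
      also have "\<dots> = (\<Sum>i<n. inner_n n (?i H i - ?i H' i) (?i H i - ?i H' i))"
      proof (rule sum.cong[OF refl])
        fix i assume "i \<in> {..<n}"
        then have e: "ev i \<in> Rn n" by (simp add: ev_Rn)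
        have "S (U (ev i)) = U (orth_proj n H (ev i) - orth_proj n H' (ev i))"
          unfolding S_def using orth_proj_image[OF U(1) HH(1,2) e] orth_proj_image[OF U(1) HH(3,4) e]
          by (simp add: linear_diff[OF orthogonal_mapD(1)[OF U(1)]])
        moreover have "orth_proj n H (ev i) - orth_proj n H' (ev i) \<in> Rn n"
          by (intro subspace_diff subspace_Rn orth_proj_in_Rn HH)
        ultimately show "inner_n n (S (U (ev i))) (S (U (ev i))) = inner_n n (?i H i - ?i H' i) (?i H i - ?i H' i)"
          using orthogonal_mapD(3)[OF U(1)] by simp
      qed
      finally show ?thesis by (simp add: U(2) S_def)
    qed
  next
    fix x y assume xy: "x \<in> ?X" "y \<in> ?X"
    obtain U where "orthogonal_map n U" "U ` x = y" using orthogonal_map_transitive_Grassmannian[OF xy] .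
    then show "\<exists>T\<in>?T. T x = y" by (intro bexI[of _ "(`) U"]) auto
  qed
  have "invariant_prob M" "invariant_prob N"
    using M N unfolding invariant_prob_def is_Haar_Grassmannian_def Grassmannian_borel_ev by auto
  then show ?thesis by (rule invariant_prob_unique)
qed

section \<open>Existence of Haar measures by adding one dimension\<close>

definition residual :: "nat \<Rightarrow> (nat \<Rightarrow> real) set \<Rightarrow> (nat \<Rightarrow> real) \<Rightarrow> nat \<Rightarrow> real" where
  "residual n H g = trunc n g - orth_proj n H g"

definition adjoin :: "nat \<Rightarrow> (nat \<Rightarrow> real) set \<Rightarrow> (nat \<Rightarrow> real) \<Rightarrow> (nat \<Rightarrow> real) set" where
  "adjoin n H g = {h + t *\<^sub>R residual n H g | h t. h \<in> H}"

text \<open>Apart from the dimension, the explicit projection onto the enlarged subspace is the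
  point: it is a measurable expression in the old projection and \<open>g\<close>.\<close>

lemma onb_adjoin:
  assumes u: "onb n j u H" and r: "inner_n n (residual n H g) (residual n H g) \<noteq> 0"
  defines "w \<equiv> residual n H g"
  defines "v \<equiv> u(j := (1 / sqrt (inner_n n w w)) *\<^sub>R w)"
  shows "onb n (Suc j) v (adjoin n H g)"
    and "orth_proj n (adjoin n H g) x = orth_proj n H x + (inner_n n x w / inner_n n w w) *\<^sub>R w"
proof -
  note H = onb_subspace[OF u]
  have o: "onf n j u" and Hr: "H = range (lc j u)" using u by (auto simp: onb_def)
  have ww: "inner_n n w w > 0" using r inner_n_nonneg[of n w] by (simp add: w_def)
  have wR: "w \<in> Rn n" unfolding w_def residual_def
    by (intro subspace_diff subspace_Rn trunc_Rn orth_proj_in_Rn H)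
  have wu: "inner_n n w (u i) = 0" if "i < j" for i
    using inner_orth_proj[OF H onb_in[OF u that], of g] by (simp add: w_def residual_def inner_n_diff inner_n_trunc)
  have 1: "inner_n n (v j) (v j) = 1" using ww by (simp add: v_def inner_n_scale)
  have 2: "inner_n n (v j) (v i) = 0" "inner_n n (v i) (v j) = 0" if "i < j" for i
    using that wu[OF that] by (simp_all add: v_def inner_n_scale inner_n_commute[of n "u i"])
  have 3: "inner_n n (v i) (v l) = (if i = l then 1 else 0)" if "i < j" "l < j" for i l
    using that o by (simp add: v_def onf_def)
  have vo: "onf n (Suc j) v" unfolding onf_def
  proof (intro conjI allI impI)
    fix i assume "i < Suc j" then show "v i \<in> Rn n"
      using o wR by (auto simp: v_def onf_def less_Suc_eq intro: subspace_scale[OF subspace_Rn])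
  next
    fix i l assume "i < Suc j" "l < Suc j"
    then show "inner_n n (v i) (v l) = (if i = l then 1 else 0)"
      by (elim less_SucE) (simp_all add: 1 2 3)
  qed
  have lv: "lc j v a = lc j u a" for a by (rule lc_cong) (auto simp: v_def)
  have vj: "v j = (1 / sqrt (inner_n n w w)) *\<^sub>R w" by (simp add: v_def)
  have "adjoin n H g = range (lc (Suc j) v)"
  proof (intro antisym subsetI)
    fix x assume "x \<in> adjoin n H g"
    then obtain a t where x: "x = lc j u a + t *\<^sub>R w" by (auto simp: adjoin_def Hr w_def)
    have "lc (Suc j) v (a(j := t * sqrt (inner_n n w w))) = lc j u (a(j := t * sqrt (inner_n n w w))) + t *\<^sub>R w"
      using ww by (simp add: lc_Suc lv vj)
    also have "lc j u (a(j := t * sqrt (inner_n n w w))) = lc j u a" by (rule lc_cong) auto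
    finally show "x \<in> range (lc (Suc j) v)" unfolding x by (metis rangeI)
  next
    fix x assume "x \<in> range (lc (Suc j) v)"
    then obtain a where "x = lc j u a + (a j * (1 / sqrt (inner_n n w w))) *\<^sub>R w" by (auto simp: lc_Suc lv vj)
    then show "x \<in> adjoin n H g" unfolding adjoin_def Hr w_def by blast
  qed
  with vo show b: "onb n (Suc j) v (adjoin n H g)" by (simp add: onb_def)
  show "orth_proj n (adjoin n H g) x = orth_proj n H x + (inner_n n x w / inner_n n w w) *\<^sub>R w"
  proof -
    have "orth_proj n (adjoin n H g) x = lc j u (\<lambda>i. inner_n n x (v i)) + inner_n n x (v j) *\<^sub>R v j"
      unfolding orth_proj_onb[OF b] lc_Suc lv ..
    also have "lc j u (\<lambda>i. inner_n n x (v i)) = orth_proj n H x"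
      unfolding orth_proj_onb[OF u] by (rule lc_cong) (auto simp: v_def)
    also have "inner_n n x (v j) *\<^sub>R v j = (inner_n n x w / inner_n n w w) *\<^sub>R w"
      using ww by (simp add: vj inner_n_scale)
    finally show ?thesis .
  qed
qed

lemma adjoin_image:
  assumes U: "orthogonal_map n U" and H: "subspace H" "H \<subseteq> Rn n" and g: "g \<in> Rn n"
  shows "residual n (U ` H) (U g) = U (residual n H g)" "adjoin n (U ` H) (U g) = U ` adjoin n H g"
proof -
  note lin = orthogonal_mapD(1)[OF U]
  show r: "residual n (U ` H) (U g) = U (residual n H g)"
    using orth_proj_image[OF U H g] orthogonal_mapD(2)[OF U g] g
    by (simp add: residual_def trunc_Rn linear_diff[OF lin])
  show "adjoin n (U ` H) (U g) = U ` adjoin n H g"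
    unfolding adjoin_def r by (auto simp: linear_add[OF lin] linear_scale[OF lin] image_iff) (metis linear_add[OF lin] linear_scale[OF lin])+
qed

text \<open>The residual of \<open>g\<close> is its projection onto the complement of
  \<open>H\<close>, which has positive dimension.\<close>

lemma AE_residual_nonzero:
  assumes H: "subspace H" "H \<subseteq> Rn n" "dim H < n"
  shows "AE g in gauss n. inner_n n (residual n H g) (residual n H g) \<noteq> 0"
proof -
  note f = orth_compl_facts[OF H(1,2)]
  have "dim (orth_compl n H) \<ge> 1" using f(3) H(3) by simp
  from AE_orth_proj_nonzero[OF f(1,2) this] show ?thesis
  proof eventually_elim
    case (elim g)
    then show ?case using inner_n_eq_0[OF orth_proj_in_Rn[OF f(1,2)], of g] f(4)[of g] by (simp add: residual_def)
  qed
qed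

text \<open>A Haar measure in the next dimension is obtained by adjoining to \<open>H\<close> the component of an independent
  Gaussian vector orthogonal to \<open>H\<close>.\<close>

lemma Haar_step:
  assumes M: "is_Haar_Grassmannian n j M" and j: "j < n"
  shows "\<exists>M'. is_Haar_Grassmannian n (Suc j) M'"
proof -
  have ps: "prob_space M" and ss [measurable_cong]: "sets M = sets (Grassmannian_borel n j)"
    and inv: "\<And>U. orthogonal_map n U \<Longrightarrow> distr M M ((`) U) = M"
    using M by (auto simp: is_Haar_Grassmannian_def)
  interpret M: prob_space M by (rule ps)
  interpret G: prob_space "gauss n" by (rule prob_space_gauss)
  interpret P: pair_prob_space M "gauss n" ..
  have sp: "space M = Grassmannian n j" using sets_eq_imp_space_eq[OF ss] by simp
  let ?K = "M \<Otimes>\<^sub>M gauss n" and ?G = "Grassmannian_borel n (Suc j)"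
  define r where "r H g = inner_n n (residual n H g) (residual n H g)" for H g
  \<comment> \<open>On the null set where nothing new is adjoined, an arbitrary subspace of the
    right dimension keeps \<open>f\<close> inside the Grassmannian.\<close>
  define f where "f p = (if r (fst p) (snd p) = 0 then Rn (Suc j) else adjoin n (fst p) (snd p))" for p
  have fM: "fst \<in> ?K \<rightarrow>\<^sub>M Grassmannian_borel n j"
    using measurable_fst[of M "gauss n"] measurable_cong_sets[OF refl ss] by blast
  have [measurable]: "snd \<in> borel_measurable ?K"
    using measurable_snd[of M "gauss n"] measurable_cong_sets[OF refl sets_gauss] by blast
  note op = measurable_orth_proj[OF fM]
  have res: "(\<lambda>p. residual n (fst p) (snd p)) \<in> borel_measurable ?K"
    unfolding residual_def by (intro measurable_add_seq op) measurable
  have fR: "f p \<in> Grassmannian n (Suc j)" if p: "fst p \<in> Grassmannian n j" for p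
  proof -
    obtain u where u: "onb n j u (fst p)" using Grassmannian_onb[OF p] .
    then show ?thesis
      using onb_Grassmannian[OF onb_adjoin(1)[OF u, of "snd p"]] Rn_Grassmannian[of "Suc j" n] j
      by (auto simp: f_def r_def)
  qed
  have f [measurable]: "f \<in> ?K \<rightarrow>\<^sub>M ?G"
  proof (rule measurable_GrassmannianI)
    show "f \<in> space ?K \<rightarrow> Grassmannian n (Suc j)"
      using fR by (auto simp: space_pair_measure sp)
    fix i l
    let ?w = "\<lambda>p. residual n (fst p) (snd p)"
    have "(\<lambda>p. (if r (fst p) (snd p) = 0 then orth_proj n (Rn (Suc j)) (ev i)
        else orth_proj n (fst p) (ev i) + (inner_n n (ev i) (?w p) / inner_n n (?w p) (?w p)) *\<^sub>R ?w p) l) \<in> borel_measurable ?K"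
    proof -
      have 1 [measurable]: "(\<lambda>p. inner_n n (?w p) (?w p)) \<in> borel_measurable ?K" by (intro measurable_inner_n res)
      have 2: "(\<lambda>p. orth_proj n (fst p) (ev i) + (inner_n n (ev i) (?w p) / inner_n n (?w p) (?w p)) *\<^sub>R ?w p) \<in> borel_measurable ?K"
        by (rule measurable_add_seq(1)[OF op[OF measurable_const] measurable_scaleR_seq[OF borel_measurable_divide[OF measurable_inner_n[OF measurable_const res] 1] res]]) simp_all
      have 3: "{p \<in> space ?K. inner_n n (?w p) (?w p) = 0} \<in> sets ?K" by measurable
      have c: "(\<lambda>_. orth_proj n (Rn (Suc j)) (ev i)) \<in> borel_measurable ?K" by simp
      show ?thesis unfolding r_def using measurable_nth[OF measurable_If[OF c 2 3], of l] .
    qed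
    moreover have "(if r (fst p) (snd p) = 0 then orth_proj n (Rn (Suc j)) (ev i)
        else orth_proj n (fst p) (ev i) + (inner_n n (ev i) (?w p) / inner_n n (?w p) (?w p)) *\<^sub>R ?w p) l = orth_proj n (f p) (ev i) l"
      if "p \<in> space ?K" for p
    proof -
      have "fst p \<in> Grassmannian n j" using that by (auto simp: space_pair_measure sp)
      then obtain u where "onb n j u (fst p)" by (rule Grassmannian_onb)
      from onb_adjoin(2)[OF this, of "snd p" "ev i"] show ?thesis by (simp add: f_def r_def)
    qed
    ultimately show "(\<lambda>p. orth_proj n (f p) (ev i) l) \<in> borel_measurable ?K"
      by (rule measurable_cong[THEN iffD1, rotated])
  qed
  define M' where "M' = distr ?K ?G f"
  have "distr M' M' ((`) U) = M'" if U: "orthogonal_map n U" for U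
  proof (rule measure_eqI)
    show "sets (distr M' M' ((`) U)) = sets M'" by simp
    have U' [measurable]: "(`) U \<in> ?G \<rightarrow>\<^sub>M ?G" by (rule measurable_Grassmannian_image[OF U])
    have UM: "(`) U \<in> M \<rightarrow>\<^sub>M M"
      using measurable_Grassmannian_image[OF U, of j] measurable_cong_sets[OF ss ss] by blast
    have sM': "sets M' = sets ?G" by (simp add: M'_def)
    fix A assume "A \<in> sets (distr M' M' ((`) U))"
    then have A [measurable]: "A \<in> sets ?G" by (simp add: sM')
    let ?A = "indicator A :: _ \<Rightarrow> ennreal"
    have Am [measurable]: "?A \<in> borel_measurable ?G" by simp
    have UA: "(`) U -` A \<inter> Grassmannian n (Suc j) \<in> sets ?G" using measurable_sets[OF U' A] by simp
    have o: "onf n n (\<lambda>i. U (ev i))" using orthogonal_map_onf[OF U onf_ev] by simp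
    have Afm: "(\<lambda>p. ?A (f p)) \<in> borel_measurable ?K" by (rule measurable_compose[OF f Am])
    have Afm2: "(\<lambda>g. ?A (f (H, g))) \<in> borel_measurable borel" if "H \<in> Grassmannian n j" for H
      using measurable_compose[OF measurable_Pair1'[of H M "gauss n"] Afm] that sp
      by (simp add: measurable_cong_sets[OF sets_gauss refl])
    have Afm3: "(\<lambda>H. \<integral>\<^sup>+g. ?A (f (H, g)) \<partial>gauss n) \<in> borel_measurable M"
      using G.borel_measurable_nn_integral_fst[OF Afm] by simp
    have "emeasure (distr M' M' ((`) U)) A = emeasure M' ((`) U -` A \<inter> space M')"
      using A U' by (intro emeasure_distr) (auto simp: sM' measurable_cong_sets[OF sM' sM'])
    also have "\<dots> = emeasure ?K (f -` ((`) U -` A \<inter> space M') \<inter> space ?K)"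
      unfolding M'_def by (rule emeasure_distr[OF f]) (use UA in simp)
    also have "\<dots> = (\<integral>\<^sup>+p. ?A (U ` f p) \<partial>?K)"
    proof -
      have "f -` ((`) U -` A \<inter> space M') \<inter> space ?K \<in> sets ?K"
        unfolding M'_def by (rule measurable_sets[OF f]) (use UA in simp)
      then have "emeasure ?K (f -` ((`) U -` A \<inter> space M') \<inter> space ?K) = (\<integral>\<^sup>+p. indicator (f -` ((`) U -` A \<inter> space M') \<inter> space ?K) p \<partial>?K)"
        by simp
      also have "\<dots> = (\<integral>\<^sup>+p. ?A (U ` f p) \<partial>?K)"
        using measurable_space[OF f] by (intro nn_integral_cong) (auto simp: M'_def indicator_def)
      finally show ?thesis .
    qed
    also have "\<dots> = (\<integral>\<^sup>+H. \<integral>\<^sup>+g. ?A (U ` f (H, g)) \<partial>gauss n \<partial>M)"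
      by (rule G.nn_integral_fst[symmetric]) (rule measurable_compose[OF f measurable_compose[OF U' Am]])
    \<comment> \<open>Adjoining commutes with \<open>U\<close>. For fixed \<open>H\<close> the
      rotated Gaussian vector is replaced by an unrotated one; in the next step invariance of
      \<open>M\<close> removes \<open>U\<close> from \<open>H\<close>.\<close>
    also have "\<dots> = (\<integral>\<^sup>+H. \<integral>\<^sup>+g. ?A (f (U ` H, g)) \<partial>gauss n \<partial>M)"
    proof (rule nn_integral_cong)
      fix H assume "H \<in> space M"
      then have HG: "H \<in> Grassmannian n j" by (simp add: sp)
      note H = GrassmannianD[OF HG]
      have "(\<integral>\<^sup>+g. ?A (U ` f (H, g)) \<partial>gauss n) = (\<integral>\<^sup>+g. ?A (f (U ` H, lc n (\<lambda>i. U (ev i)) g)) \<partial>gauss n)"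
      proof (intro nn_integral_cong_AE, use AE_gauss_Rn[of n] AE_residual_nonzero[OF H(1,2), unfolded H(3), OF j] in eventually_elim)
        fix g assume g: "g \<in> Rn n" and rr: "inner_n n (residual n H g) (residual n H g) \<noteq> 0"
        have rR: "residual n H g \<in> Rn n" unfolding residual_def
          by (intro subspace_diff subspace_Rn trunc_Rn orth_proj_in_Rn H)
        have "U ` f (H, g) = f (U ` H, U g)"
          using rr adjoin_image[OF U H(1,2) g] orthogonal_mapD(3)[OF U rR rR] by (simp add: f_def r_def)
        then show "?A (U ` f (H, g)) = ?A (f (U ` H, lc n (\<lambda>i. U (ev i)) g))"
          using orthogonal_map_eq_lc[OF U g] by simp
      qed
      also have "\<dots> = (\<integral>\<^sup>+g. ?A (f (U ` H, g)) \<partial>gauss n)"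
        by (rule nn_integral_gauss_orthogonal[OF o]) (rule Afm2[OF orthogonal_map_Grassmannian[OF U HG]])
      finally show "(\<integral>\<^sup>+g. ?A (U ` f (H, g)) \<partial>gauss n) = (\<integral>\<^sup>+g. ?A (f (U ` H, g)) \<partial>gauss n)" .
    qed
    also have "\<dots> = (\<integral>\<^sup>+H. \<integral>\<^sup>+g. ?A (f (H, g)) \<partial>gauss n \<partial>distr M M ((`) U))"
      by (rule nn_integral_distr[symmetric, OF UM]) (use Afm3 in simp)
    also have "\<dots> = (\<integral>\<^sup>+H. \<integral>\<^sup>+g. ?A (f (H, g)) \<partial>gauss n \<partial>M)" by (simp add: inv[OF U])
    also have "\<dots> = (\<integral>\<^sup>+p. ?A (f p) \<partial>?K)" by (rule G.nn_integral_fst[OF Afm])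
    also have "\<dots> = (\<integral>\<^sup>+x. ?A x \<partial>M')"
      unfolding M'_def by (rule nn_integral_distr[symmetric, OF f]) simp
    also have "\<dots> = emeasure M' A" using A by (simp add: sM')
    finally show "emeasure (distr M' M' ((`) U)) A = emeasure M' A" .
  qed
  then have "is_Haar_Grassmannian n (Suc j) M'"
    unfolding is_Haar_Grassmannian_def M'_def using P.prob_space_distr[OF f] by auto
  then show ?thesis by blast
qed

lemma Haar_Grassmannian_exists: "m \<le> n \<Longrightarrow> \<exists>M. is_Haar_Grassmannian n m M"
proof (induction m)
  case 0
  let ?G = "Grassmannian_borel n 0"
  have "onb n 0 (\<lambda>_. 0) {0}" by (auto simp: onb_def onf_def lc_0)
  then have in_G: "{0} \<in> space ?G" by (simp add: onb_Grassmannian)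
  have "is_Haar_Grassmannian n 0 (return ?G {0})"
    unfolding is_Haar_Grassmannian_def
  proof (intro conjI allI impI)
    show "prob_space (return ?G {0})" using in_G by (rule prob_space_return)
    show "sets (return ?G {0}) = sets ?G" by simp
    fix U assume U: "orthogonal_map n U"
    have U0: "U ` {0} = {0}" using linear_0[OF orthogonal_mapD(1)[OF U]] by simp
    have Um: "(`) U \<in> ?G \<rightarrow>\<^sub>M return ?G {0}"
      using measurable_Grassmannian_image[OF U, of 0] by simp
    have "distr (return ?G {0}) (return ?G {0}) ((`) U) = return (return ?G {0}) (U ` {0})"
      by (rule distr_return[OF Um in_G])
    then show "distr (return ?G {0}) (return ?G {0}) ((`) U) = return ?G {0}"
      unfolding U0 by (simp only: return_sets_cong[OF sets_return])
  qed
  then show ?case by blast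
next
  case (Suc m)
  then obtain M where "is_Haar_Grassmannian n m M" by auto
  then show ?case using Haar_step Suc.prems by auto
qed

lemma is_Haar_Haar_Grassmannian: "m \<le> n \<Longrightarrow> is_Haar_Grassmannian n m (Haar_Grassmannian n m)"
  unfolding Haar_Grassmannian_def
  using Haar_Grassmannian_exists Haar_Grassmannian_unique by (metis the_equality)

text \<open>Both sides are averages over a random subspace and an independent Gaussian vector. Invariance of the
  Haar measure replaces the vector by a multiple of \<open>v\<close>, whose length does not matter as \<open>\<psi>\<close> is homogeneous;
  invariance of the Gaussian measure replaces the subspace by \<open>\<real>\<^sup>m\<close>.\<close>

lemma Haar_random_subspace_vs_random_vector:
  fixes \<psi> :: "real \<Rightarrow> real \<Rightarrow> ennreal"
  assumes m: "m \<le> n" and \<psi>: "case_prod \<psi> \<in> borel_measurable (borel \<Otimes>\<^sub>M borel)"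
    "\<And>a b c. c > 0 \<Longrightarrow> \<psi> (c * a) (c * b) = \<psi> a b"
    and v: "v \<in> Rn n" "v \<noteq> 0"
  shows "(\<integral>\<^sup>+H. \<psi> (inner_n n (orth_proj n H v) (orth_proj n H v)) (inner_n n v v) \<partial>Haar_Grassmannian n m)
    = (\<integral>\<^sup>+g. \<psi> (inner_n m g g) (inner_n n g g) \<partial>gauss n)"
proof -
  let ?M = "Haar_Grassmannian n m"
  have ps: "prob_space ?M" and ss: "sets ?M = sets (Grassmannian_borel n m)"
    and inv: "\<And>U. orthogonal_map n U \<Longrightarrow> distr ?M ?M ((`) U) = ?M"
    using is_Haar_Haar_Grassmannian[OF m] by (auto simp: is_Haar_Grassmannian_def)
  interpret M: prob_space ?M by (rule ps)
  interpret G: prob_space "gauss n" by (rule prob_space_gauss)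
  interpret P: pair_sigma_finite ?M "gauss n" ..
  have sp: "space ?M = Grassmannian n m" using sets_eq_imp_space_eq[OF ss] by simp
  define \<Phi> where "\<Phi> H x = \<psi> (inner_n n (orth_proj n H x) (orth_proj n H x)) (inner_n n x x)" for H x
  have \<Phi>m: "(\<lambda>p. \<Phi> (fst p) (snd p)) \<in> borel_measurable (?M \<Otimes>\<^sub>M gauss n)"
  proof -
    have 1: "fst \<in> ?M \<Otimes>\<^sub>M gauss n \<rightarrow>\<^sub>M Grassmannian_borel n m"
      using measurable_fst[of ?M "gauss n"] measurable_cong_sets[OF refl ss] by blast
    have 2: "snd \<in> borel_measurable (?M \<Otimes>\<^sub>M gauss n)"
      using measurable_snd[of ?M "gauss n"] measurable_cong_sets[OF refl sets_gauss] by blast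
    have "(\<lambda>p. (inner_n n (orth_proj n (fst p) (snd p)) (orth_proj n (fst p) (snd p)), inner_n n (snd p) (snd p)))
      \<in> ?M \<Otimes>\<^sub>M gauss n \<rightarrow>\<^sub>M borel \<Otimes>\<^sub>M borel"
      by (intro measurable_Pair measurable_inner_n measurable_orth_proj[OF 1] 2)
    from measurable_compose[OF this \<psi>(1)] show ?thesis by (simp add: \<Phi>_def)
  qed
  have \<Phi>m1: "(\<lambda>H. \<Phi> H x) \<in> borel_measurable ?M" for x
    using measurable_compose[OF measurable_Pair2'[of x "gauss n" ?M] \<Phi>m] by simp
  have \<Phi>m2: "(\<lambda>x. \<Phi> H x) \<in> borel_measurable borel" if "H \<in> Grassmannian n m" for H
    using measurable_compose[OF measurable_Pair1'[of H ?M "gauss n"] \<Phi>m] that sp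
    by (simp add: measurable_cong_sets[OF sets_gauss refl])
  have \<Phi>U: "\<Phi> (U ` H) (U x) = \<Phi> H x" if U: "orthogonal_map n U" and H: "H \<in> Grassmannian n m" and x: "x \<in> Rn n" for U H x
  proof -
    note HD = GrassmannianD(1,2)[OF H]
    show ?thesis unfolding \<Phi>_def orth_proj_image[OF U HD x]
      using orthogonal_mapD(3)[OF U x x] orthogonal_mapD(3)[OF U orth_proj_in_Rn[OF HD] orth_proj_in_Rn[OF HD]] by simp
  qed
  define A where "A x = (\<integral>\<^sup>+H. \<Phi> H x \<partial>?M)" for x
  have AU: "A (U x) = A x" if U: "orthogonal_map n U" and x: "x \<in> Rn n" for U x
  proof -
    have UM: "(`) U \<in> ?M \<rightarrow>\<^sub>M ?M"
      using measurable_Grassmannian_image[OF U, of m] measurable_cong_sets[OF ss ss] by blast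
    have "A (U x) = (\<integral>\<^sup>+H. \<Phi> H (U x) \<partial>distr ?M ?M ((`) U))" by (simp add: A_def inv[OF U])
    also have "\<dots> = (\<integral>\<^sup>+H. \<Phi> (U ` H) (U x) \<partial>?M)"
      by (rule nn_integral_distr[OF UM]) (use \<Phi>m1 in simp)
    also have "\<dots> = A x" unfolding A_def using \<Phi>U[OF U _ x] sp by (intro nn_integral_cong) auto
    finally show ?thesis .
  qed
  have As: "A (c *\<^sub>R x) = A x" if "c \<noteq> 0" for c x
  proof -
    have "\<Phi> H (c *\<^sub>R x) = \<Phi> H x" if "H \<in> Grassmannian n m" for H
      using \<psi>(2)[of "c * c"] \<open>c \<noteq> 0\<close> linear_scale[OF orth_proj_linear[OF GrassmannianD(1,2)[OF that]], of c x]
      by (simp add: \<Phi>_def inner_n_scale mult.assoc zero_less_mult_iff) (metis linorder_neqE_linordered_idom mult.assoc)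
    then show ?thesis unfolding A_def using sp by (intro nn_integral_cong) auto
  qed
  have Aconst: "A x = A v" if x: "x \<in> Rn n" "x \<noteq> 0" for x
  proof -
    define c where "c = sqrt (inner_n n v v / inner_n n x x)"
    have p: "inner_n n x x > 0" "inner_n n v v > 0"
      using inner_n_eq_0[OF x(1)] inner_n_eq_0[OF v(1)] x v inner_n_nonneg[of n x] inner_n_nonneg[of n v] by (simp_all add: less_le)
    then have c: "c \<noteq> 0" "c * c * inner_n n x x = inner_n n v v" by (simp_all add: c_def)
    have "inner_n n (c *\<^sub>R x) (c *\<^sub>R x) = inner_n n v v" using c by (simp add: inner_n_scale mult.assoc)
    then obtain U where "orthogonal_map n U" "U (c *\<^sub>R x) = v"
      using orthogonal_map_transitive[OF subspace_scale[OF subspace_Rn x(1)] v(1)] by blast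
    then show ?thesis using AU[of U "c *\<^sub>R x"] As[OF c(1)] subspace_scale[OF subspace_Rn x(1)] by metis
  qed
  have B: "(\<integral>\<^sup>+g. \<Phi> H g \<partial>gauss n) = (\<integral>\<^sup>+g. \<Phi> (Rn m) g \<partial>gauss n)" if H: "H \<in> Grassmannian n m" for H
  proof -
    obtain U where U: "orthogonal_map n U" "U ` Rn m = H"
      using orthogonal_map_transitive_Grassmannian[OF Rn_Grassmannian[OF m] H] .
    have o: "onf n n (\<lambda>i. U (ev i))" using orthogonal_map_onf[OF U(1) onf_ev] by simp
    have "(\<integral>\<^sup>+g. \<Phi> H g \<partial>gauss n) = (\<integral>\<^sup>+g. \<Phi> H (lc n (\<lambda>i. U (ev i)) g) \<partial>gauss n)"
      by (rule nn_integral_gauss_orthogonal[OF o \<Phi>m2[OF H], symmetric])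
    also have "\<dots> = (\<integral>\<^sup>+g. \<Phi> (Rn m) g \<partial>gauss n)"
    proof (intro nn_integral_cong_AE, use AE_gauss_Rn[of n] in eventually_elim)
      fix g assume "g \<in> Rn n"
      then show "\<Phi> H (lc n (\<lambda>i. U (ev i)) g) = \<Phi> (Rn m) g"
        using \<Phi>U[OF U(1) Rn_Grassmannian[OF m]] orthogonal_map_eq_lc[OF U(1)] U(2) by metis
    qed
    finally show ?thesis .
  qed
  have n: "n \<ge> 1" using v by (cases n) (auto simp: Rn_iff zero_fun_def)
  have ne: "AE g in gauss n. g \<in> Rn n \<and> g \<noteq> 0"
  proof -
    have "AE g in gauss n. inner_n n g (ev 0) \<noteq> 0"
    proof (rule AE_gauss_inner_nonzero)
      have "ev 0 0 = 1" by (simp add: ev_def)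
      then show "inner_n n (ev 0) (ev 0) = 1" using n by (simp add: inner_n_ev)
    qed (use n in \<open>simp add: ev_Rn\<close>)
    with AE_gauss_Rn[of n] show ?thesis by eventually_elim (auto simp: inner_n_zero)
  qed
  have "A v = (\<integral>\<^sup>+g. A v \<partial>gauss n)" by (simp add: G.emeasure_space_1[simplified])
  also have "\<dots> = (\<integral>\<^sup>+g. A g \<partial>gauss n)"
    using ne Aconst by (intro nn_integral_cong_AE) auto
  also have "\<dots> = (\<integral>\<^sup>+H. \<integral>\<^sup>+g. \<Phi> H g \<partial>gauss n \<partial>?M)"
    unfolding A_def using P.Fubini'[of \<Phi>] \<Phi>m by (simp add: case_prod_beta')
  also have "\<dots> = (\<integral>\<^sup>+H. \<integral>\<^sup>+g. \<Phi> (Rn m) g \<partial>gauss n \<partial>?M)"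
    by (rule nn_integral_cong) (simp add: sp B)
  also have "\<dots> = (\<integral>\<^sup>+g. \<Phi> (Rn m) g \<partial>gauss n)" by (simp add: M.emeasure_space_1)
  also have "\<dots> = (\<integral>\<^sup>+g. \<psi> (inner_n m g g) (inner_n n g g) \<partial>gauss n)"
  proof -
    have "inner_n n (trunc m g) (trunc m g) = inner_n m g g" for g
      using inner_n_Rn(1)[OF trunc_Rn(1) m, of g] by (simp add: inner_n_trunc)
    then show ?thesis by (simp add: \<Phi>_def orth_proj_Rn[OF m])
  qed
  finally show ?thesis by (simp add: A_def \<Phi>_def)
qed

section \<open>Concentration of the principal values\<close>

lemma exp_half_le:
  assumes "0 \<le> x" "x \<le> 1"
  shows "exp (x / 2) \<le> 1 + (x :: real)"
proof -
  have "exp (x / 2) \<le> 1 + x / 2 + (x / 2)\<^sup>2" using assms by (intro exp_bound) auto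
  also have "(x / 2)\<^sup>2 \<le> x / 2"
  proof -
    have "(x / 2) * (x / 2) \<le> (x / 2) * 1" using assms by (intro mult_left_mono) auto
    then show ?thesis by (simp add: power2_eq_square)
  qed
  finally show ?thesis by simp
qed

lemma prod_lessThan_split:
  assumes "m \<le> n"
  shows "(\<Prod>i<n. if i < m then a else b) = a ^ m * (b :: real) ^ (n - m)"
proof -
  have "{..<n} \<inter> {i. i < m} = {..<m}" "{..<n} \<inter> - {i. i < m} = {m..<n}" using assms by auto
  then show ?thesis by (simp add: prod.If_cases)
qed

text \<open>Variables stand for the products with \<epsilon> that occur in the concentration bound,
  which keeps the argument linear.\<close>

lemma halves_diff:
  fixes p q s t :: real
  assumes "p / 2 + q / 2 < \<bar>s - (s + t) / 2\<bar>"
  shows "0 < (s - p) - (t + q) \<or> 0 < (t - q) - (s + p)"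
proof -
  have eq: "s - (s + t) / 2 = (s - t) / 2" by (simp add: field_simps)
  have "\<bar>s - (s + t) / 2\<bar> = \<bar>s - t\<bar> / 2" unfolding eq by simp
  then have "p / 2 + q / 2 < \<bar>s - t\<bar> / 2" using assms by (simp only:)
  moreover have "p / 2 + q / 2 < w / 2 \<Longrightarrow> p + q < w" for w by linarith
  ultimately have "p + q < \<bar>s - t\<bar>" by blast
  then show ?thesis by (cases "s \<ge> t") simp_all
qed

text \<open>Here \<open>a\<close> is the square of the norm of the projection of a vector, and \<open>b\<close> that of the vector.\<close>

definition unbalanced :: "real \<Rightarrow> real \<Rightarrow> real \<Rightarrow> bool" where
  "unbalanced \<epsilon> a b \<longleftrightarrow> \<bar>a - b / 2\<bar> > (\<epsilon> / 2) * b"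

text \<open>A Chernoff bound. The unbalanced event is the union of
  \<open>0 < (1 - \<epsilon>) * S1 g - (1 + \<epsilon>) * S2 g\<close> and its mirror image; the
  exponential is taken with the factor \<open>\<epsilon> / 2\<close>. For even \<open>n\<close> each
  expectation is a power \<open>m\<close> of \<open>1 / sqrt (a * b)\<close>, where the linear terms
  cancel and \<open>a * b \<ge> 1 + \<epsilon>\<^sup>2\<close>. An odd \<open>n\<close> costs a
  factor of at most 2 in one of the two, hence the 3.\<close>

lemma gauss_half_norm_concentration:
  assumes \<epsilon>: "0 < \<epsilon>" "\<epsilon> \<le> 1" and m: "m = n div 2"
  shows "(\<integral>\<^sup>+g. of_bool (unbalanced \<epsilon> (inner_n m g g) (inner_n n g g)) \<partial>gauss n)
    \<le> ennreal (3 * exp (- \<epsilon>\<^sup>2 * m / 4))"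
proof -
  define a b where "a = 1 - \<epsilon> + \<epsilon>\<^sup>2" and "b = 1 + \<epsilon> + \<epsilon>\<^sup>2"
  have a: "a \<ge> 3 / 4"
  proof -
    have "0 \<le> (\<epsilon> - 1 / 2)\<^sup>2" by simp
    then show ?thesis by (simp add: a_def power2_eq_square algebra_simps)
  qed
  have b: "b \<ge> 1" using \<epsilon> by (simp add: b_def)
  have ab: "a * b = 1 + \<epsilon>\<^sup>2 + \<epsilon> ^ 4"
    by (simp add: a_def b_def algebra_simps power2_eq_square power4_eq_xxxx)
  have mn: "m \<le> n" "n - m = m \<or> n - m = Suc m" using m by auto
  have key: "(1 / sqrt a) ^ m * (1 / sqrt b) ^ m \<le> exp (- \<epsilon>\<^sup>2 * m / 4)"
  proof -
    have "\<epsilon>\<^sup>2 \<le> 1" using \<epsilon> by (simp add: power_le_one)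
    then have "exp (\<epsilon>\<^sup>2 / 2) \<le> 1 + \<epsilon>\<^sup>2" by (intro exp_half_le) auto
    also have "\<dots> \<le> a * b" unfolding ab by simp
    finally have "sqrt (exp (\<epsilon>\<^sup>2 / 2)) \<le> sqrt a * sqrt b" by (simp add: real_sqrt_mult[symmetric])
    moreover have "sqrt (exp (\<epsilon>\<^sup>2 / 2)) = exp (\<epsilon>\<^sup>2 / 4)"
      by (rule real_sqrt_unique) (simp_all add: exp_double[symmetric])
    ultimately have "1 / (sqrt a * sqrt b) \<le> 1 / exp (\<epsilon>\<^sup>2 / 4)" using a b by (intro divide_left_mono) auto
    then have "(1 / (sqrt a * sqrt b)) ^ m \<le> exp (- (\<epsilon>\<^sup>2 / 4)) ^ m"
      using a b by (intro power_mono) (auto simp: exp_minus inverse_eq_divide)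
    also have "\<dots> = exp (- \<epsilon>\<^sup>2 * m / 4)" by (simp add: exp_of_nat_mult[symmetric] mult.commute)
    finally show ?thesis by (simp add: power_mult_distrib[symmetric] power_divide)
  qed
  have sa: "1 / sqrt a \<le> 2" "1 / sqrt b \<le> 1" "1 / sqrt a \<ge> 0" "1 / sqrt b \<ge> 0"
  proof -
    have "1 / 2 \<le> sqrt a" using a by (intro real_le_rsqrt) (simp add: power2_eq_square)
    then show "1 / sqrt a \<le> 2" using a by (simp add: divide_simps)
  qed (use a b in auto)
  have ineq1: "(1 / sqrt a) ^ m * (1 / sqrt b) ^ (n - m) \<le> exp (- \<epsilon>\<^sup>2 * m / 4)"
  proof -
    have "(1 / sqrt b) ^ (n - m) \<le> (1 / sqrt b) ^ m" using mn sa by (intro power_decreasing) auto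
    then have "(1 / sqrt a) ^ m * (1 / sqrt b) ^ (n - m) \<le> (1 / sqrt a) ^ m * (1 / sqrt b) ^ m"
      using sa by (intro mult_left_mono) auto
    then show ?thesis using key by linarith
  qed
  have ineq2: "(1 / sqrt b) ^ m * (1 / sqrt a) ^ (n - m) \<le> 2 * exp (- \<epsilon>\<^sup>2 * m / 4)"
  proof -
    have "(1 / sqrt a) ^ (n - m) \<le> 2 * (1 / sqrt a) ^ m"
    proof (cases "n - m = m")
      case False
      then have eq: "(1 / sqrt a) ^ (n - m) = (1 / sqrt a) * (1 / sqrt a) ^ m" using mn by auto
      show ?thesis unfolding eq by (rule mult_right_mono[OF sa(1)]) (rule zero_le_power[OF sa(3)])
    qed (use sa in auto)
    then have "(1 / sqrt b) ^ m * (1 / sqrt a) ^ (n - m) \<le> (1 / sqrt b) ^ m * (2 * (1 / sqrt a) ^ m)"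
      using sa by (intro mult_left_mono) auto
    then show ?thesis using key by (simp add: mult_ac)
  qed
  \<comment> \<open>The coefficients of the two Chernoff exponents; \<open>1 - 2 * c1 i\<close> and
    \<open>1 - 2 * c2 i\<close> are \<open>a\<close> or \<open>b\<close>.\<close>
  define c1 c2 where "c1 i = (if i < m then \<epsilon> / 2 * (1 - \<epsilon>) else - \<epsilon> / 2 * (1 + \<epsilon>))"
    and "c2 i = (if i < m then - \<epsilon> / 2 * (1 + \<epsilon>) else \<epsilon> / 2 * (1 - \<epsilon>))" for i
  have small: "\<epsilon> * (1 - \<epsilon>) < 1" "- \<epsilon> * (1 + \<epsilon>) < 1"
    using a b by (auto simp: a_def b_def algebra_simps power2_eq_square)
  have c: "c1 i < 1 / 2" "c2 i < 1 / 2" for i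
    using small by (auto simp: c1_def c2_def)
  have e12: "1 - 2 * (\<epsilon> / 2 * (1 - \<epsilon>)) = a" "1 - 2 * (- \<epsilon> / 2 * (1 + \<epsilon>)) = b"
    by (simp_all add: a_def b_def field_simps power2_eq_square)
  have r: "1 / sqrt (1 - 2 * c1 i) = (if i < m then 1 / sqrt a else 1 / sqrt b)"
    "1 / sqrt (1 - 2 * c2 i) = (if i < m then 1 / sqrt b else 1 / sqrt a)" for i
    by (cases "i < m"; simp only: c1_def c2_def if_True if_False e12)+
  define S1 S2 where "S1 g = (\<Sum>i<m. (g i)\<^sup>2)" and "S2 g = (\<Sum>i\<in>{m..<n}. (g i)\<^sup>2)" for g :: "nat \<Rightarrow> real"
  have sum_c: "(\<Sum>i<n. c1 i * (g i)\<^sup>2) = \<epsilon> / 2 * ((1 - \<epsilon>) * S1 g - (1 + \<epsilon>) * S2 g)"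
    "(\<Sum>i<n. c2 i * (g i)\<^sup>2) = \<epsilon> / 2 * ((1 - \<epsilon>) * S2 g - (1 + \<epsilon>) * S1 g)"
    "inner_n n g g = S1 g + S2 g" "inner_n m g g = S1 g" for g
  proof -
    have u: "{..<n} = {..<m} \<union> {m..<n}" using mn by auto
    have split: "(\<Sum>i<n. h i) = (\<Sum>i<m. h i) + (\<Sum>i\<in>{m..<n}. h i)" for h :: "nat \<Rightarrow> real"
      unfolding u by (rule sum.union_disjoint) auto
    show "(\<Sum>i<n. c1 i * (g i)\<^sup>2) = \<epsilon> / 2 * ((1 - \<epsilon>) * S1 g - (1 + \<epsilon>) * S2 g)"
      "(\<Sum>i<n. c2 i * (g i)\<^sup>2) = \<epsilon> / 2 * ((1 - \<epsilon>) * S2 g - (1 + \<epsilon>) * S1 g)"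
    proof -
      have "(\<Sum>i<m. c1 i * (g i)\<^sup>2) = (\<epsilon> / 2 * (1 - \<epsilon>)) * S1 g" "(\<Sum>i<m. c2 i * (g i)\<^sup>2) = (- \<epsilon> / 2 * (1 + \<epsilon>)) * S1 g"
        unfolding S1_def sum_distrib_left by (rule sum.cong; simp add: c1_def c2_def)+
      moreover have "(\<Sum>i\<in>{m..<n}. c1 i * (g i)\<^sup>2) = (- \<epsilon> / 2 * (1 + \<epsilon>)) * S2 g" "(\<Sum>i\<in>{m..<n}. c2 i * (g i)\<^sup>2) = (\<epsilon> / 2 * (1 - \<epsilon>)) * S2 g"
        unfolding S2_def sum_distrib_left by (rule sum.cong; simp add: c1_def c2_def)+
      ultimately show "(\<Sum>i<n. c1 i * (g i)\<^sup>2) = \<epsilon> / 2 * ((1 - \<epsilon>) * S1 g - (1 + \<epsilon>) * S2 g)"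
        "(\<Sum>i<n. c2 i * (g i)\<^sup>2) = \<epsilon> / 2 * ((1 - \<epsilon>) * S2 g - (1 + \<epsilon>) * S1 g)"
        unfolding split by (simp_all only:) (simp_all add: field_simps)
    qed
    show "inner_n n g g = S1 g + S2 g" "inner_n m g g = S1 g"
      by (simp_all add: inner_n_def split S1_def S2_def power2_eq_square)
  qed
  have "(\<integral>\<^sup>+g. of_bool (unbalanced \<epsilon> (inner_n m g g) (inner_n n g g)) \<partial>gauss n)
    \<le> (\<integral>\<^sup>+g. ennreal (exp (\<Sum>i<n. c1 i * (g i)\<^sup>2)) + ennreal (exp (\<Sum>i<n. c2 i * (g i)\<^sup>2)) \<partial>gauss n)"
  proof (rule nn_integral_mono)
    fix g
    show "of_bool (unbalanced \<epsilon> (inner_n m g g) (inner_n n g g))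
      \<le> ennreal (exp (\<Sum>i<n. c1 i * (g i)\<^sup>2)) + ennreal (exp (\<Sum>i<n. c2 i * (g i)\<^sup>2))"
    proof (cases "unbalanced \<epsilon> (inner_n m g g) (inner_n n g g)")
      case True
      then have "0 < (1 - \<epsilon>) * S1 g - (1 + \<epsilon>) * S2 g \<or> 0 < (1 - \<epsilon>) * S2 g - (1 + \<epsilon>) * S1 g"
      proof -
        have "\<epsilon> * S1 g / 2 + \<epsilon> * S2 g / 2 < \<bar>S1 g - (S1 g + S2 g) / 2\<bar>"
          using True unfolding unbalanced_def sum_c by (simp add: distrib_left)
        moreover have "(1 - \<epsilon>) * S1 g = S1 g - \<epsilon> * S1 g" "(1 + \<epsilon>) * S2 g = S2 g + \<epsilon> * S2 g"
          "(1 - \<epsilon>) * S2 g = S2 g - \<epsilon> * S2 g" "(1 + \<epsilon>) * S1 g = S1 g + \<epsilon> * S1 g"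
          by (simp_all add: algebra_simps)
        moreover have "p / 2 + q / 2 < \<bar>s - (s + t) / 2\<bar> \<Longrightarrow> 0 < (s - p) - (t + q) \<or> 0 < (t - q) - (s + p)" for p q s t :: real
          by (rule halves_diff)
        ultimately show ?thesis by (simp only:)
      qed
      then have "1 \<le> exp (\<Sum>i<n. c1 i * (g i)\<^sup>2) + exp (\<Sum>i<n. c2 i * (g i)\<^sup>2)"
      proof
        assume "0 < (1 - \<epsilon>) * S1 g - (1 + \<epsilon>) * S2 g"
        then have "1 \<le> exp (\<Sum>i<n. c1 i * (g i)\<^sup>2)" unfolding sum_c using \<epsilon> by simp
        then show ?thesis by (rule order_trans) simp
      next
        assume "0 < (1 - \<epsilon>) * S2 g - (1 + \<epsilon>) * S1 g"
        then have "1 \<le> exp (\<Sum>i<n. c2 i * (g i)\<^sup>2)" unfolding sum_c using \<epsilon> by simp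
        then show ?thesis by (rule order_trans) simp
      qed
      then show ?thesis using True by (simp add: ennreal_plus[symmetric] del: ennreal_plus)
    qed simp
  qed
  also have "\<dots> = ennreal (\<Prod>i<n. 1 / sqrt (1 - 2 * c1 i)) + ennreal (\<Prod>i<n. 1 / sqrt (1 - 2 * c2 i))"
    using nn_integral_gauss_exp_square[of n c1] nn_integral_gauss_exp_square[of n c2] c
    by (subst nn_integral_add) auto
  also have "\<dots> = ennreal ((1 / sqrt a) ^ m * (1 / sqrt b) ^ (n - m)) + ennreal ((1 / sqrt b) ^ m * (1 / sqrt a) ^ (n - m))"
    unfolding r prod_lessThan_split[OF mn(1)] ..
  also have "\<dots> \<le> ennreal (exp (- \<epsilon>\<^sup>2 * m / 4)) + ennreal (2 * exp (- \<epsilon>\<^sup>2 * m / 4))"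
    using ineq1 ineq2 by (intro add_mono ennreal_leI)
  also have "\<dots> = ennreal (3 * exp (- \<epsilon>\<^sup>2 * m / 4))"
    by (simp add: ennreal_plus[symmetric] del: ennreal_plus)
  finally show ?thesis .
qed

section \<open>A lower bound for the Gaussian measure of a cap, and its use for principal
  values\<close>

lemma std_normal_interval_lower:
  assumes "c \<ge> 0"
  shows "ennreal (exp (- (c + 1)\<^sup>2 / 2 - 1)) \<le> (\<integral>\<^sup>+t. ennreal (std_normal_density t) * indicator {c..c+1} t \<partial>lborel)"
proof -
  \<comment> \<open>The normalising constant is traded for \<open>exp (- 1)\<close>, so that the
    lower bound is a pure exponential.\<close>
  have s: "exp (- 1) \<le> 1 / sqrt (2 * pi)"
  proof -
    have "2 * pi \<le> 2 * (16 / 5)" using pi_approx by simp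
    also have "\<dots> \<le> 2.7 * 2.7" by simp
    also have "\<dots> \<le> exp 1 * (exp 1 :: real)"
    proof -
      have "(2.7 :: real) \<le> exp 1" using e_approx_32 by (simp add: abs_if split: if_splits)
      then show ?thesis by (intro mult_mono) auto
    qed
    finally have "sqrt (2 * pi) \<le> exp 1" by (intro real_le_lsqrt) (auto simp: power2_eq_square)
    then show ?thesis by (simp add: exp_minus inverse_eq_divide divide_simps)
  qed
  have "ennreal (exp (- (c + 1)\<^sup>2 / 2 - 1)) = (\<integral>\<^sup>+t. ennreal (exp (- (c + 1)\<^sup>2 / 2 - 1)) * indicator {c..c+1} t \<partial>lborel)"
    by (simp add: nn_integral_cmult)
  also have "\<dots> \<le> (\<integral>\<^sup>+t. ennreal (std_normal_density t) * indicator {c..c+1} t \<partial>lborel)"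
  proof (rule nn_integral_mono)
    fix t
    have "exp (- (c + 1)\<^sup>2 / 2 - 1) \<le> std_normal_density t" if "t \<in> {c..c+1}"
    proof -
    have "t\<^sup>2 \<le> (c + 1)\<^sup>2" using assms that by (intro power_mono) auto
    then have "exp (- (c + 1)\<^sup>2 / 2) \<le> exp (- t\<^sup>2 / 2)" by simp
    then have "exp (- 1) * exp (- (c + 1)\<^sup>2 / 2) \<le> 1 / sqrt (2 * pi) * exp (- t\<^sup>2 / 2)"
      using s by (intro mult_mono) auto
    moreover have "exp (- (c + 1)\<^sup>2 / 2 - 1) = exp (- 1) * exp (- (c + 1)\<^sup>2 / 2)"
      by (simp add: exp_add[symmetric])
    ultimately show ?thesis by (simp add: std_normal_density_def)
    qed
    then show "ennreal (exp (- (c + 1)\<^sup>2 / 2 - 1)) * indicator {c..c+1} t \<le> ennreal (std_normal_density t) * indicator {c..c+1} t"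
      by (auto simp: indicator_def intro: ennreal_leI)
  qed
  finally show ?thesis .
qed

lemma prod_mono_ennreal:
  fixes f g :: "nat \<Rightarrow> ennreal"
  shows "(\<And>i. f i \<le> g i) \<Longrightarrow> (\<Prod>i<k. f i) \<le> (\<Prod>i<k. g i)"
  by (induction k) (auto intro: mult_mono)

text \<open>After a rotation \<open>v\<close> is the first axis, and a box inside the cap suffices:
  if the first coordinate lies in the interval of length 1 that starts at sqrt (3 k), and the others
  in [0, 1], then the first squared coordinate exceeds 3 times the sum of the rest. In the exponent
  the first coordinate costs at most 3 k + 2 and every other one 3 / 2, together at most 6
  k.\<close>

lemma gauss_cap_lower:
  assumes v: "v \<in> Rn k" "inner_n k v v = 1"
  shows "ennreal (exp (- 6 * real k)) \<le> (\<integral>\<^sup>+x. of_bool ((inner_n k x v)\<^sup>2 > 3 / 4 * inner_n k x x) \<partial>gauss k)"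
proof -
  have k: "0 < k" using v(2) by (cases k) (auto simp: inner_n_def)
  have "onf k 1 (\<lambda>_. v)" using v by (auto simp: onf_def)
  then obtain u where u: "onf k k u" "u 0 = v" using onf_extend_full by (metis less_one)
  define c where "c i = (if i = 0 then sqrt (3 * real k) else 0)" for i :: nat
  have c0: "c i \<ge> 0" for i by (simp add: c_def)
  have "ennreal (exp (- 6 * real k)) \<le> ennreal (\<Prod>i<k. exp (- (c i + 1)\<^sup>2 / 2 - 1))"
  proof (rule ennreal_leI)
    have "(\<Sum>i<k. (c i + 1)\<^sup>2 / 2 + 1) \<le> (\<Sum>i<k. (if i = 0 then 3 * real k + 1 / 2 else 0) + 3 / 2)"
    proof (rule sum_mono)
      fix i
      have "0 \<le> (c 0 - 1)\<^sup>2" by simp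
      then have "(c 0 + 1)\<^sup>2 \<le> 2 * (c 0)\<^sup>2 + 2" by (simp add: power2_eq_square algebra_simps)
      also have "(c 0)\<^sup>2 = 3 * real k" by (simp add: c_def)
      finally show "(c i + 1)\<^sup>2 / 2 + 1 \<le> (if i = 0 then 3 * real k + 1 / 2 else 0) + 3 / 2"
        by (cases "i = 0") (simp_all add: c_def)
    qed
    also have "\<dots> = 3 * real k + 1 / 2 + 3 / 2 * real k" using k by (simp add: sum.distrib)
    also have "\<dots> \<le> 6 * real k" using k by simp
    finally have "exp (- 6 * real k) \<le> exp (- (\<Sum>i<k. (c i + 1)\<^sup>2 / 2 + 1))" by simp
    also have "\<dots> = (\<Prod>i<k. exp (- (c i + 1)\<^sup>2 / 2 - 1))"
      by (simp add: exp_sum[symmetric] sum_negf[symmetric])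
    finally show "exp (- 6 * real k) \<le> (\<Prod>i<k. exp (- (c i + 1)\<^sup>2 / 2 - 1))" .
  qed
  also have "\<dots> = (\<Prod>i<k. ennreal (exp (- (c i + 1)\<^sup>2 / 2 - 1)))" by (simp add: prod_ennreal)
  also have "\<dots> \<le> (\<Prod>i<k. \<integral>\<^sup>+t. ennreal (std_normal_density t) * indicator {c i..c i+1} t \<partial>lborel)"
    by (rule prod_mono_ennreal) (rule std_normal_interval_lower[OF c0])
  also have "\<dots> = (\<integral>\<^sup>+x. (\<Prod>i<k. indicator {c i..c i+1} (x i)) \<partial>gauss k)"
    by (rule nn_integral_gauss_prod[symmetric]) simp
  also have "\<dots> \<le> (\<integral>\<^sup>+x. of_bool ((x 0)\<^sup>2 > 3 / 4 * inner_n k x x) \<partial>gauss k)"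
  proof (rule nn_integral_mono)
    fix x :: "nat \<Rightarrow> real"
    show "(\<Prod>i<k. indicator {c i..c i+1} (x i)) \<le> (of_bool ((x 0)\<^sup>2 > 3 / 4 * inner_n k x x) :: ennreal)"
    proof (cases "\<forall>i<k. x i \<in> {c i..c i+1}")
      case True
      have "inner_n k x x = (\<Sum>i<k. (x i)\<^sup>2)" by (simp add: inner_n_def power2_eq_square)
      also have "\<dots> = (x 0)\<^sup>2 + (\<Sum>i\<in>{..<k} - {0}. (x i)\<^sup>2)" using k by (subst sum.remove[of _ 0]) auto
      also have "(\<Sum>i\<in>{..<k} - {0}. (x i)\<^sup>2) \<le> (\<Sum>i\<in>{..<k} - {0}. 1)"
        using True by (intro sum_mono) (auto simp: c_def power_le_one)
      also have "\<dots> = real k - 1" using k by (simp add: of_nat_diff)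
      finally have "inner_n k x x \<le> (x 0)\<^sup>2 + (real k - 1)" by simp
      moreover have "3 * real k \<le> (x 0)\<^sup>2"
        using True[rule_format, OF k] by (intro sqrt_le_D) (simp add: c_def)
      ultimately have "(x 0)\<^sup>2 > 3 / 4 * inner_n k x x" by simp
      moreover have "(\<Prod>i<k. indicator {c i..c i+1} (x i)) \<le> (1 :: ennreal)"
        using True by (simp add: indicator_def)
      ultimately show ?thesis by simp
    next
      case False
      then obtain i where "i < k" "x i \<notin> {c i..c i+1}" by blast
      then have z: "(\<Prod>i<k. indicator {c i..c i+1} (x i)) = (0 :: ennreal)" by (intro prod_zero bexI[of _ i]) auto
      show ?thesis unfolding z by simp
    qed
  qed
  also have "\<dots> = (\<integral>\<^sup>+x. of_bool ((inner_n k (lc k u x) v)\<^sup>2 > 3 / 4 * inner_n k (lc k u x) (lc k u x)) \<partial>gauss k)"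
    using onf_inner_lc(1)[OF u(1) k] onf_inner_lc(2)[OF u(1)] u(2) by (simp add: inner_n_def[of k])
  also have "\<dots> = (\<integral>\<^sup>+x. of_bool ((inner_n k x v)\<^sup>2 > 3 / 4 * inner_n k x x) \<partial>gauss k)"
    by (rule nn_integral_gauss_orthogonal[OF u(1)]) measurable
  finally show ?thesis .
qed

lemma orth_proj_norm_principal:
  assumes H: "subspace H" "H \<subseteq> Rn n"
    and v: "onf n k v" "\<And>i j. i < k \<Longrightarrow> j < k \<Longrightarrow> i \<noteq> j \<Longrightarrow> inner_n n (orth_proj n H (v i)) (v j) = 0"
  shows "inner_n n (orth_proj n H (lc k v y)) (orth_proj n H (lc k v y)) = (\<Sum>i<k. inner_n n (orth_proj n H (v i)) (v i) * (y i)\<^sup>2)"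
proof -
  have "inner_n n (orth_proj n H (lc k v y)) (orth_proj n H (lc k v y)) = inner_n n (orth_proj n H (lc k v y)) (lc k v y)"
    by (simp add: orth_proj_norm[OF H] inner_n_commute)
  also have "\<dots> = (\<Sum>i<k. y i * (\<Sum>j<k. y j * inner_n n (orth_proj n H (v j)) (v i)))"
    by (simp add: linear_lc[OF orth_proj_linear[OF H]] inner_n_lc inner_n_lc2)
  also have "\<dots> = (\<Sum>i<k. y i * (\<Sum>j<k. if j = i then y i * inner_n n (orth_proj n H (v i)) (v i) else 0))"
    using v(2) by (intro sum.cong refl arg_cong2[where f="(*)"]) auto
  also have "\<dots> = (\<Sum>i<k. inner_n n (orth_proj n H (v i)) (v i) * (y i)\<^sup>2)"
    by (intro sum.cong) (auto simp: power2_eq_square)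
  finally show ?thesis .
qed

text \<open>The vectors close to the worst principal vector are all unbalanced, and their Gaussian measure is at
  least \<open>exp (- 6 k)\<close> by the previous cap estimate. This replaces an \<open>\<epsilon>\<close>-net.\<close>

lemma principal_values_balanced:
  assumes H: "subspace H" "H \<subseteq> Rn n" and k: "k \<le> n" and \<epsilon>: "\<epsilon> > 0"
    and v: "onb n k v (Rn k)" "\<And>i j. i < k \<Longrightarrow> j < k \<Longrightarrow> i \<noteq> j \<Longrightarrow> inner_n n (orth_proj n H (v i)) (v j) = 0"
    and small: "(\<integral>\<^sup>+x. of_bool (unbalanced \<epsilon> (inner_n n (orth_proj n H x) (orth_proj n H x)) (inner_n n x x)) \<partial>gauss k)
      < ennreal (exp (- 6 * real k))"
    and i: "i < k"
  shows "\<bar>inner_n n (orth_proj n H (v i)) (v i) - 1 / 2\<bar> \<le> \<epsilon>"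
proof (rule ccontr)
  define l where "l i = inner_n n (orth_proj n H (v i)) (v i)" for i
  \<comment> \<open>The largest deviation, not just one above \<epsilon>: the remaining principal
    values then cannot compensate for the index \<open>p\<close>.\<close>
  define d where "d = Max ((\<lambda>i. \<bar>l i - 1 / 2\<bar>) ` {..<k})"
  have o: "onf n k v" using v(1) by (simp add: onb_def)
  assume "\<not> \<bar>inner_n n (orth_proj n H (v i)) (v i) - 1 / 2\<bar> \<le> \<epsilon>"
  then have "\<epsilon> < \<bar>l i - 1 / 2\<bar>" by (simp add: l_def)
  also have "\<bar>l i - 1 / 2\<bar> \<le> d" unfolding d_def using i by (intro Max_ge) auto
  finally have d: "\<epsilon> < d" .
  have "d \<in> (\<lambda>i. \<bar>l i - 1 / 2\<bar>) ` {..<k}" unfolding d_def using i by (intro Max_in) auto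
  then obtain p where p: "p < k" "d = \<bar>l p - 1 / 2\<bar>" by auto
  have dl: "\<bar>l j - 1 / 2\<bar> \<le> d" if "j < k" for j unfolding d_def using that by (intro Max_ge) auto
  have vp: "v p \<in> Rn k" using onb_in[OF v(1) p(1)] .
  have vp1: "inner_n k (v p) (v p) = 1"
  proof -
    have "inner_n n (v p) (v p) = 1" using o p(1) by (simp add: onf_def)
    then show ?thesis using inner_n_Rn(1)[OF vp k, of "v p"] by simp
  qed
  have "ennreal (exp (- 6 * real k)) \<le> (\<integral>\<^sup>+x. of_bool ((inner_n k x (v p))\<^sup>2 > 3 / 4 * inner_n k x x) \<partial>gauss k)"
    by (rule gauss_cap_lower[OF vp vp1])
  also have "\<dots> \<le> (\<integral>\<^sup>+x. of_bool (unbalanced \<epsilon> (inner_n n (orth_proj n H x) (orth_proj n H x)) (inner_n n x x)) \<partial>gauss k)"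
  proof (intro nn_integral_mono_AE, use AE_gauss_Rn[of k] in eventually_elim)
    fix x assume x: "x \<in> Rn k"
    show "of_bool ((inner_n k x (v p))\<^sup>2 > 3 / 4 * inner_n k x x)
      \<le> (of_bool (unbalanced \<epsilon> (inner_n n (orth_proj n H x) (orth_proj n H x)) (inner_n n x x)) :: ennreal)"
    proof (cases "(inner_n k x (v p))\<^sup>2 > 3 / 4 * inner_n k x x")
      case True
      define y where "y i = inner_n n x (v i)" for i
      have xy: "x = lc k v y" unfolding y_def using onb_expand[OF v(1) x] by simp
      have xx: "inner_n n x x = (\<Sum>i<k. (y i)\<^sup>2)"
        unfolding xy onf_inner_lc(2)[OF o] by (simp add: power2_eq_square)
      have PP: "inner_n n (orth_proj n H x) (orth_proj n H x) = (\<Sum>i<k. l i * (y i)\<^sup>2)"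
        unfolding xy l_def by (rule orth_proj_norm_principal[OF H o v(2)])
      have yp: "(y p)\<^sup>2 > 3 / 4 * (\<Sum>i<k. (y i)\<^sup>2)"
        using True unfolding inner_n_Rn(1)[OF x k, symmetric] xx by (simp add: y_def)
      have s: "(\<Sum>i<k. h i) = h p + (\<Sum>i\<in>{..<k} - {p}. h i)" for h :: "nat \<Rightarrow> real"
        using p(1) by (intro sum.remove) auto
      define R where "R = (\<Sum>i\<in>{..<k} - {p}. (y i)\<^sup>2)"
      have R: "R \<ge> 0" "(\<Sum>i<k. (y i)\<^sup>2) = (y p)\<^sup>2 + R" by (auto simp: R_def s intro!: sum_nonneg)
      have "\<bar>\<Sum>i\<in>{..<k} - {p}. (l i - 1 / 2) * (y i)\<^sup>2\<bar> \<le> (\<Sum>i\<in>{..<k} - {p}. d * (y i)\<^sup>2)"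
        by (rule order_trans[OF sum_abs sum_mono]) (auto simp: abs_mult intro!: mult_right_mono dl)
      also have "\<dots> = d * R" by (simp add: R_def sum_distrib_left)
      finally have T: "\<bar>\<Sum>i\<in>{..<k} - {p}. (l i - 1 / 2) * (y i)\<^sup>2\<bar> \<le> d * R" .
      have diff: "(\<Sum>i<k. l i * (y i)\<^sup>2) - (\<Sum>i<k. (y i)\<^sup>2) / 2 = (l p - 1 / 2) * (y p)\<^sup>2 + (\<Sum>i\<in>{..<k} - {p}. (l i - 1 / 2) * (y i)\<^sup>2)"
        by (subst s[symmetric]) (simp add: algebra_simps sum_subtractf sum_divide_distrib)
      have "\<bar>(l p - 1 / 2) * (y p)\<^sup>2\<bar> = d * (y p)\<^sup>2" by (simp add: abs_mult p(2))
      then have "\<bar>(\<Sum>i<k. l i * (y i)\<^sup>2) - (\<Sum>i<k. (y i)\<^sup>2) / 2\<bar> \<ge> d * (y p)\<^sup>2 - d * R"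
        unfolding diff using T by linarith
      moreover have "d * (y p)\<^sup>2 - d * R > (\<epsilon> / 2) * (\<Sum>i<k. (y i)\<^sup>2)"
      proof -
        \<comment> \<open>The threshold 3 / 4 of the cap is made for this: it gives
          \<open>(y p)\<^sup>2 - R > ((y p)\<^sup>2 + R) / 2\<close>, and the factor 1 / 2 is the
          one in \<open>unbalanced\<close>.\<close>
        have q: "(y p)\<^sup>2 > 3 * R" using yp unfolding R(2) by simp
        have "(\<epsilon> / 2) * ((y p)\<^sup>2 + R) \<le> (d / 2) * ((y p)\<^sup>2 + R)" using d R by (intro mult_right_mono) auto
        also have "\<dots> < (d / 2) * (2 * (y p)\<^sup>2 - 2 * R)" using d \<epsilon> q by (intro mult_strict_left_mono) auto
        also have "\<dots> = d * (y p)\<^sup>2 - d * R" by (simp add: algebra_simps)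
        finally show ?thesis unfolding R(2) .
      qed
      ultimately have "unbalanced \<epsilon> (inner_n n (orth_proj n H x) (orth_proj n H x)) (inner_n n x x)"
        unfolding unbalanced_def PP xx by linarith
      then show ?thesis by simp
    qed simp
  qed
  finally show False using small by simp
qed

lemma measurable_unbalanced:
  "case_prod (\<lambda>a b. of_bool (unbalanced \<epsilon> a b) :: ennreal) \<in> borel_measurable (borel \<Otimes>\<^sub>M borel)"
  unfolding unbalanced_def by measurable

text \<open>Fubini and Markov instead of a union bound: the average over \<open>H\<close> of the
  Gaussian fraction of unbalanced vectors is bounded by the estimate for a single vector, and the
  threshold \<open>exp (- 6 * real k)\<close> costs its inverse as a factor.\<close>

lemma Haar_balanced_subspaces:
  assumes m: "m = n div 2" and k: "1 \<le> k" "k \<le> n" and \<epsilon>: "0 < \<epsilon>" "\<epsilon> \<le> 1"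
  obtains A where "A \<in> sets (Haar_Grassmannian n m)"
    "measure (Haar_Grassmannian n m) A \<ge> 1 - 3 * exp (6 * real k - \<epsilon>\<^sup>2 * m / 4)"
    "\<And>H. H \<in> A \<Longrightarrow> H \<in> Grassmannian n m \<and>
       (\<integral>\<^sup>+x. of_bool (unbalanced \<epsilon> (inner_n n (orth_proj n H x) (orth_proj n H x)) (inner_n n x x)) \<partial>gauss k)
         < ennreal (exp (- 6 * real k))"
proof -
  let ?M = "Haar_Grassmannian n m"
  have mn: "m \<le> n" using m by simp
  have ps: "prob_space ?M" and ss: "sets ?M = sets (Grassmannian_borel n m)"
    using is_Haar_Haar_Grassmannian[OF mn] by (auto simp: is_Haar_Grassmannian_def)
  interpret M: prob_space ?M by (rule ps)
  interpret G: prob_space "gauss k" by (rule prob_space_gauss)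
  interpret P: pair_sigma_finite ?M "gauss k" ..
  have sp: "space ?M = Grassmannian n m" using sets_eq_imp_space_eq[OF ss] by simp
  define b where "b H x = (of_bool (unbalanced \<epsilon> (inner_n n (orth_proj n H x) (orth_proj n H x)) (inner_n n x x)) :: ennreal)" for H x
  define I where "I H = (\<integral>\<^sup>+x. b H x \<partial>gauss k)" for H
  have bm: "(\<lambda>p. b (fst p) (snd p)) \<in> borel_measurable (?M \<Otimes>\<^sub>M gauss k)"
  proof -
    have 1: "fst \<in> ?M \<Otimes>\<^sub>M gauss k \<rightarrow>\<^sub>M Grassmannian_borel n m"
      using measurable_fst[of ?M "gauss k"] measurable_cong_sets[OF refl ss] by blast
    have 2: "snd \<in> borel_measurable (?M \<Otimes>\<^sub>M gauss k)"
      using measurable_snd[of ?M "gauss k"] measurable_cong_sets[OF refl sets_gauss] by blast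
    have "(\<lambda>p. (inner_n n (orth_proj n (fst p) (snd p)) (orth_proj n (fst p) (snd p)), inner_n n (snd p) (snd p)))
      \<in> ?M \<Otimes>\<^sub>M gauss k \<rightarrow>\<^sub>M borel \<Otimes>\<^sub>M borel"
      by (intro measurable_Pair measurable_inner_n measurable_orth_proj[OF 1] 2)
    from measurable_compose[OF this measurable_unbalanced[of \<epsilon>]] show ?thesis by (simp add: b_def)
  qed
  have Im: "I \<in> borel_measurable ?M"
    unfolding I_def using G.borel_measurable_nn_integral_fst[OF bm] by simp
  have ne: "AE x in gauss k. x \<in> Rn k \<and> x \<noteq> 0"
  proof -
    have "AE g in gauss k. inner_n k g (ev 0) \<noteq> 0"
    proof (rule AE_gauss_inner_nonzero)
      have "ev 0 0 = 1" by (simp add: ev_def)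
      then show "inner_n k (ev 0) (ev 0) = 1" using k by (simp add: inner_n_ev)
    qed (use k in \<open>simp add: ev_Rn\<close>)
    with AE_gauss_Rn[of k] show ?thesis by eventually_elim (auto simp: inner_n_zero)
  qed
  define q where "q = 3 * exp (- \<epsilon>\<^sup>2 * m / 4)"
  have "(\<integral>\<^sup>+H. I H \<partial>?M) = (\<integral>\<^sup>+x. \<integral>\<^sup>+H. b H x \<partial>?M \<partial>gauss k)"
    unfolding I_def using P.Fubini'[of b] bm by (simp add: case_prod_beta')
  also have "\<dots> \<le> (\<integral>\<^sup>+x. ennreal q \<partial>gauss k)"
  proof (intro nn_integral_mono_AE, use ne in eventually_elim)
    fix x assume x: "x \<in> Rn k \<and> x \<noteq> 0"
    have "(\<integral>\<^sup>+H. b H x \<partial>?M) = (\<integral>\<^sup>+g. of_bool (unbalanced \<epsilon> (inner_n m g g) (inner_n n g g)) \<partial>gauss n)"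
      unfolding b_def
    proof (rule Haar_random_subspace_vs_random_vector[OF mn measurable_unbalanced])
      show "x \<in> Rn n" using x Rn_mono[OF k(2)] by blast
      show "x \<noteq> 0" using x by simp
      fix a b c :: real assume "c > 0"
      have "\<bar>c * a - c * b / 2\<bar> = c * \<bar>a - b / 2\<bar>"
      proof -
        have "c * a - c * b / 2 = c * (a - b / 2)" by (simp add: algebra_simps)
        then show ?thesis using \<open>c > 0\<close> by (simp add: abs_mult)
      qed
      then show "(of_bool (unbalanced \<epsilon> (c * a) (c * b)) :: ennreal) = of_bool (unbalanced \<epsilon> a b)"
        using \<open>c > 0\<close> by (simp add: unbalanced_def mult.left_commute[of _ c])
    qed
    also have "\<dots> \<le> ennreal q" unfolding q_def by (rule gauss_half_norm_concentration[OF \<epsilon> m])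
    finally show "(\<integral>\<^sup>+H. b H x \<partial>?M) \<le> ennreal q" .
  qed
  also have "\<dots> = ennreal q" by (simp add: G.emeasure_space_1[simplified])
  finally have Iq: "(\<integral>\<^sup>+H. I H \<partial>?M) \<le> ennreal q" .
  define A where "A = {H \<in> space ?M. I H < ennreal (exp (- 6 * real k))}"
  have A [measurable]: "A \<in> sets ?M" unfolding A_def using Im by measurable
  define e where "e = exp (6 * real k)"
  have e1: "ennreal e * ennreal (exp (- 6 * real k)) = 1"
    by (simp add: e_def ennreal_mult[symmetric] exp_minus[symmetric] exp_add[symmetric])
  have "space ?M - A \<subseteq> {H \<in> space ?M. 1 \<le> ennreal e * I H}"
  proof
    fix H assume "H \<in> space ?M - A"
    then have H: "H \<in> space ?M" "ennreal (exp (- 6 * real k)) \<le> I H" by (auto simp: A_def)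
    have "1 \<le> ennreal e * I H" unfolding e1[symmetric] using H(2) by (intro mult_left_mono) auto
    then show "H \<in> {H \<in> space ?M. 1 \<le> ennreal e * I H}" using H(1) by simp
  qed
  then have "emeasure ?M (space ?M - A) \<le> emeasure ?M {H \<in> space ?M. 1 \<le> ennreal e * I H}"
    using Im by (intro emeasure_mono) measurable
  also have "\<dots> \<le> ennreal e * (\<integral>\<^sup>+H. I H * indicator (space ?M) H \<partial>?M)"
    by (rule nn_integral_Markov_inequality) (use Im in measurable)
  also have "(\<integral>\<^sup>+H. I H * indicator (space ?M) H \<partial>?M) = (\<integral>\<^sup>+H. I H \<partial>?M)"
    by (intro nn_integral_cong) simp
  also have "ennreal e * \<dots> \<le> ennreal e * ennreal q" using Iq by (intro mult_left_mono) auto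
  also have "\<dots> = ennreal (e * q)" by (simp add: ennreal_mult e_def q_def)
  finally have "measure ?M (space ?M - A) \<le> e * q"
    unfolding M.emeasure_eq_measure by (simp add: e_def q_def)
  moreover have "e * q = 3 * exp (6 * real k - \<epsilon>\<^sup>2 * m / 4)"
    by (simp add: e_def q_def exp_add[symmetric] exp_diff exp_minus field_simps)
  ultimately have "measure ?M A \<ge> 1 - 3 * exp (6 * real k - \<epsilon>\<^sup>2 * m / 4)"
    using M.prob_compl[OF A] by simp
  show ?thesis
  proof (rule that[OF A])
    show "measure ?M A \<ge> 1 - 3 * exp (6 * real k - \<epsilon>\<^sup>2 * m / 4)" by fact
    fix H assume "H \<in> A"
    then show "H \<in> Grassmannian n m \<and> (\<integral>\<^sup>+x. of_bool (unbalanced \<epsilon> (inner_n n (orth_proj n H x) (orth_proj n H x)) (inner_n n x x)) \<partial>gauss k)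
         < ennreal (exp (- 6 * real k))"
      unfolding A_def I_def b_def sp by simp
  qed
qed

section \<open>Densities of the first coordinates\<close>

lemma nn_integral_powr_Icc:
  assumes "a > -1" "r > 0"
  shows "(\<integral>\<^sup>+t. ennreal (t powr a) * indicator {0<..r} t \<partial>lborel) = ennreal (r powr (a + 1) / (a + 1))"
proof -
  have "((\<lambda>x. x powr a) has_integral (r powr (a + 1) / (a + 1))) {0..r}"
    using assms by (intro has_integral_powr_from_0) auto
  then have "(\<integral>\<^sup>+t. ennreal (t powr a) * indicator {0..r} t \<partial>lborel) = ennreal (r powr (a + 1) / (a + 1))"
    by (rule nn_integral_has_integral_lebesgue'[rotated]) simp
  moreover have "(\<integral>\<^sup>+t. ennreal (t powr a) * indicator {0<..r} t \<partial>lborel) = (\<integral>\<^sup>+t. ennreal (t powr a) * indicator {0..r} t \<partial>lborel)"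
    by (intro nn_integral_cong) (auto simp: indicator_def)
  ultimately show ?thesis by simp
qed

lemma measurable_powr_weight:
  "(\<lambda>s :: real. ennreal (s powr a) * indicator {0<..} s) \<in> borel_measurable borel"
  "(\<lambda>s. ennreal (sqrt s ^ k)) \<in> borel_measurable borel"
proof -
  note measurable_nth [measurable del]
  show "(\<lambda>s :: real. ennreal (s powr a) * indicator {0<..} s) \<in> borel_measurable borel"
    "(\<lambda>s. ennreal (sqrt s ^ k)) \<in> borel_measurable borel" by measurable
qed

lemma inner_n_mult: "inner_n k (\<lambda>i. c * y i) (\<lambda>i. c * y i) = (c * c) * inner_n k y y"
  by (simp add: inner_n_def sum_distrib_left mult_ac)

lemma emeasure_leb_ball:
  assumes "r > 0"
  shows "emeasure (leb j) {z. inner_n j z z \<le> r} = emeasure (leb j) {z. inner_n j z z \<le> 1} * ennreal (r powr (real j / 2))"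
proof -
  have m: "{z. inner_n j z z \<le> c} \<in> sets borel" for c by measurable
  have s: "sqrt r * sqrt r = r" using assms by simp
  have "emeasure (leb j) {z. inner_n j z z \<le> r} = (\<integral>\<^sup>+z. indicator {z. inner_n j z z \<le> r} z \<partial>leb j)"
    using m by simp
  also have "\<dots> = (\<integral>\<^sup>+z. indicator {z. inner_n j z z \<le> r} (\<lambda>i. sqrt r * z i) \<partial>leb j) * ennreal (\<Prod>i<j. sqrt r)"
    using assms m by (intro nn_integral_leb_scale[symmetric]) auto
  also have "(\<lambda>z. indicator {z. inner_n j z z \<le> r} (\<lambda>i. sqrt r * z i)) = (indicator {z. inner_n j z z \<le> 1} :: _ \<Rightarrow> ennreal)"
  proof
    fix z :: "nat \<Rightarrow> real"
    have "inner_n j (\<lambda>i. sqrt r * z i) (\<lambda>i. sqrt r * z i) = r * inner_n j z z" unfolding inner_n_mult s ..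
    then show "indicator {z. inner_n j z z \<le> r} (\<lambda>i. sqrt r * z i) = (indicator {z. inner_n j z z \<le> 1} z :: ennreal)"
      using assms by (simp add: indicator_def)
  qed
  also have "(\<Prod>i<j. sqrt r) = r powr (real j / 2)"
    using assms by (simp add: powr_half_sqrt[symmetric] powr_realpow[symmetric] powr_powr)
  finally show ?thesis using m by simp
qed

text \<open>Polar coordinates in the squared norm \<open>r\<close>: by scaling, a ball has volume
  proportional to \<open>r powr (real j / 2)\<close>, so the push-forward of Lebesgue measure and
  the measure with the stated density agree on half-lines. The value of \<kappa> stays open, since
  normalising constants are later fixed by total mass 1.\<close>

lemma nn_integral_leb_radial:
  assumes j: "j \<ge> 1"
  obtains \<kappa> :: ennreal where "\<And>h. h \<in> borel_measurable borel \<Longrightarrow>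
    (\<integral>\<^sup>+z. h (inner_n j z z) \<partial>leb j) = \<kappa> * (\<integral>\<^sup>+r. h r * ennreal (r powr (real j / 2 - 1)) * indicator {0<..} r \<partial>lborel)"
proof
  define V where "V = emeasure (leb j) {z. inner_n j z z \<le> 1}"
  define \<kappa> where "\<kappa> = V * ennreal (real j / 2)"
  let ?w = "\<lambda>r. ennreal (r powr (real j / 2 - 1)) * indicator {0<..} r"
  let ?M1 = "distr (leb j) borel (\<lambda>z. inner_n j z z)" and ?M2 = "density lborel (\<lambda>r. \<kappa> * ?w r)"
  have [measurable]: "(\<lambda>z. inner_n j z z) \<in> leb j \<rightarrow>\<^sub>M borel" by measurable
  have cube: "inner_n j z z \<le> 1 \<Longrightarrow> \<forall>i<j. \<bar>z i\<bar> \<le> 1" for z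
  proof (intro allI impI)
    fix i assume z: "inner_n j z z \<le> 1" and i: "i < j"
    have "(z i)\<^sup>2 \<le> (\<Sum>i<j. (z i)\<^sup>2)" using i by (intro member_le_sum) auto
    also have "\<dots> \<le> 1" using z by (simp add: inner_n_def power2_eq_square)
    finally show "\<bar>z i\<bar> \<le> 1" by (simp add: abs_square_le_1)
  qed
  have wm: "?w \<in> borel_measurable lborel" using measurable_powr_weight(1) by simp
  have "V \<le> emeasure (leb j) {z. \<forall>i<j. \<bar>z i\<bar> \<le> 1}"
    unfolding V_def using cube by (intro emeasure_mono) (auto, measurable)
  then have V: "V < top" using emeasure_leb_cube[of 1 j] by (auto simp: less_top[symmetric] top_unique)
  have M1: "emeasure ?M1 {..r} = emeasure (leb j) {z. inner_n j z z \<le> r}" for r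
    by (subst emeasure_distr) (auto intro!: arg_cong2[where f=emeasure])
  have eq: "emeasure ?M1 {..r} = emeasure ?M2 {..r}" for r
  proof (cases "r > 0")
    case True
    have "emeasure ?M2 {..r} = (\<integral>\<^sup>+t. \<kappa> * (ennreal (t powr (real j / 2 - 1)) * indicator {0<..r} t) \<partial>lborel)"
      by (subst emeasure_density) (auto intro!: nn_integral_cong simp: indicator_def)
    also have "\<dots> = \<kappa> * ennreal (r powr (real j / 2) / (real j / 2))"
      using nn_integral_powr_Icc[of "real j / 2 - 1" r] True j by (subst nn_integral_cmult) auto
    also have "\<dots> = V * ennreal (r powr (real j / 2))"
      using j unfolding \<kappa>_def by (simp add: mult.assoc ennreal_mult[symmetric])
    finally show ?thesis unfolding M1 V_def emeasure_leb_ball[OF True] by simp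
  next
    case False
    \<comment> \<open>At \<open>r = 0\<close> the ball is a null set because
      \<open>j \<ge> 1\<close>: it lies in a cube of side 0.\<close>
    have "emeasure (leb j) {z. inner_n j z z \<le> r} \<le> emeasure (leb j) {z. \<forall>i<j. \<bar>z i\<bar> \<le> 0}"
    proof (rule emeasure_mono)
      show "{z. inner_n j z z \<le> r} \<subseteq> {z. \<forall>i<j. \<bar>z i\<bar> \<le> 0}"
      proof (safe)
        fix z i assume "inner_n j z z \<le> r" "i < j"
        then have "(\<Sum>i<j. z i * z i) = 0" using False inner_n_nonneg[of j z] by (simp add: inner_n_def)
        then show "\<bar>z i\<bar> \<le> 0" using \<open>i < j\<close> by (simp add: sum_nonneg_eq_0_iff)
      qed
      show "{z. \<forall>i<j. \<bar>z i\<bar> \<le> 0} \<in> sets (leb j)" unfolding sets_leb by measurable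
    qed
    also have "\<dots> = 0" using emeasure_leb_cube[of 0 j] j by simp
    finally have "emeasure ?M1 {..r} = 0" unfolding M1 by simp
    moreover have "emeasure ?M2 {..r} = 0"
      using False by (subst emeasure_density) (auto simp: nn_integral_0_iff_AE indicator_def)
    ultimately show ?thesis by simp
  qed
  have "?M1 = ?M2"
  proof (rule measure_eqI_generator_eq[where E="range atMost" and \<Omega>=UNIV and A="\<lambda>i. {..real i}"])
    show "Int_stable (range atMost :: real set set)" by (auto simp: Int_stable_def)
    show "sets ?M1 = sigma_sets UNIV (range atMost)" "sets ?M2 = sigma_sets UNIV (range atMost)"
      by (simp_all add: borel_eq_atMost)
    show "(\<Union>i. {..real i}) = UNIV" using real_arch_simple by auto
    show "emeasure ?M1 {..real i} \<noteq> \<infinity>" for i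
    proof -
      have "emeasure ?M1 {..real i} \<le> emeasure ?M1 {..real i + 1}" by (intro emeasure_mono) auto
      also have "\<dots> = V * ennreal ((real i + 1) powr (real j / 2))" unfolding M1 V_def by (rule emeasure_leb_ball) simp
      also have "\<dots> < \<infinity>" using V by (simp add: ennreal_mult_less_top)
      finally show ?thesis by simp
    qed
  qed (use eq in auto)
  then have *: "(\<integral>\<^sup>+r. h r \<partial>?M1) = (\<integral>\<^sup>+r. h r \<partial>?M2)" for h by simp
  fix h :: "real \<Rightarrow> ennreal" assume [measurable]: "h \<in> borel_measurable borel"
  have "(\<integral>\<^sup>+z. h (inner_n j z z) \<partial>leb j) = (\<integral>\<^sup>+r. h r \<partial>?M1)" by (subst nn_integral_distr) simp_all
  also have "\<dots> = (\<integral>\<^sup>+r. \<kappa> * ?w r * h r \<partial>lborel)" unfolding *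
    by (rule nn_integral_density[OF borel_measurable_times_ennreal[OF borel_measurable_const wm]]) simp
  also have "\<dots> = (\<integral>\<^sup>+r. \<kappa> * (h r * ?w r) \<partial>lborel)" by (intro nn_integral_cong) (simp add: mult_ac)
  also have "\<dots> = \<kappa> * (\<integral>\<^sup>+r. h r * ?w r \<partial>lborel)"
    by (rule nn_integral_cmult[OF borel_measurable_times_ennreal[OF _ wm]]) simp
  finally show "(\<integral>\<^sup>+z. h (inner_n j z z) \<partial>leb j) = \<kappa> * (\<integral>\<^sup>+r. h r * ennreal (r powr (real j / 2 - 1)) * indicator {0<..} r \<partial>lborel)"
    by (simp add: mult.assoc)
qed

text \<open>The density, up to a constant, of the first \<open>k\<close> coordinates of a uniform point of the sphere of
  dimension \<open>2 a + k + 1\<close>.\<close>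

definition wt :: "nat \<Rightarrow> real \<Rightarrow> (nat \<Rightarrow> real) \<Rightarrow> real" where
  "wt k a y = (if inner_n k y y < 1 then (1 - inner_n k y y) powr a else 0)"

lemma measurable_wt [measurable]: "wt k a \<in> borel_measurable borel"
  unfolding wt_def by measurable

lemma wt_nonneg: "wt k a y \<ge> 0"
  by (simp add: wt_def)

text \<open>A uniform point of the sphere is the direction of a Gaussian vector. With
  \<open>s\<close> the squared length of the whole vector, substituting \<open>sqrt s * y\<close>
  for its first \<open>k\<close> coordinates separates the radial integral, which becomes
  \<open>C\<close>, from an integral over the unit ball. \<open>C\<close> is chosen before
  \<open>F\<close>, so that a single choice of \<open>F\<close> can later determine it.\<close>

lemma sphere_marginal_density:
  assumes j: "j \<ge> 1"
  obtains C :: ennreal where "\<And>F. F \<in> borel_measurable borel \<Longrightarrow>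
    (\<integral>\<^sup>+g. F ((1 / sqrt (inner_n (k + j) g g)) *\<^sub>R trunc k g) \<partial>gauss (k + j))
      = C * (\<integral>\<^sup>+y. F y * ennreal (wt k (real j / 2 - 1) y) \<partial>leb k)"
proof -
  obtain \<kappa> :: ennreal where \<kappa>: "\<And>h. h \<in> borel_measurable borel \<Longrightarrow>
    (\<integral>\<^sup>+z. h (inner_n j z z) \<partial>leb j) = \<kappa> * (\<integral>\<^sup>+r. h r * ennreal (r powr (real j / 2 - 1)) * indicator {0<..} r \<partial>lborel)"
    using nn_integral_leb_radial[OF j] by blast
  define a where "a = real j / 2 - 1"
  define e where "e s = ennreal ((1 / sqrt (2 * pi)) ^ (k + j) * exp (- s / 2))" for s :: real
  define C where "C = \<kappa> * (\<integral>\<^sup>+s. e s * (ennreal (s powr a) * indicator {0<..} s * ennreal (sqrt s ^ k)) \<partial>lborel)"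
  have em [measurable]: "e \<in> borel_measurable borel" unfolding e_def by measurable
  have main: "(\<integral>\<^sup>+g. F ((1 / sqrt (inner_n (k + j) g g)) *\<^sub>R trunc k g) \<partial>gauss (k + j))
      = C * (\<integral>\<^sup>+y. F y * ennreal (wt k a y) \<partial>leb k)"
    if Fm [measurable]: "F \<in> borel_measurable borel" for F
  proof -
    interpret P: pair_sigma_finite lborel "leb k"
      by (intro pair_sigma_finite.intro sigma_finite_leb sigma_finite_lborel)
    have i1: "inner_n (k + j) (append_n k x z) (append_n k x z) = inner_n k x x + inner_n j z z" for x z
      by (induction j) (simp_all add: inner_n_def append_n_def)
    have t1: "trunc k (append_n k x z) = trunc k x" for x z
      by (auto simp: trunc_def append_n_def)
    define Q where "Q s x = ennreal ((s - inner_n k x x) powr a) * indicator {0<..} (s - inner_n k x x)" for s x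
    define G where "G s x = e s * (F ((1 / sqrt s) *\<^sub>R trunc k x) * Q s x)" for s x
    have [measurable]: "(\<lambda>x. F ((1 / sqrt (inner_n (k + j) x x)) *\<^sub>R trunc k x)) \<in> borel_measurable borel"
      by (rule measurable_compose[OF measurable_scaleR_seq Fm]) measurable
    have Fs: "(\<lambda>p. F ((1 / sqrt (f p)) *\<^sub>R trunc k (g p))) \<in> borel_measurable N"
      if "f \<in> borel_measurable N" "g \<in> borel_measurable N" for f g and N :: "'x measure"
      by (rule measurable_compose[OF measurable_scaleR_seq Fm])
        (use that in \<open>auto intro!: borel_measurable_divide borel_measurable_sqrt measurable_compose[OF _ measurable_trunc]\<close>)
    have Qm: "(\<lambda>p. Q (f p) (g p)) \<in> borel_measurable N"
      if [measurable]: "f \<in> borel_measurable N" "g \<in> borel_measurable N" for f g and N :: "'x measure"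
      unfolding Q_def by measurable
    have Gm: "(\<lambda>p. G (f p) (g p)) \<in> borel_measurable N"
      if fg: "f \<in> borel_measurable N" "g \<in> borel_measurable N" for f g and N :: "'x measure"
      unfolding G_def by (intro borel_measurable_times_ennreal measurable_compose[OF fg(1) em] Fs Qm fg)
    have "(\<integral>\<^sup>+g. F ((1 / sqrt (inner_n (k + j) g g)) *\<^sub>R trunc k g) \<partial>gauss (k + j))
      = (\<integral>\<^sup>+x. e (inner_n (k + j) x x) * F ((1 / sqrt (inner_n (k + j) x x)) *\<^sub>R trunc k x) \<partial>leb (k + j))"
      by (subst nn_integral_gauss) (simp_all add: gden_eq e_def)
    also have "\<dots> = (\<integral>\<^sup>+x. \<integral>\<^sup>+z. e (inner_n k x x + inner_n j z z) * F ((1 / sqrt (inner_n k x x + inner_n j z z)) *\<^sub>R trunc k x) \<partial>leb j \<partial>leb k)"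
      by (subst nn_integral_leb_add) (simp_all add: i1 t1)
    also have "\<dots> = (\<integral>\<^sup>+x. \<kappa> * (\<integral>\<^sup>+s. G s x \<partial>lborel) \<partial>leb k)"
    proof (rule nn_integral_cong)
      fix x
      let ?X = "inner_n k x x"
      let ?h = "\<lambda>r. e (?X + r) * F ((1 / sqrt (?X + r)) *\<^sub>R trunc k x)"
      have hm: "?h \<in> borel_measurable borel"
        by (intro borel_measurable_times_ennreal measurable_compose[OF _ em] Fs) auto
      have "(\<integral>\<^sup>+z. ?h (inner_n j z z) \<partial>leb j) = \<kappa> * (\<integral>\<^sup>+r. ?h r * ennreal (r powr a) * indicator {0<..} r \<partial>lborel)"
        unfolding a_def by (rule \<kappa>[OF hm])
      also have "(\<integral>\<^sup>+r. ?h r * ennreal (r powr a) * indicator {0<..} r \<partial>lborel) = (\<integral>\<^sup>+r. G (?X + 1 * r) x \<partial>lborel)"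
        by (intro nn_integral_cong) (simp add: G_def Q_def mult_ac)
      also have "\<dots> = (\<integral>\<^sup>+s. G s x \<partial>lborel)"
        using nn_integral_real_affine[of "\<lambda>s. G s x" 1 ?X] Gm[of "\<lambda>s. s" borel "\<lambda>_. x"] by simp
      finally show "(\<integral>\<^sup>+z. ?h (inner_n j z z) \<partial>leb j) = \<kappa> * (\<integral>\<^sup>+s. G s x \<partial>lborel)" .
    qed
    also have "\<dots> = \<kappa> * (\<integral>\<^sup>+x. (\<integral>\<^sup>+s. G s x \<partial>lborel) \<partial>leb k)"
    proof (rule nn_integral_cmult)
      have "(\<lambda>(x, s). G s x) \<in> borel_measurable (leb k \<Otimes>\<^sub>M lborel)"
        using Gm[of snd "leb k \<Otimes>\<^sub>M lborel" fst] by (simp add: case_prod_beta')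
      then show "(\<lambda>x. \<integral>\<^sup>+s. G s x \<partial>lborel) \<in> borel_measurable (leb k)"
        by (rule lborel.borel_measurable_nn_integral)
    qed
    also have "(\<integral>\<^sup>+x. (\<integral>\<^sup>+s. G s x \<partial>lborel) \<partial>leb k) = (\<integral>\<^sup>+s. (\<integral>\<^sup>+x. G s x \<partial>leb k) \<partial>lborel)"
      using P.Fubini'[of G] Gm[of fst "lborel \<Otimes>\<^sub>M leb k" snd] by (simp add: case_prod_beta')
    also have "\<dots> = (\<integral>\<^sup>+s. (e s * (ennreal (s powr a) * indicator {0<..} s * ennreal (sqrt s ^ k))) * (\<integral>\<^sup>+y. F y * ennreal (wt k a y) \<partial>leb k) \<partial>lborel)"
    proof (rule nn_integral_cong)
      fix s :: real
      show "(\<integral>\<^sup>+x. G s x \<partial>leb k) = (e s * (ennreal (s powr a) * indicator {0<..} s * ennreal (sqrt s ^ k))) * (\<integral>\<^sup>+y. F y * ennreal (wt k a y) \<partial>leb k)"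
      proof (cases "s > 0")
        case False
        then have "G s x = 0" for x using inner_n_nonneg[of k x] by (simp add: G_def Q_def indicator_def)
        then show ?thesis using False by simp
      next
        case True
        have ss: "sqrt s * sqrt s = s" using True by simp
        have Gs: "(\<lambda>x. G s x) \<in> borel_measurable borel" using Gm[of "\<lambda>_. s" borel "\<lambda>x. x"] by simp
        \<comment> \<open>Scaling brings out \<open>s powr a\<close> here and the Jacobian
          \<open>sqrt s ^ k\<close> below; neither involves \<open>y\<close>.\<close>
        have sc: "G s (\<lambda>i. sqrt s * y i) = (e s * ennreal (s powr a)) * (F (trunc k y) * ennreal (wt k a y))" for y
        proof -
          have "inner_n k (\<lambda>i. sqrt s * y i) (\<lambda>i. sqrt s * y i) = s * inner_n k y y" unfolding inner_n_mult ss ..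
          then have "s - inner_n k (\<lambda>i. sqrt s * y i) (\<lambda>i. sqrt s * y i) = s * (1 - inner_n k y y)"
            by (simp add: algebra_simps)
          then have "Q s (\<lambda>i. sqrt s * y i) = ennreal (s powr a) * ennreal (wt k a y)"
            using True by (simp add: Q_def wt_def indicator_def powr_mult ennreal_mult zero_less_mult_iff)
          moreover have "(1 / sqrt s) *\<^sub>R trunc k (\<lambda>i. sqrt s * y i) = trunc k y"
            using True by (auto simp: trunc_def fun_simps)
          ultimately show ?thesis by (simp add: G_def mult_ac)
        qed
        have "(\<integral>\<^sup>+x. G s x \<partial>leb k) = (\<integral>\<^sup>+y. G s (\<lambda>i. sqrt s * y i) \<partial>leb k) * ennreal (\<Prod>i<k. sqrt s)"
          using True by (intro nn_integral_leb_scale[OF Gs, symmetric]) auto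
        also have "(\<integral>\<^sup>+y. G s (\<lambda>i. sqrt s * y i) \<partial>leb k) = (e s * ennreal (s powr a)) * (\<integral>\<^sup>+y. F (trunc k y) * ennreal (wt k a y) \<partial>leb k)"
          unfolding sc by (rule nn_integral_cmult) measurable
        also have "(\<integral>\<^sup>+y. F (trunc k y) * ennreal (wt k a y) \<partial>leb k) = (\<integral>\<^sup>+y. F y * ennreal (wt k a y) \<partial>leb k)"
          by (intro nn_integral_cong_AE, use AE_leb_Rn[of k] in eventually_elim) (simp add: trunc_Rn)
        finally show ?thesis using True by (simp add: mult_ac)
      qed
    qed
    also have "\<dots> = (\<integral>\<^sup>+s. (e s * (ennreal (s powr a) * indicator {0<..} s * ennreal (sqrt s ^ k))) \<partial>lborel) * (\<integral>\<^sup>+y. F y * ennreal (wt k a y) \<partial>leb k)"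
    proof (rule nn_integral_multc)
      have "(\<lambda>s. e s * (ennreal (s powr a) * indicator {0<..} s * ennreal (sqrt s ^ k))) \<in> borel_measurable borel"
        by (intro borel_measurable_times_ennreal em measurable_powr_weight)
      then show "(\<lambda>s. e s * (ennreal (s powr a) * indicator {0<..} s * ennreal (sqrt s ^ k))) \<in> borel_measurable lborel"
        by simp
    qed
    finally show ?thesis unfolding C_def by (simp only: mult.assoc)
  qed
  show ?thesis by (rule that[of C]) (rule main[unfolded a_def])
qed

text \<open>A point of the sphere whose first \<open>k\<close> coordinates are \<open>\<Sum>i<k. y i * v i\<close>, for \<open>y\<close> in the unit ball; the
  coordinate of index \<open>k\<close> makes up for the missing length.\<close>

definition lift_k :: "nat \<Rightarrow> (nat \<Rightarrow> nat \<Rightarrow> real) \<Rightarrow> (nat \<Rightarrow> real) \<Rightarrow> nat \<Rightarrow> real" where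
  "lift_k k v y = lc k v y + sqrt (1 - inner_n k y y) *\<^sub>R ev k"

lemma measurable_lift_k: "lift_k k v \<in> borel_measurable borel"
  unfolding lift_k_def
  by (intro measurable_add_seq(1) measurable_lc measurable_ident measurable_scaleR_seq measurable_const
      borel_measurable_sqrt borel_measurable_diff measurable_inner_n) simp_all

text \<open>For a function of the first \<open>k\<close> coordinates, \<open>z\<close> may be
  replaced by a point built from its \<open>k\<close> coefficients alone, as the two agree in those
  coordinates. The coefficients lie in the unit ball by Bessel's inequality.\<close>

lemma lift_k_sphere:
  assumes v: "onb n k v (Rn k)" and k: "k < n" and z: "z \<in> sphere_in n (Rn n)"
  defines "y \<equiv> (\<lambda>i. inner_n n z (v i))"
  shows "lift_k k v y \<in> sphere_in n (Rn n)" "i < k \<Longrightarrow> lift_k k v y i = z i"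
proof -
  have o: "onf n k v" using v by (simp add: onb_def)
  have n: "n \<ge> 1" using k by simp
  have zz: "inner_n n z z = 1" using z n by (simp add: sphere_in_iff)
  have yy: "inner_n k y y \<le> 1"
  proof -
    have "0 \<le> inner_n n z z - (\<Sum>i<k. (inner_n n z (v i))\<^sup>2)"
      using onf_Bessel[OF o, of z] inner_n_nonneg by metis
    then show ?thesis using zz by (simp add: y_def inner_n_def[of k] power2_eq_square)
  qed
  have lR: "lc k v y \<in> Rn k" using v by (auto simp: onb_def)
  have le: "inner_n n (lc k v y) (ev k) = 0" "inner_n n (ev k) (lc k v y) = 0" using k lR by (simp_all add: inner_n_ev Rn_iff)
  have ee: "inner_n n (ev k) (ev k) = 1" using k by (simp add: inner_n_ev) (simp add: ev_def)
  have ll: "inner_n n (lc k v y) (lc k v y) = inner_n k y y"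
    using onf_inner_lc(2)[OF o] by (simp add: inner_n_def[of k])
  have "inner_n n (lift_k k v y) (lift_k k v y) = inner_n k y y + sqrt (1 - inner_n k y y) * sqrt (1 - inner_n k y y)"
    unfolding lift_k_def by (simp add: inner_n_add inner_n_scale le ll ee)
  also have "\<dots> = 1" using yy by simp
  finally have "inner_n n (lift_k k v y) (lift_k k v y) = 1" .
  moreover have "lift_k k v y \<in> Rn n"
    unfolding lift_k_def using k Rn_mono[OF _ lR, of n] by (intro subspace_add subspace_scale subspace_Rn ev_Rn) auto
  ultimately show "lift_k k v y \<in> sphere_in n (Rn n)" using n by (simp add: sphere_in_iff)
  have "lc k v y = trunc k z"
  proof -
    have "inner_n n (trunc k z) (v i) = y i" if "i < k" for i
    proof -
      have vi: "v i \<in> Rn k" using onb_in[OF v that] .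
      show ?thesis unfolding y_def inner_n_Rn(2)[OF vi less_imp_le[OF k]] inner_n_trunc ..
    qed
    then have "lc k v y = lc k v (\<lambda>i. inner_n n (trunc k z) (v i))" by (intro lc_cong) auto
    also have "\<dots> = trunc k z" by (rule onb_expand[OF v trunc_Rn(1)])
    finally show ?thesis .
  qed
  then show "lift_k k v y i = z i" if "i < k"
    using that by (simp add: lift_k_def fun_simps trunc_def ev_def)
qed

text \<open>The components of the Gaussian vector orthogonal to \<open>H\<close> do not affect the
  direction of its projection and are integrated out.\<close>

lemma sphere_measure_gauss:
  assumes u: "onb n m u H" and m: "m \<ge> 1" and [measurable]: "F \<in> borel_measurable borel"
  shows "(\<integral>\<^sup>+x. F x \<partial>sphere_measure n H) = (\<integral>\<^sup>+g. F ((1 / sqrt (inner_n m g g)) *\<^sub>R lc m u g) \<partial>gauss m)"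
proof -
  note H = onb_subspace[OF u]
  have o: "onf n m u" using u by (simp add: onb_def)
  obtain w where w: "onf n n w" "\<And>i. i < m \<Longrightarrow> w i = u i" using onf_extend_full[OF o] by metis
  have mn: "m \<le> n" using onf_card_le[OF o] .
  interpret prob_space "gauss (n - m)" by (rule prob_space_gauss)
  let ?G = "\<lambda>g. F ((1 / sqrt (inner_n m g g)) *\<^sub>R lc m u g)"
  have Gm: "?G \<in> borel_measurable borel"
    by (rule measurable_compose[OF _ assms(3)]) (intro measurable_scaleR_seq measurable_lc measurable_ident borel_measurable_divide
      borel_measurable_sqrt measurable_inner_n measurable_const; simp)
  have sm: "sph n H \<in> borel_measurable borel" by (rule measurable_sph[OF H])
  have eq: "sph n H (lc n w g) = (1 / sqrt (inner_n m g g)) *\<^sub>R lc m u g" for g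
  proof -
    have "inner_n n (lc n w g) (u i) = g i" if "i < m" for i
      using onf_inner_lc(1)[OF w(1), of i g] w(2)[OF that] that mn by simp
    then have P: "orth_proj n H (lc n w g) = lc m u g"
      unfolding orth_proj_onb[OF u] by (intro lc_cong) auto
    show ?thesis unfolding sph_def P onf_inner_lc(2)[OF o] by (simp add: inner_n_def[of m])
  qed
  have "(\<integral>\<^sup>+x. F x \<partial>sphere_measure n H) = (\<integral>\<^sup>+g. F (sph n H g) \<partial>gauss n)"
    using sphere_measure_facts(2)[OF H] onb_dim[OF u] m by simp
  also have "\<dots> = (\<integral>\<^sup>+g. F (sph n H (lc n w g)) \<partial>gauss n)"
    by (rule nn_integral_gauss_orthogonal[OF w(1) measurable_compose[OF sm assms(3)], symmetric])
  also have "\<dots> = (\<integral>\<^sup>+g. ?G g \<partial>gauss (m + (n - m)))" unfolding eq using mn by simp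
  also have "\<dots> = (\<integral>\<^sup>+g. \<integral>\<^sup>+z. ?G (append_n m g z) \<partial>gauss (n - m) \<partial>gauss m)"
    by (rule nn_integral_gauss_add[OF Gm])
  also have "\<dots> = (\<integral>\<^sup>+g. ?G g \<partial>gauss m)"
  proof (rule nn_integral_cong)
    fix g
    have "inner_n m (append_n m g z) (append_n m g z) = inner_n m g g" "lc m u (append_n m g z) = lc m u g" for z
      by (auto simp: inner_n_def append_n_def lc_def)
    then show "(\<integral>\<^sup>+z. ?G (append_n m g z) \<partial>gauss (n - m)) = ?G g"
      by (simp add: emeasure_space_1[simplified])
  qed
  finally show ?thesis .
qed

text \<open>By \<open>uv\<close> the only basis vector of \<open>H\<close> with a component along
  \<open>v i\<close> is \<open>u i\<close>, and that component is \<open>s i\<close>. The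
  coefficient of a point of the sphere along \<open>v i\<close> is thus \<open>s i\<close> times the
  one along \<open>u i\<close>, which dilates the marginal density of the standard sphere. The
  Jacobian goes into \<open>C\<close>.\<close>

lemma sphere_measure_density:
  assumes u: "onb n (k + j) u H" and j: "j \<ge> 1" and k: "k < n" and v: "onb n k v (Rn k)"
    and s: "\<And>i. i < k \<Longrightarrow> s i > 0"
    and uv: "\<And>l i. l < k + j \<Longrightarrow> i < k \<Longrightarrow> inner_n n (u l) (v i) = (if l = i then s i else 0)"
  obtains C :: ennreal where "\<And>\<phi>. \<phi> \<in> borel_measurable borel \<Longrightarrow>
    (\<And>x y. x \<in> sphere_in n (Rn n) \<Longrightarrow> y \<in> sphere_in n (Rn n) \<Longrightarrow> \<forall>i<k. x i = y i \<Longrightarrow> \<phi> x = \<phi> y) \<Longrightarrow>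
    (\<integral>\<^sup>+x. \<phi> x \<partial>sphere_measure n H) = C * (\<integral>\<^sup>+y. \<phi> (lift_k k v y) * ennreal (wt k (real j / 2 - 1) (\<lambda>i. y i / s i)) \<partial>leb k)"
proof -
  obtain C :: ennreal where C: "\<And>F. F \<in> borel_measurable borel \<Longrightarrow>
    (\<integral>\<^sup>+g. F ((1 / sqrt (inner_n (k + j) g g)) *\<^sub>R trunc k g) \<partial>gauss (k + j))
      = C * (\<integral>\<^sup>+y. F y * ennreal (wt k (real j / 2 - 1) y) \<partial>leb k)"
    using sphere_marginal_density[OF j] by blast
  let ?m = "k + j" and ?a = "real j / 2 - 1"
  have o: "onf n ?m u" using u by (simp add: onb_def)
  have n: "n \<ge> 1" using k by simp
  define p where "p = (\<Prod>i<k. s i)"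
  have p: "p > 0" unfolding p_def using s by (intro prod_pos) auto
  show ?thesis
  proof (rule that[of "C * ennreal (1 / p)"])
    fix \<phi> :: "(nat \<Rightarrow> real) \<Rightarrow> ennreal"
    assume \<phi>[measurable]: "\<phi> \<in> borel_measurable borel"
      and dep: "\<And>x y. x \<in> sphere_in n (Rn n) \<Longrightarrow> y \<in> sphere_in n (Rn n) \<Longrightarrow> \<forall>i<k. x i = y i \<Longrightarrow> \<phi> x = \<phi> y"
    have lm: "lift_k k v \<in> borel_measurable borel" by (rule measurable_lift_k)
    have mult: "(\<lambda>y i. s i * y i) \<in> borel_measurable borel"
      by (rule measurable_seqI) simp
    have divm: "(\<lambda>y i. y i / s i) \<in> borel_measurable borel"
      by (rule measurable_seqI) simp
    define F where "F y = \<phi> (lift_k k v (\<lambda>i. s i * y i))" for y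
    have Fm: "F \<in> borel_measurable borel" unfolding F_def
      by (rule measurable_compose[OF measurable_compose[OF mult lm] \<phi>])
    have "(\<integral>\<^sup>+x. \<phi> x \<partial>sphere_measure n H) = (\<integral>\<^sup>+g. \<phi> ((1 / sqrt (inner_n ?m g g)) *\<^sub>R lc ?m u g) \<partial>gauss ?m)"
      by (rule sphere_measure_gauss[OF u _ \<phi>]) (use j in simp)
    also have "\<dots> = (\<integral>\<^sup>+g. F ((1 / sqrt (inner_n ?m g g)) *\<^sub>R trunc k g) \<partial>gauss ?m)"
    proof (intro nn_integral_cong_AE)
      have "AE g in gauss ?m. inner_n ?m g (ev 0) \<noteq> 0"
      proof (rule AE_gauss_inner_nonzero)
        have "ev 0 0 = 1" by (simp add: ev_def)
        then show "inner_n ?m (ev 0) (ev 0) = 1" using j by (simp add: inner_n_ev)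
      qed (use j in \<open>simp add: ev_Rn\<close>)
      with AE_gauss_Rn[of ?m]
      show "AE g in gauss ?m. \<phi> ((1 / sqrt (inner_n ?m g g)) *\<^sub>R lc ?m u g) = F ((1 / sqrt (inner_n ?m g g)) *\<^sub>R trunc k g)"
      proof eventually_elim
        case (elim g)
        then have gp: "inner_n ?m g g > 0" using inner_n_eq_0[of g ?m] inner_n_nonneg[of ?m g] by (auto simp: less_le inner_n_zero)
        define c where "c = 1 / sqrt (inner_n ?m g g)"
        have c: "c * c * inner_n ?m g g = 1" using gp by (simp add: c_def)
        define z where "z = c *\<^sub>R lc ?m u g"
        have "inner_n n (lc ?m u g) (lc ?m u g) = inner_n ?m g g"
          using onf_inner_lc(2)[OF o] by (simp add: inner_n_def[of ?m])
        then have "inner_n n z z = 1" using c by (simp add: z_def inner_n_scale mult.assoc)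
        moreover have "z \<in> Rn n" unfolding z_def by (intro subspace_scale subspace_Rn onf_lc_Rn[OF o])
        ultimately have z: "z \<in> sphere_in n (Rn n)" using n by (simp add: sphere_in_iff)
        have zv: "inner_n n z (v i) = s i * (c * g i)" if "i < k" for i
        proof -
          have "inner_n n (lc ?m u g) (v i) = (\<Sum>l<?m. if l = i then g i * s i else 0)"
            unfolding inner_n_lc using uv that by (intro sum.cong) auto
          then show ?thesis using that by (simp add: z_def inner_n_scale mult_ac)
        qed
        have "lift_k k v (\<lambda>i. s i * (c *\<^sub>R trunc k g) i) = lift_k k v (\<lambda>i. inner_n n z (v i))"
        proof -
          have e: "s i * (c *\<^sub>R trunc k g) i = inner_n n z (v i)" if "i < k" for i
            using zv[OF that] that by (simp add: trunc_def fun_simps)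
          have "lc k v (\<lambda>i. s i * (c *\<^sub>R trunc k g) i) = lc k v (\<lambda>i. inner_n n z (v i))"
            using e by (intro lc_cong) auto
          moreover have "inner_n k (\<lambda>i. s i * (c *\<^sub>R trunc k g) i) (\<lambda>i. s i * (c *\<^sub>R trunc k g) i) = inner_n k (\<lambda>i. inner_n n z (v i)) (\<lambda>i. inner_n n z (v i))"
            unfolding inner_n_def[of k] using e by (intro sum.cong) auto
          ultimately show ?thesis by (simp add: lift_k_def)
        qed
        then have "F (c *\<^sub>R trunc k g) = \<phi> (lift_k k v (\<lambda>i. inner_n n z (v i)))" by (simp add: F_def)
        also have "\<dots> = \<phi> z"
          using lift_k_sphere[OF v k z] by (intro dep z) auto
        finally show ?case by (simp add: c_def z_def)
      qed
    qed
    also have "\<dots> = C * (\<integral>\<^sup>+y. F y * ennreal (wt k ?a y) \<partial>leb k)" by (rule C[OF Fm])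
    also have "(\<integral>\<^sup>+y. F y * ennreal (wt k ?a y) \<partial>leb k)
      = ennreal (1 / p) * (\<integral>\<^sup>+y. \<phi> (lift_k k v y) * ennreal (wt k ?a (\<lambda>i. y i / s i)) \<partial>leb k)"
    proof -
      let ?K = "\<lambda>y. \<phi> (lift_k k v y) * ennreal (wt k ?a (\<lambda>i. y i / s i))"
      have Km: "?K \<in> borel_measurable borel"
        by (intro borel_measurable_times_ennreal measurable_compose[OF lm \<phi>] measurable_compose[OF measurable_compose[OF divm measurable_wt] measurable_ennreal])
      have "?K (\<lambda>i. s i * y i) = F y * ennreal (wt k ?a y)" for y
      proof -
        have "inner_n k (\<lambda>i. s i * y i / s i) (\<lambda>i. s i * y i / s i) = inner_n k y y"
          unfolding inner_n_def[of k] using s by (intro sum.cong) force+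
        then show ?thesis by (simp add: F_def wt_def)
      qed
      then have sc: "(\<integral>\<^sup>+y. F y * ennreal (wt k ?a y) \<partial>leb k) * ennreal p = (\<integral>\<^sup>+y. ?K y \<partial>leb k)"
        using nn_integral_leb_scale[OF Km, of k s] s by (simp add: p_def)
      have "ennreal (1 / p) * (\<integral>\<^sup>+y. ?K y \<partial>leb k) = (ennreal (1 / p) * ennreal p) * (\<integral>\<^sup>+y. F y * ennreal (wt k ?a y) \<partial>leb k)"
        unfolding sc[symmetric] by (simp only: mult_ac)
      also have "ennreal (1 / p) * ennreal p = 1" using p by (simp add: ennreal_mult[symmetric])
      finally show ?thesis by simp
    qed
    finally show "(\<integral>\<^sup>+x. \<phi> x \<partial>sphere_measure n H) = C * ennreal (1 / p) * (\<integral>\<^sup>+y. \<phi> (lift_k k v y) * ennreal (wt k ?a (\<lambda>i. y i / s i)) \<partial>leb k)"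
      by (simp add: mult.assoc)
  qed
qed

section \<open>Comparing the two densities with a Gaussian\<close>

lemma nn_integral_exp_square:
  assumes "a > 0"
  shows "(\<integral>\<^sup>+t. ennreal (exp (- a * t\<^sup>2)) \<partial>lborel) = ennreal (sqrt (pi / a))"
proof -
  define s where "s = 1 / sqrt (2 * a)"
  have s: "s > 0" "s\<^sup>2 = 1 / (2 * a)" using assms by (auto simp: s_def power_divide)
  have "exp (- a * t\<^sup>2) = sqrt (pi / a) * normal_density 0 s t" for t
    unfolding normal_density_def s(2) using assms by simp
  then have "(\<integral>\<^sup>+t. ennreal (exp (- a * t\<^sup>2)) \<partial>lborel) = (\<integral>\<^sup>+t. ennreal (sqrt (pi / a)) * ennreal (normal_density 0 s t) \<partial>lborel)"
    using assms by (simp add: ennreal_mult)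
  also have "\<dots> = ennreal (sqrt (pi / a)) * 1"
    using s by (subst nn_integral_cmult) (auto simp: nn_integral_eq_integral integrable_normal_density integral_normal_density)
  finally show ?thesis by simp
qed

lemma nn_integral_leb_exp_square:
  assumes "a > 0"
  shows "(\<integral>\<^sup>+y. ennreal (exp (- a * inner_n k y y)) \<partial>leb k) = ennreal (sqrt (pi / a) ^ k)"
proof -
  have "(\<integral>\<^sup>+y. ennreal (exp (- a * inner_n k y y)) \<partial>leb k) = (\<integral>\<^sup>+y. (\<Prod>i<k. ennreal (exp (- a * (y i)\<^sup>2))) \<partial>leb k)"
    by (simp add: prod_ennreal exp_sum[symmetric] inner_n_def power2_eq_square sum_distrib_left sum_negf mult.assoc)
  also have "\<dots> = (\<Prod>i<k. \<integral>\<^sup>+t. ennreal (exp (- a * t\<^sup>2)) \<partial>lborel)"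
    by (rule nn_integral_leb_prod) simp
  also have "\<dots> = ennreal (sqrt (pi / a) ^ k)"
    unfolding nn_integral_exp_square[OF assms] using assms by (simp add: ennreal_power)
  finally show ?thesis .
qed

lemma wt_le_exp:
  assumes "a \<ge> 0"
  shows "wt k a y \<le> exp (- a * inner_n k y y)"
proof (cases "inner_n k y y < 1")
  case True
  have "ln (1 - inner_n k y y) \<le> - inner_n k y y"
    using ln_le_minus_one[of "1 - inner_n k y y"] True by simp
  then have "a * ln (1 - inner_n k y y) \<le> a * (- inner_n k y y)" using assms by (rule mult_left_mono)
  then show ?thesis using True by (simp add: wt_def powr_def)
qed (simp add: wt_def)

text \<open>All that is lost against the Gaussian on the small ball is the second-order term of the
  logarithm, at most \<open>2 * b\<^sup>2\<close>.\<close>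

lemma wt_ge_exp:
  assumes "a \<ge> 0" "inner_n k y y \<le> b" "b \<le> 1 / 2"
  shows "exp (- 2 * a * b\<^sup>2) * exp (- a * inner_n k y y) \<le> wt k a y"
proof -
  let ?u = "inner_n k y y"
  have u: "0 \<le> ?u" "?u \<le> 1 / 2" using assms inner_n_nonneg[of k y] by linarith+
  have "- ?u - 2 * ?u\<^sup>2 \<le> ln (1 - ?u)" by (rule ln_one_minus_pos_lower_bound[OF u])
  moreover have "?u\<^sup>2 \<le> b\<^sup>2" using u assms by (intro power_mono)
  ultimately have "- ?u - 2 * b\<^sup>2 \<le> ln (1 - ?u)" by linarith
  then have "a * (- ?u - 2 * b\<^sup>2) \<le> a * ln (1 - ?u)" using assms(1) by (intro mult_left_mono)
  then have "exp (a * (- ?u - 2 * b\<^sup>2)) \<le> exp (a * ln (1 - ?u))" by simp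
  also have "\<dots> = wt k a y" using u by (simp add: wt_def powr_def)
  also have "exp (a * (- ?u - 2 * b\<^sup>2)) = exp (- 2 * a * b\<^sup>2) * exp (- a * ?u)"
    by (simp add: exp_add[symmetric] algebra_simps)
  finally show ?thesis .
qed

text \<open>Half of the exponent is spent on the decay; the other half stays under the integral and
  costs the factor \<open>sqrt 2 ^ k\<close>.\<close>

lemma exp_square_tail:
  assumes "a > 0"
  shows "(\<integral>\<^sup>+y. ennreal (exp (- a * inner_n k y y)) * of_bool (inner_n k y y > b) \<partial>leb k)
    \<le> ennreal (sqrt (pi / a) ^ k * (sqrt 2 ^ k * exp (- a * b / 2)))"
proof -
  have "(\<integral>\<^sup>+y. ennreal (exp (- a * inner_n k y y)) * of_bool (inner_n k y y > b) \<partial>leb k)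
    \<le> (\<integral>\<^sup>+y. ennreal (exp (- a * b / 2)) * ennreal (exp (- (a / 2) * inner_n k y y)) \<partial>leb k)"
  proof (rule nn_integral_mono)
    fix y
    show "ennreal (exp (- a * inner_n k y y)) * of_bool (inner_n k y y > b)
      \<le> ennreal (exp (- a * b / 2)) * ennreal (exp (- (a / 2) * inner_n k y y))"
    proof (cases "inner_n k y y > b")
      case True
      then have "a * b \<le> a * inner_n k y y" using assms by simp
      then have E: "exp (- a * inner_n k y y) \<le> exp (- a * b / 2) * exp (- (a / 2) * inner_n k y y)"
        unfolding exp_add[symmetric] by simp
      then show ?thesis using True ennreal_leI[OF E] by (simp add: ennreal_mult)
    qed simp
  qed
  also have "\<dots> = ennreal (exp (- a * b / 2)) * ennreal (sqrt (pi / (a / 2)) ^ k)"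
    using assms nn_integral_leb_exp_square[of "a / 2" k] by (subst nn_integral_cmult) simp_all
  also have "sqrt (pi / (a / 2)) = sqrt (pi / a) * sqrt 2"
    by (simp add: real_sqrt_mult[symmetric])
  finally show ?thesis using assms by (simp add: ennreal_mult[symmetric] power_mult_distrib mult_ac)
qed

lemma nn_integral_wt_upper:
  assumes "a > 0"
  shows "(\<integral>\<^sup>+y. ennreal (wt k a y) \<partial>leb k) \<le> ennreal (sqrt (pi / a) ^ k)"
  unfolding nn_integral_leb_exp_square[OF assms, symmetric]
  using assms by (intro nn_integral_mono ennreal_leI wt_le_exp) simp

lemma nn_integral_wt_tail:
  assumes "a > 0"
  shows "(\<integral>\<^sup>+y. ennreal (wt k a y) * of_bool (inner_n k y y > b) \<partial>leb k)
    \<le> ennreal (sqrt (pi / a) ^ k * (sqrt 2 ^ k * exp (- a * b / 2)))"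
proof (rule order_trans[OF nn_integral_mono exp_square_tail[OF assms]])
  fix y
  have "ennreal (wt k a y) \<le> ennreal (exp (- a * inner_n k y y))"
    using assms by (intro ennreal_leI wt_le_exp) simp
  then show "ennreal (wt k a y) * of_bool (inner_n k y y > b) \<le> ennreal (exp (- a * inner_n k y y)) * of_bool (inner_n k y y > b)"
    by (rule mult_right_mono) simp
qed

text \<open>The Gaussian minorant is valid on the ball only, so its tail is subtracted.\<close>

lemma nn_integral_wt_lower:
  assumes a: "a > 0" and b: "b \<le> 1 / 2"
  shows "ennreal (exp (- 2 * a * b\<^sup>2) * (sqrt (pi / a) ^ k * (1 - sqrt 2 ^ k * exp (- a * b / 2))))
    \<le> (\<integral>\<^sup>+y. ennreal (wt k a y) \<partial>leb k)"
proof -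
  let ?G = "sqrt (pi / a) ^ k" and ?t = "sqrt 2 ^ k * exp (- a * b / 2)" and ?e = "\<lambda>y. ennreal (exp (- a * inner_n k y y))"
  have G: "?G \<ge> 0" using a by simp
  have "ennreal ?G = (\<integral>\<^sup>+y. ?e y \<partial>leb k)" by (rule nn_integral_leb_exp_square[OF a, symmetric])
  also have "\<dots> = (\<integral>\<^sup>+y. ?e y * of_bool (inner_n k y y \<le> b) + ?e y * of_bool (inner_n k y y > b) \<partial>leb k)"
    by (intro nn_integral_cong) auto
  also have "\<dots> = (\<integral>\<^sup>+y. ?e y * of_bool (inner_n k y y \<le> b) \<partial>leb k) + (\<integral>\<^sup>+y. ?e y * of_bool (inner_n k y y > b) \<partial>leb k)"
    by (rule nn_integral_add) measurable
  also have "\<dots> \<le> (\<integral>\<^sup>+y. ?e y * of_bool (inner_n k y y \<le> b) \<partial>leb k) + ennreal (?G * ?t)"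
    by (intro add_left_mono exp_square_tail[OF a])
  finally have "ennreal ?G - ennreal (?G * ?t) \<le> (\<integral>\<^sup>+y. ?e y * of_bool (inner_n k y y \<le> b) \<partial>leb k)"
    by (simp add: ennreal_minus_le_iff add.commute)
  then have "ennreal (?G * (1 - ?t)) \<le> (\<integral>\<^sup>+y. ?e y * of_bool (inner_n k y y \<le> b) \<partial>leb k)"
    using G by (simp add: ennreal_minus right_diff_distrib)
  then have "ennreal (exp (- 2 * a * b\<^sup>2)) * ennreal (?G * (1 - ?t)) \<le> ennreal (exp (- 2 * a * b\<^sup>2)) * (\<integral>\<^sup>+y. ?e y * of_bool (inner_n k y y \<le> b) \<partial>leb k)"
    by (intro mult_left_mono) auto
  also have "\<dots> = (\<integral>\<^sup>+y. ennreal (exp (- 2 * a * b\<^sup>2)) * (?e y * of_bool (inner_n k y y \<le> b)) \<partial>leb k)"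
    by (rule nn_integral_cmult[symmetric]) measurable
  also have "\<dots> \<le> (\<integral>\<^sup>+y. ennreal (wt k a y) \<partial>leb k)"
  proof (rule nn_integral_mono)
    fix y
    show "ennreal (exp (- 2 * a * b\<^sup>2)) * (?e y * of_bool (inner_n k y y \<le> b)) \<le> ennreal (wt k a y)"
      using wt_ge_exp[of a k y b] a b by (auto simp: ennreal_mult[symmetric] intro: ennreal_leI split: split_of_bool)
  qed
  finally show ?thesis by (simp add: ennreal_mult'[symmetric])
qed

lemma inverse_product_bound:
  fixes l \<epsilon> :: real
  assumes "\<bar>l - 1 / 2\<bar> \<le> \<epsilon>" "\<epsilon> \<le> 1 / 4"
  shows "1 / l + 1 / (1 - l) \<le> 4 * (1 + 8 * \<epsilon>\<^sup>2)" "1 / l \<le> 4" "1 / (1 - l) \<le> 4" "0 < l" "l < 1"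
proof -
  have l: "1 / 4 \<le> l" "l \<le> 3 / 4" using assms by (auto simp: abs_le_iff)
  then show "0 < l" "l < 1" "1 / l \<le> 4" "1 / (1 - l) \<le> 4" by (auto simp: divide_simps)
  define d where "d = (l - 1 / 2)\<^sup>2"
  have d: "d \<le> \<epsilon>\<^sup>2" unfolding d_def using assms(1) by (metis abs_ge_zero power2_abs power_mono)
  have "\<epsilon>\<^sup>2 \<le> (1 / 4)\<^sup>2" using assms by (intro power_mono) auto
  then have e: "\<epsilon>\<^sup>2 \<le> 1 / 16" by (simp add: power2_eq_square)
  have ll: "l * (1 - l) = 1 / 4 - d" by (simp add: d_def power2_eq_square algebra_simps)
  have "1 / l + 1 / (1 - l) = 1 / (l * (1 - l))" using l by (simp add: field_simps)
  also have "\<dots> = 1 / (1 / 4 - d)" by (simp only: ll)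
  also have "1 / (1 / 4 - d) \<le> 1 / (1 / 4 - \<epsilon>\<^sup>2)" using d e by (intro divide_left_mono mult_pos_pos) auto
  also have "\<dots> \<le> 4 * (1 + 8 * \<epsilon>\<^sup>2)"
  proof -
    have "\<epsilon>\<^sup>2 * \<epsilon>\<^sup>2 \<le> \<epsilon>\<^sup>2 * (1 / 16)" using e by (intro mult_left_mono) auto
    moreover have "(4 * (1 + 8 * \<epsilon>\<^sup>2)) * (1 / 4 - \<epsilon>\<^sup>2) = 1 + 4 * \<epsilon>\<^sup>2 - 32 * (\<epsilon>\<^sup>2 * \<epsilon>\<^sup>2)"
      by (simp add: algebra_simps)
    moreover have "0 \<le> \<epsilon>\<^sup>2" by simp
    ultimately have "1 \<le> (4 * (1 + 8 * \<epsilon>\<^sup>2)) * (1 / 4 - \<epsilon>\<^sup>2)" by linarith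
    then show ?thesis using e by (simp add: divide_le_eq)
  qed
  finally show "1 / l + 1 / (1 - l) \<le> 4 * (1 + 8 * \<epsilon>\<^sup>2)" .
qed

text \<open>The eigenvalues \<open>l i\<close> for \<open>H\<close> become \<open>1 - l i\<close> for the complement, and
  \<open>1 / l + 1 / (1 - l) = 4 + O(\<epsilon>\<^sup>2)\<close>: the deviations cancel to first order.\<close>

lemma wt_product_lower:
  assumes l: "\<And>i. i < k \<Longrightarrow> \<bar>l i - 1 / 2\<bar> \<le> \<epsilon>" and \<epsilon>: "\<epsilon> \<le> 1 / 4"
    and a: "0 \<le> a1" "a1 \<le> a2" "2 * a2 \<le> a0"
    and b: "inner_n k y y \<le> b" "b \<le> 1 / 16"
  shows "exp (- (32 * a2 * \<epsilon>\<^sup>2 * b + 64 * a2 * b\<^sup>2)) * (wt k a0 y)\<^sup>2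
    \<le> wt k a1 (\<lambda>i. y i / sqrt (l i)) * wt k a2 (\<lambda>i. y i / sqrt (1 - l i))"
proof -
  note lb = inverse_product_bound[OF l \<epsilon>]
  define u where "u = inner_n k y y"
  define z1 z2 where "z1 = inner_n k (\<lambda>i. y i / sqrt (l i)) (\<lambda>i. y i / sqrt (l i))"
    and "z2 = inner_n k (\<lambda>i. y i / sqrt (1 - l i)) (\<lambda>i. y i / sqrt (1 - l i))"
  have u_sum: "u = (\<Sum>i<k. (y i)\<^sup>2)" by (simp add: u_def inner_n_def power2_eq_square)
  have z1_sum: "z1 = (\<Sum>i<k. (1 / l i) * (y i)\<^sup>2)"
    unfolding z1_def inner_n_def
  proof (rule sum.cong[OF refl])
    fix i assume "i \<in> {..<k}"
    then have "l i > 0" using lb(4) by simp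
    then show "y i / sqrt (l i) * (y i / sqrt (l i)) = 1 / l i * (y i)\<^sup>2" by (simp add: power2_eq_square)
  qed
  have z2_sum: "z2 = (\<Sum>i<k. (1 / (1 - l i)) * (y i)\<^sup>2)"
    unfolding z2_def inner_n_def
  proof (rule sum.cong[OF refl])
    fix i assume "i \<in> {..<k}"
    then have "1 - l i > 0" using lb(5) by simp
    then show "y i / sqrt (1 - l i) * (y i / sqrt (1 - l i)) = 1 / (1 - l i) * (y i)\<^sup>2" by (simp add: power2_eq_square)
  qed
  have u0: "0 \<le> u" "u \<le> b" using b inner_n_nonneg[of k y] by (auto simp: u_def)
  have z1: "0 \<le> z1" "z1 \<le> 4 * u"
    unfolding z1_def using inner_n_nonneg apply blast
    unfolding z1_def[symmetric] z1_sum u_sum sum_distrib_left using lb(2) by (intro sum_mono mult_right_mono) auto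
  have z2: "0 \<le> z2" "z2 \<le> 4 * u"
    unfolding z2_def using inner_n_nonneg apply blast
    unfolding z2_def[symmetric] z2_sum u_sum sum_distrib_left using lb(3) by (intro sum_mono mult_right_mono) auto
  have z12: "z1 + z2 \<le> 4 * (1 + 8 * \<epsilon>\<^sup>2) * u"
    unfolding z1_sum z2_sum u_sum sum_distrib_left sum.distrib[symmetric] distrib_right[symmetric]
    using lb(1) by (intro sum_mono mult_right_mono) auto
  have q: "z1 \<le> 1 / 2" "z2 \<le> 1 / 2" "u < 1" using z1 z2 u0 b by auto
  have sq: "z1\<^sup>2 \<le> 16 * b\<^sup>2" "z2\<^sup>2 \<le> 16 * b\<^sup>2"
  proof -
    have "z1\<^sup>2 \<le> (4 * b)\<^sup>2" using z1 u0 by (intro power_mono) auto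
    then show "z1\<^sup>2 \<le> 16 * b\<^sup>2" by (simp add: power_mult_distrib)
    have "z2\<^sup>2 \<le> (4 * b)\<^sup>2" using z2 u0 by (intro power_mono) auto
    then show "z2\<^sup>2 \<le> 16 * b\<^sup>2" by (simp add: power_mult_distrib)
  qed
  have L1: "- z1 - 2 * z1\<^sup>2 \<le> ln (1 - z1)" "ln (1 - z1) \<le> 0"
    using ln_one_minus_pos_lower_bound[OF z1(1) q(1)] z1(1) q(1) by auto
  have L2: "- z2 - 2 * z2\<^sup>2 \<le> ln (1 - z2)"
    by (rule ln_one_minus_pos_lower_bound[OF z2(1) q(2)])
  \<comment> \<open>For odd \<open>n\<close> the two exponents differ; as the logarithm is
    nonpositive, \<open>a1\<close> may be replaced by the larger \<open>a2\<close>.\<close>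
  have "a2 * (- z1 - 2 * z1\<^sup>2) \<le> a2 * ln (1 - z1)" using L1(1) a by (intro mult_left_mono) auto
  also have "\<dots> \<le> a1 * ln (1 - z1)" using L1(2) a by (intro mult_right_mono_neg)
  finally have A1: "a2 * (- z1 - 2 * z1\<^sup>2) \<le> a1 * ln (1 - z1)" .
  have A2: "a2 * (- z2 - 2 * z2\<^sup>2) \<le> a2 * ln (1 - z2)" using L2 a by (intro mult_left_mono) auto
  \<comment> \<open>The term with \<open>\<epsilon>\<^sup>2\<close> comes from the sum of
    \<open>z1\<close> and \<open>z2\<close>; each of the two squares is at most
    \<open>16 * b\<^sup>2\<close> and enters with factor 2, which makes 64.\<close>
  have A3: "a2 * (- 4 * u - 32 * \<epsilon>\<^sup>2 * b - 64 * b\<^sup>2) \<le> a2 * ((- z1 - 2 * z1\<^sup>2) + (- z2 - 2 * z2\<^sup>2))"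
  proof (rule mult_left_mono)
    have "\<epsilon>\<^sup>2 * u \<le> \<epsilon>\<^sup>2 * b" using u0 by (intro mult_left_mono) auto
    moreover have "4 * (1 + 8 * \<epsilon>\<^sup>2) * u = 4 * u + 32 * (\<epsilon>\<^sup>2 * u)" by (simp add: algebra_simps)
    ultimately show "- 4 * u - 32 * \<epsilon>\<^sup>2 * b - 64 * b\<^sup>2 \<le> (- z1 - 2 * z1\<^sup>2) + (- z2 - 2 * z2\<^sup>2)"
      using z12 sq by linarith
  qed (use a in simp)
  have "ln (1 - u) \<le> - u" using ln_le_minus_one[of "1 - u"] q by simp
  then have "a0 * ln (1 - u) \<le> a0 * (- u)" using a by (intro mult_left_mono) auto
  moreover have "2 * a2 * u \<le> a0 * u" using a u0 by (intro mult_right_mono)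
  ultimately have A0: "2 * (a0 * ln (1 - u)) \<le> a2 * (- 4 * u)" by simp
  have "2 * (a0 * ln (1 - u)) - (32 * a2 * \<epsilon>\<^sup>2 * b + 64 * a2 * b\<^sup>2) \<le> a1 * ln (1 - z1) + a2 * ln (1 - z2)"
    using A0 A1 A2 A3 by (simp add: algebra_simps)
  then have "exp (2 * (a0 * ln (1 - u)) - (32 * a2 * \<epsilon>\<^sup>2 * b + 64 * a2 * b\<^sup>2)) \<le> exp (a1 * ln (1 - z1) + a2 * ln (1 - z2))" by simp
  moreover have "wt k a0 y = exp (a0 * ln (1 - u))" "wt k a1 (\<lambda>i. y i / sqrt (l i)) = exp (a1 * ln (1 - z1))"
    "wt k a2 (\<lambda>i. y i / sqrt (1 - l i)) = exp (a2 * ln (1 - z2))"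
    using q by (simp_all add: wt_def powr_def u_def[symmetric] z1_def[symmetric] z2_def[symmetric])
  moreover have "exp (2 * (a0 * ln (1 - u)) - (32 * a2 * \<epsilon>\<^sup>2 * b + 64 * a2 * b\<^sup>2)) = exp (- (32 * a2 * \<epsilon>\<^sup>2 * b + 64 * a2 * b\<^sup>2)) * (exp (a0 * ln (1 - u)))\<^sup>2"
    by (simp add: exp_double[symmetric] exp_add[symmetric])
  ultimately show ?thesis by (simp only: exp_add)
qed

lemma nn_integral_wt_scale:
  assumes "\<And>i. i < k \<Longrightarrow> s i > 0"
  shows "(\<integral>\<^sup>+y. ennreal (wt k a (\<lambda>i. y i / s i)) \<partial>leb k) = (\<integral>\<^sup>+y. ennreal (wt k a y) \<partial>leb k) * ennreal (\<Prod>i<k. s i)"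
proof -
  let ?K = "\<lambda>y. ennreal (wt k a (\<lambda>i. y i / s i))"
  have divm: "(\<lambda>y i. y i / s i) \<in> borel_measurable borel" by (rule measurable_seqI) simp
  have Km: "?K \<in> borel_measurable borel"
    by (intro measurable_compose[OF measurable_compose[OF divm measurable_wt] measurable_ennreal])
  have "?K (\<lambda>i. s i * y i) = ennreal (wt k a y)" for y
  proof -
    have "inner_n k (\<lambda>i. s i * y i / s i) (\<lambda>i. s i * y i / s i) = inner_n k y y"
      unfolding inner_n_def[of k] using assms by (intro sum.cong) force+
    then show ?thesis by (simp add: wt_def)
  qed
  then show ?thesis using nn_integral_leb_scale[OF Km, of k s] assms by simp
qed

text \<open>The constants of the densities are obtained as extended reals; total mass 1 makes them
  finite and positive.\<close>

lemma ennreal_mult_eq_1: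
  assumes "C * I = (1 :: ennreal)"
  obtains c i where "C = ennreal c" "I = ennreal i" "c > 0" "i > 0" "c * i = 1"
proof -
  have "C \<noteq> 0" "I \<noteq> 0" using assms by auto
  then have "C \<noteq> top" "I \<noteq> top" using assms by (auto simp: ennreal_mult_eq_top_iff ennreal_top_mult ennreal_mult_top)
  then obtain c i where ci: "C = ennreal c" "I = ennreal i" "c \<ge> 0" "i \<ge> 0" by (metis ennreal_cases)
  then have "c > 0" "i > 0" using \<open>C \<noteq> 0\<close> \<open>I \<noteq> 0\<close> by (auto simp: less_le)
  moreover have "c * i = 1" using assms ci by (simp add: ennreal_mult[symmetric])
  ultimately show ?thesis using that ci by blast
qed

text \<open>The weights \<open>0\<close>, \<open>1\<close>, \<open>2\<close> belong to the whole space, to \<open>H\<close> and to its complement. The mass outside the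
  ball of radius \<open>sqrt b\<close> is negligible even against \<open>M\<close>, and the normalising constants are compared
  through Gaussian integrals.\<close>

lemma density_product_lower:
  fixes \<phi> :: "(nat \<Rightarrow> real) \<Rightarrow> real"
  assumes \<phi>m [measurable]: "\<phi> \<in> borel_measurable borel" and \<phi>0: "\<And>y. \<phi> y \<ge> 0"
    and \<phi>M: "AE y in leb k. inner_n k y y < 1 \<longrightarrow> \<phi> y \<le> M" and M: "M > 0"
    and l: "\<And>i. i < k \<Longrightarrow> \<bar>l i - 1 / 2\<bar> \<le> \<epsilon>" and \<epsilon>: "\<epsilon> \<le> 1 / 4"
    and a: "0 < a1" "a1 \<le> a2" "2 * a2 \<le> a0" and b: "0 < b" "b \<le> 1 / 16"
    and C0: "C0 * (\<integral>\<^sup>+y. ennreal (wt k a0 y) \<partial>leb k) = 1"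
    and C1: "C1 * (\<integral>\<^sup>+y. ennreal (wt k a1 (\<lambda>i. y i / sqrt (l i))) \<partial>leb k) = 1"
    and C2: "C2 * (\<integral>\<^sup>+y. ennreal (wt k a2 (\<lambda>i. y i / sqrt (1 - l i))) \<partial>leb k) = 1"
    and \<phi>1: "C0 * (\<integral>\<^sup>+y. ennreal (\<phi> y) * ennreal (wt k a0 y) \<partial>leb k) = 1"
    and num: "(2 * a1 / a0) ^ k \<ge> (99 / 100)" "2 * a0 * b\<^sup>2 \<le> (1 / 1000)" "32 * a2 * \<epsilon>\<^sup>2 * b + 64 * a2 * b\<^sup>2 \<le> (4 / 100)"
      "sqrt 2 ^ k * exp (- a0 * b / 2) \<le> (1 / 1000)" "M * (sqrt 2 ^ k * exp (- a0 * b / 2)) \<le> (1 / 1000)"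
  defines "X1 \<equiv> C1 * (\<integral>\<^sup>+y. ennreal (\<phi> y) * ennreal (wt k a1 (\<lambda>i. y i / sqrt (l i))) \<partial>leb k)"
    and "X2 \<equiv> C2 * (\<integral>\<^sup>+y. ennreal (\<phi> y) * ennreal (wt k a2 (\<lambda>i. y i / sqrt (1 - l i))) \<partial>leb k)"
  shows "X1 < top" "X2 < top" "ennreal (81 / 100) \<le> X1 * X2"
proof -
  note lb = inverse_product_bound[OF l \<epsilon>]
  define s1 s2 where "s1 i = sqrt (l i)" and "s2 i = sqrt (1 - l i)" for i
  have s: "s1 i > 0" "s2 i > 0" "s1 i \<le> 1" "s2 i \<le> 1" if "i < k" for i
    using lb(4,5)[OF that] by (auto simp: s1_def s2_def)
  define w0 w1 w2 where "w0 = wt k a0" and "w1 y = wt k a1 (\<lambda>i. y i / s1 i)" and "w2 y = wt k a2 (\<lambda>i. y i / s2 i)" for y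
  have divm: "(\<lambda>y i. y i / s i) \<in> borel_measurable borel" for s :: "nat \<Rightarrow> real" by (rule measurable_seqI) simp
  have w0m [measurable]: "w0 \<in> borel_measurable borel" by (simp add: w0_def)
  have w1m [measurable]: "w1 \<in> borel_measurable borel" unfolding w1_def by (rule measurable_compose[OF divm measurable_wt])
  have w2m [measurable]: "w2 \<in> borel_measurable borel" unfolding w2_def by (rule measurable_compose[OF divm measurable_wt])
  have w_nonneg: "w0 y \<ge> 0" "w1 y \<ge> 0" "w2 y \<ge> 0" for y by (simp_all add: w0_def w1_def w2_def wt_nonneg)
  define I0 I1 I2 where "I0 = (\<integral>\<^sup>+y. ennreal (w0 y) \<partial>leb k)" and "I1 = (\<integral>\<^sup>+y. ennreal (w1 y) \<partial>leb k)"
    and "I2 = (\<integral>\<^sup>+y. ennreal (w2 y) \<partial>leb k)"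
  obtain c0 i0 where ci0: "C0 = ennreal c0" "I0 = ennreal i0" "c0 > 0" "i0 > 0" "c0 * i0 = 1"
    using ennreal_mult_eq_1[OF C0] unfolding I0_def w0_def by blast
  obtain c1 i1 where ci1: "C1 = ennreal c1" "I1 = ennreal i1" "c1 > 0" "i1 > 0" "c1 * i1 = 1"
    using ennreal_mult_eq_1[OF C1] unfolding I1_def w1_def s1_def by blast
  obtain c2 i2 where ci2: "C2 = ennreal c2" "I2 = ennreal i2" "c2 > 0" "i2 > 0" "c2 * i2 = 1"
    using ennreal_mult_eq_1[OF C2] unfolding I2_def w2_def s2_def by blast
  define J1 J2 where "J1 = (\<integral>\<^sup>+y. ennreal (\<phi> y) * ennreal (w1 y) \<partial>leb k)" and "J2 = (\<integral>\<^sup>+y. ennreal (\<phi> y) * ennreal (w2 y) \<partial>leb k)"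
  have X: "X1 = C1 * J1" "X2 = C2 * J2" by (simp_all add: X1_def X2_def J1_def J2_def w1_def w2_def s1_def s2_def)
  \<comment> \<open>Since \<open>s1\<close> and \<open>s2\<close> are at most 1, the ellipsoids that
    carry \<open>w1\<close> and \<open>w2\<close> lie in the unit ball, where the bound
    \<open>M\<close> on \<phi> holds.\<close>
  have inner_le: "inner_n k y y \<le> inner_n k (\<lambda>i. y i / s i) (\<lambda>i. y i / s i)"
    if "\<And>i. i < k \<Longrightarrow> 0 < s i" "\<And>i. i < k \<Longrightarrow> s i \<le> 1" for y s
    unfolding inner_n_def
  proof (rule sum_mono)
    fix i assume "i \<in> {..<k}"
    then have si: "0 < s i" "s i \<le> 1" using that by auto
    then have "s i * s i \<le> 1" by (simp add: mult_le_one)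
    then have "y i * y i * (s i * s i) \<le> y i * y i * 1" by (intro mult_left_mono) auto
    then show "y i * y i \<le> y i / s i * (y i / s i)" using si by (simp add: divide_simps)
  qed
  have bound: "(\<integral>\<^sup>+y. ennreal (\<phi> y) * ennreal (wt k a (\<lambda>i. y i / s i)) \<partial>leb k) \<le> ennreal M * (\<integral>\<^sup>+y. ennreal (wt k a (\<lambda>i. y i / s i)) \<partial>leb k)"
    if "\<And>i. i < k \<Longrightarrow> 0 < s i" "\<And>i. i < k \<Longrightarrow> s i \<le> 1" for a s
  proof -
    have "(\<integral>\<^sup>+y. ennreal (\<phi> y) * ennreal (wt k a (\<lambda>i. y i / s i)) \<partial>leb k) \<le> (\<integral>\<^sup>+y. ennreal M * ennreal (wt k a (\<lambda>i. y i / s i)) \<partial>leb k)"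
    proof (intro nn_integral_mono_AE, use \<phi>M in eventually_elim)
      fix y assume y: "inner_n k y y < 1 \<longrightarrow> \<phi> y \<le> M"
      show "ennreal (\<phi> y) * ennreal (wt k a (\<lambda>i. y i / s i)) \<le> ennreal M * ennreal (wt k a (\<lambda>i. y i / s i))"
      proof (cases "inner_n k y y < 1")
        case True then show ?thesis using y by (intro mult_right_mono ennreal_leI) auto
      next
        case False then show ?thesis using inner_le[where y=y and s=s] that by (simp add: wt_def)
      qed
    qed
    also have "\<dots> = ennreal M * (\<integral>\<^sup>+y. ennreal (wt k a (\<lambda>i. y i / s i)) \<partial>leb k)"
      by (rule nn_integral_cmult) (use measurable_compose[OF measurable_compose[OF divm measurable_wt] measurable_ennreal] in simp)
    finally show ?thesis .
  qed
  have "J1 \<le> ennreal M * I1" unfolding J1_def I1_def w1_def by (rule bound) (simp_all add: s)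
  then show "X1 < top" unfolding X ci1(1,2) by (auto simp: ennreal_mult_less_top intro: le_less_trans)
  have "J2 \<le> ennreal M * I2" unfolding J2_def I2_def w2_def by (rule bound) (simp_all add: s)
  then show "X2 < top" unfolding X ci2(1,2) by (auto simp: ennreal_mult_less_top intro: le_less_trans)
  define \<delta> where "\<delta> = 32 * a2 * \<epsilon>\<^sup>2 * b + 64 * a2 * b\<^sup>2"
  define K K' where "K = (\<integral>\<^sup>+y. ennreal (\<phi> y * w0 y) * of_bool (inner_n k y y \<le> b) \<partial>leb k)"
    and "K' = (\<integral>\<^sup>+y. ennreal (\<phi> y * w0 y) * of_bool (inner_n k y y > b) \<partial>leb k)"
  \<comment> \<open>Cauchy-Schwarz for \<open>sqrt (\<phi> y * w1 y)\<close> and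
    \<open>sqrt (\<phi> y * w2 y)\<close>, whose product dominates
    \<open>exp (- \<delta> / 2) * (\<phi> y * w0 y)\<close> on the small ball.\<close>
  have CS: "ennreal (exp (- \<delta>)) * K\<^sup>2 \<le> J1 * J2"
  proof -
    have "ennreal (exp (- \<delta> / 2)) * K = (\<integral>\<^sup>+y. ennreal (exp (- \<delta> / 2)) * (ennreal (\<phi> y * w0 y) * of_bool (inner_n k y y \<le> b)) \<partial>leb k)"
      unfolding K_def by (rule nn_integral_cmult[symmetric]) measurable
    also have "\<dots> \<le> (\<integral>\<^sup>+y. ennreal (sqrt (\<phi> y * w1 y)) * ennreal (sqrt (\<phi> y * w2 y)) \<partial>leb k)"
    proof (rule nn_integral_mono)
      fix y
      show "ennreal (exp (- \<delta> / 2)) * (ennreal (\<phi> y * w0 y) * of_bool (inner_n k y y \<le> b))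
        \<le> ennreal (sqrt (\<phi> y * w1 y)) * ennreal (sqrt (\<phi> y * w2 y))"
      proof (cases "inner_n k y y \<le> b")
        case True
        have "exp (- \<delta>) * (w0 y)\<^sup>2 \<le> w1 y * w2 y"
          unfolding \<delta>_def w0_def w1_def w2_def s1_def s2_def
          by (rule wt_product_lower[OF l \<epsilon> less_imp_le[OF a(1)] a(2,3) True b(2)])
        then have "(exp (- \<delta>) * (w0 y)\<^sup>2) * (\<phi> y)\<^sup>2 \<le> (w1 y * w2 y) * (\<phi> y)\<^sup>2" by (rule mult_right_mono) simp
        moreover have "(exp (- \<delta> / 2) * (\<phi> y * w0 y))\<^sup>2 = (exp (- \<delta>) * (w0 y)\<^sup>2) * (\<phi> y)\<^sup>2"
          by (simp add: power_mult_distrib exp_double[symmetric] mult_ac)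
        moreover have "(w1 y * w2 y) * (\<phi> y)\<^sup>2 = (\<phi> y * w1 y) * (\<phi> y * w2 y)" by (simp add: power2_eq_square mult_ac)
        ultimately have "(exp (- \<delta> / 2) * (\<phi> y * w0 y))\<^sup>2 \<le> (\<phi> y * w1 y) * (\<phi> y * w2 y)" by simp
        then have "exp (- \<delta> / 2) * (\<phi> y * w0 y) \<le> sqrt (\<phi> y * w1 y) * sqrt (\<phi> y * w2 y)"
          unfolding real_sqrt_mult[symmetric] by (rule real_le_rsqrt)
        then show ?thesis using True \<phi>0 w_nonneg by (simp add: ennreal_mult[symmetric] ennreal_leI)
      qed simp
    qed
    finally have "(ennreal (exp (- \<delta> / 2)) * K)\<^sup>2 \<le> (\<integral>\<^sup>+y. ennreal (sqrt (\<phi> y * w1 y)) * ennreal (sqrt (\<phi> y * w2 y)) \<partial>leb k)\<^sup>2"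
      by (rule power_mono) simp
    also have "\<dots> \<le> (\<integral>\<^sup>+y. (ennreal (sqrt (\<phi> y * w1 y)))\<^sup>2 \<partial>leb k) * (\<integral>\<^sup>+y. (ennreal (sqrt (\<phi> y * w2 y)))\<^sup>2 \<partial>leb k)"
      by (rule Cauchy_Schwarz_nn_integral) measurable
    also have "\<dots> = J1 * J2"
      using \<phi>0 w_nonneg by (simp add: J1_def J2_def ennreal_power ennreal_mult)
    also have "(ennreal (exp (- \<delta> / 2)) * K)\<^sup>2 = ennreal (exp (- \<delta>)) * K\<^sup>2"
      by (simp add: power_mult_distrib ennreal_power exp_double[symmetric])
    finally show ?thesis .
  qed
  define \<tau> where "\<tau> = sqrt 2 ^ k * exp (- a0 * b / 2)"
  define G where "G a = sqrt (pi / a) ^ k" for a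
  have a0: "a0 > 0" using a by linarith
  have Gp: "G a > 0" if "a > 0" for a using that by (simp add: G_def)
  have \<tau>: "0 < \<tau>" "\<tau> \<le> (1 / 1000)" "M * \<tau> \<le> (1 / 1000)" using num by (auto simp: \<tau>_def)
  have K'_le: "K' \<le> ennreal (M * (G a0 * \<tau>))"
  proof -
    have "K' \<le> (\<integral>\<^sup>+y. ennreal M * (ennreal (w0 y) * of_bool (inner_n k y y > b)) \<partial>leb k)"
      unfolding K'_def
    proof (intro nn_integral_mono_AE, use \<phi>M in eventually_elim)
      fix y assume y: "inner_n k y y < 1 \<longrightarrow> \<phi> y \<le> M"
      have "\<phi> y * w0 y \<le> M * w0 y"
        using y w_nonneg(1)[of y] by (cases "inner_n k y y < 1") (auto intro: mult_right_mono simp: w0_def wt_def)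
      then have "ennreal (\<phi> y * w0 y) \<le> ennreal M * ennreal (w0 y)"
        using M w_nonneg by (simp add: ennreal_mult[symmetric] ennreal_leI)
      then show "ennreal (\<phi> y * w0 y) * of_bool (inner_n k y y > b) \<le> ennreal M * (ennreal (w0 y) * of_bool (inner_n k y y > b))"
        unfolding mult.assoc[symmetric] by (rule mult_right_mono) simp
    qed
    also have "\<dots> = ennreal M * (\<integral>\<^sup>+y. ennreal (w0 y) * of_bool (inner_n k y y > b) \<partial>leb k)"
      by (rule nn_integral_cmult) measurable
    also have "\<dots> \<le> ennreal M * ennreal (G a0 * \<tau>)"
      unfolding w0_def G_def \<tau>_def by (intro mult_left_mono nn_integral_wt_tail a0) simp
    finally show ?thesis using M Gp[OF a0] \<tau> by (simp add: ennreal_mult)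
  qed
  have i0_ge: "i0 \<ge> (998 / 1000) * G a0"
  proof -
    have "ennreal (exp (- 2 * a0 * b\<^sup>2) * (G a0 * (1 - \<tau>))) \<le> ennreal i0"
      unfolding ci0(2)[symmetric] I0_def w0_def G_def \<tau>_def using b by (intro nn_integral_wt_lower a0) simp
    then have 1: "exp (- 2 * a0 * b\<^sup>2) * (G a0 * (1 - \<tau>)) \<le> i0" using ci0(4) by (simp add: ennreal_le_iff)
    have "1 + (- (2 * a0 * b\<^sup>2)) \<le> exp (- (2 * a0 * b\<^sup>2))" by (rule exp_ge_add_one_self)
    then have "(999 / 1000) \<le> exp (- 2 * a0 * b\<^sup>2)" using num(2) by simp
    moreover have "G a0 * (999 / 1000) \<le> G a0 * (1 - \<tau>)" using \<tau> Gp[OF a0] by (intro mult_left_mono) auto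
    ultimately have "(999 / 1000) * (G a0 * (999 / 1000)) \<le> exp (- 2 * a0 * b\<^sup>2) * (G a0 * (1 - \<tau>))"
      using Gp[OF a0] by (intro mult_mono) auto
    moreover have "(998 / 1000) * G a0 \<le> (999 / 1000) * (G a0 * (999 / 1000))" using Gp[OF a0] by simp
    ultimately show ?thesis using 1 by linarith
  qed
  \<comment> \<open>By \<open>\<phi>1\<close> and \<open>C0\<close>, \<phi> and the constant 1 have
    the same integral against \<open>w0\<close>.\<close>
  have KK: "K + K' = I0"
  proof -
    have "K + K' = (\<integral>\<^sup>+y. ennreal (\<phi> y * w0 y) * of_bool (inner_n k y y \<le> b) + ennreal (\<phi> y * w0 y) * of_bool (inner_n k y y > b) \<partial>leb k)"
      unfolding K_def K'_def by (rule nn_integral_add[symmetric]) measurable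
    also have "\<dots> = (\<integral>\<^sup>+y. ennreal (\<phi> y) * ennreal (w0 y) \<partial>leb k)"
      using \<phi>0 w_nonneg by (intro nn_integral_cong) (auto simp: ennreal_mult)
    finally have "C0 * (K + K') = 1" using \<phi>1 by (simp add: w0_def)
    then have "C0 * (K + K') = C0 * I0" using C0 by (simp add: I0_def w0_def)
    then show ?thesis using ci0 by (auto simp: ennreal_mult_cancel_left)
  qed
  have K_ge: "ennreal ((99 / 100) * i0) \<le> K"
  proof -
    have "M * (G a0 * \<tau>) = (M * \<tau>) * G a0" by simp
    also have "\<dots> \<le> (1 / 1000) * G a0" using \<tau> Gp[OF a0] by (intro mult_right_mono) auto
    also have "\<dots> \<le> (1 / 100) * i0" using i0_ge Gp[OF a0] by simp
    finally have "K' \<le> ennreal ((1 / 100) * i0)" using K'_le by (meson ennreal_leI order_trans)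
    then have "ennreal i0 \<le> K + ennreal ((1 / 100) * i0)" using KK ci0(2) by (metis add_left_mono)
    then have "ennreal i0 - ennreal ((1 / 100) * i0) \<le> K" by (simp add: ennreal_minus_le_iff add.commute)
    then show ?thesis using ci0(4) by (simp add: ennreal_minus)
  qed
  define p where "p = (\<Prod>i<k. s1 i) * (\<Prod>i<k. s2 i)"
  have i1_le: "i1 \<le> G a1 * (\<Prod>i<k. s1 i)" and i2_le: "i2 \<le> G a1 * (\<Prod>i<k. s2 i)"
  proof -
    have pp: "(\<Prod>i<k. s1 i) > 0" "(\<Prod>i<k. s2 i) > 0" using s by (auto intro: prod_pos)
    have "ennreal i1 = (\<integral>\<^sup>+y. ennreal (wt k a1 y) \<partial>leb k) * ennreal (\<Prod>i<k. s1 i)"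
      unfolding ci1(2)[symmetric] I1_def w1_def by (rule nn_integral_wt_scale[OF s(1)])
    also have "\<dots> \<le> ennreal (G a1) * ennreal (\<Prod>i<k. s1 i)"
      unfolding G_def by (intro mult_right_mono nn_integral_wt_upper a) simp
    finally show "i1 \<le> G a1 * (\<Prod>i<k. s1 i)"
      using Gp[OF a(1)] pp by (simp add: ennreal_mult[symmetric] ennreal_le_iff)
    have a2: "a2 > 0" using a by linarith
    have "ennreal i2 = (\<integral>\<^sup>+y. ennreal (wt k a2 y) \<partial>leb k) * ennreal (\<Prod>i<k. s2 i)"
      unfolding ci2(2)[symmetric] I2_def w2_def by (rule nn_integral_wt_scale[OF s(2)])
    also have "\<dots> \<le> ennreal (G a2) * ennreal (\<Prod>i<k. s2 i)"
      unfolding G_def by (intro mult_right_mono nn_integral_wt_upper a2) simp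
    finally have "i2 \<le> G a2 * (\<Prod>i<k. s2 i)"
      using Gp[OF a2] pp by (simp add: ennreal_mult[symmetric] ennreal_le_iff)
    also have "\<dots> \<le> G a1 * (\<Prod>i<k. s2 i)"
    proof (rule mult_right_mono)
      have "pi / a2 \<le> pi / a1" using a by (intro divide_left_mono) auto
      then show "G a2 \<le> G a1" unfolding G_def using a2 by (intro power_mono real_sqrt_le_mono) auto
    qed (use pp in simp)
    finally show "i2 \<le> G a1 * (\<Prod>i<k. s2 i)" .
  qed
  \<comment> \<open>As \<open>l i * (1 - l i) \<le> 1 / 4\<close>, the Jacobians of the two
    dilations multiply to at most \<open>(1 / 2) ^ k\<close>. This offsets the Gaussian constants,
    because \<open>a0\<close> is about twice \<open>a1\<close>.\<close>
  have p_le: "p \<le> (1 / 2) ^ k" "p > 0"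
  proof -
    have "p = (\<Prod>i<k. s1 i * s2 i)" by (simp add: p_def prod.distrib)
    also have "\<dots> \<le> (\<Prod>i<k. 1 / 2)"
    proof (rule prod_mono, intro conjI)
      fix i assume "i \<in> {..<k}"
      then have i: "i < k" by simp
      show "0 \<le> s1 i * s2 i" using s[OF i] by simp
      have "0 \<le> (l i - 1 / 2)\<^sup>2" by simp
      then have "l i * (1 - l i) \<le> (1 / 2)\<^sup>2" by (simp add: power2_eq_square algebra_simps)
      then have "sqrt (l i * (1 - l i)) \<le> 1 / 2" by (intro real_le_lsqrt) auto
      then show "s1 i * s2 i \<le> 1 / 2" by (simp add: s1_def s2_def real_sqrt_mult)
    qed
    finally show "p \<le> (1 / 2) ^ k" by simp
    show "p > 0" unfolding p_def using s by (auto intro!: mult_pos_pos prod_pos)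
  qed
  have i12: "i1 * i2 \<le> (G a1)\<^sup>2 * (1 / 2) ^ k"
  proof -
    have "i1 * i2 \<le> (G a1 * (\<Prod>i<k. s1 i)) * (G a1 * (\<Prod>i<k. s2 i))"
      using i1_le i2_le ci1(4) ci2(4) by (intro mult_mono) auto
    also have "\<dots> = (G a1)\<^sup>2 * p" by (simp add: p_def power2_eq_square mult_ac)
    also have "\<dots> \<le> (G a1)\<^sup>2 * (1 / 2) ^ k" using p_le by (intro mult_left_mono) auto
    finally show ?thesis .
  qed
  have GG: "(G a1)\<^sup>2 * (1 / 2) ^ k * (2 * a1 / a0) ^ k = (G a0)\<^sup>2"
  proof -
    have G2: "(G a)\<^sup>2 = (pi / a) ^ k" if "a > 0" for a
      using that by (simp add: G_def power_mult[symmetric] mult.commute[of k] power_mult)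
    show ?thesis unfolding G2[OF a(1)] G2[OF a0] power_mult_distrib[symmetric] using a(1) a0 by simp
  qed
  have i12': "(99 / 100) * (i1 * i2) \<le> (G a0)\<^sup>2"
  proof -
    have "(99 / 100) * (i1 * i2) \<le> (2 * a1 / a0) ^ k * ((G a1)\<^sup>2 * (1 / 2) ^ k)"
      by (rule mult_mono[OF num(1) i12]) (use a(1) a0 ci1(4) ci2(4) in simp_all)
    then show ?thesis using GG by (simp add: mult_ac)
  qed
  have "(96 / 100) \<le> exp (- \<delta>)"
  proof -
    have "\<delta> \<le> 4 / 100" using num(3) by (simp only: \<delta>_def)
    then show ?thesis using exp_ge_add_one_self[of "- \<delta>"] by linarith
  qed
  \<comment> \<open>The losses fit: 0.96 times the square of 0.99 * 0.998 is above 0.9, and 0.99 *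
    0.9 is above 0.81.\<close>
  have final: "(81 / 100) \<le> c1 * c2 * (exp (- \<delta>) * ((99 / 100) * i0)\<^sup>2)"
  proof -
    have "(99 / 100) * x \<le> y \<Longrightarrow> 0 < x \<Longrightarrow> (81 / 100) * x \<le> (9 / 10) * y" for x y :: real by linarith
    from this[OF i12'] have "(81 / 100) * (i1 * i2) \<le> (9 / 10) * (G a0)\<^sup>2" using ci1(4) ci2(4) by simp
    also have "\<dots> \<le> (96 / 100) * ((99 / 100) * ((998 / 1000) * G a0))\<^sup>2" by (simp add: power_mult_distrib power2_eq_square)
    also have "\<dots> \<le> exp (- \<delta>) * ((99 / 100) * i0)\<^sup>2"
      using \<open>(96 / 100) \<le> exp (- \<delta>)\<close> i0_ge Gp[OF a0] by (intro mult_mono power_mono) auto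
    finally have "(c1 * c2) * ((81 / 100) * (i1 * i2)) \<le> (c1 * c2) * (exp (- \<delta>) * ((99 / 100) * i0)\<^sup>2)"
      using ci1(3) ci2(3) by (intro mult_left_mono) auto
    moreover have "(c1 * c2) * ((81 / 100) * (i1 * i2)) = (81 / 100) * ((c1 * i1) * (c2 * i2))" by (simp add: mult_ac)
    ultimately show ?thesis using ci1(5) ci2(5) by simp
  qed
  have "ennreal (81 / 100) \<le> ennreal (c1 * c2 * (exp (- \<delta>) * ((99 / 100) * i0)\<^sup>2))" using final by (rule ennreal_leI)
  also have "\<dots> = (C1 * C2) * (ennreal (exp (- \<delta>)) * (ennreal ((99 / 100) * i0))\<^sup>2)"
    unfolding ci1(1) ci2(1) using ci0(4) ci1(3) ci2(3) by (simp add: ennreal_mult ennreal_power)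
  also have "\<dots> \<le> (C1 * C2) * (ennreal (exp (- \<delta>)) * K\<^sup>2)"
    using K_ge by (intro mult_left_mono power_mono) auto
  also have "\<dots> \<le> (C1 * C2) * (J1 * J2)" using CS by (intro mult_left_mono) auto
  also have "\<dots> = X1 * X2" by (simp add: X mult_ac)
  finally show "ennreal (81 / 100) \<le> X1 * X2" .
qed

section \<open>Application to a subspace, its complement and the whole space\<close>

definition dep_on_first :: "nat \<Rightarrow> nat \<Rightarrow> ((nat \<Rightarrow> real) \<Rightarrow> ennreal) \<Rightarrow> bool" where
  "dep_on_first n k \<phi> \<longleftrightarrow> (\<forall>x\<in>sphere_in n (Rn n). \<forall>y\<in>sphere_in n (Rn n). (\<forall>i<k. x i = y i) \<longrightarrow> \<phi> x = \<phi> y)"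

text \<open>The vectors \<open>orth_proj n H (v i)\<close> are mutually orthogonal with squared
  norms \<open>l i\<close>; normalised, they start an orthonormal basis of \<open>H\<close> of the
  kind required by \<open>sphere_measure_density\<close>, with \<open>s i = sqrt (l i)\<close>. The
  constant function 1 determines \<open>C\<close>. For \<open>H = Rn n\<close> all
  \<open>l i\<close> are 1, so the whole sphere is a special case.\<close>

lemma subspace_density:
  assumes H: "subspace H" "H \<subseteq> Rn n" "dim H = k + j" and j: "j \<ge> 1" and k: "k < n"
    and v: "onb n k v (Rn k)" "\<And>i i'. i < k \<Longrightarrow> i' < k \<Longrightarrow> i \<noteq> i' \<Longrightarrow> inner_n n (orth_proj n H (v i)) (v i') = 0"
    and l: "\<And>i. i < k \<Longrightarrow> inner_n n (orth_proj n H (v i)) (v i) = l i" "\<And>i. i < k \<Longrightarrow> l i > 0"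
  shows "\<exists>C :: ennreal. (\<forall>\<phi>\<in>borel_measurable borel. dep_on_first n k \<phi> \<longrightarrow>
    (\<integral>\<^sup>+x. \<phi> x \<partial>sphere_measure n H) = C * (\<integral>\<^sup>+y. \<phi> (lift_k k v y) * ennreal (wt k (real j / 2 - 1) (\<lambda>i. y i / sqrt (l i))) \<partial>leb k)) \<and>
    C * (\<integral>\<^sup>+y. ennreal (wt k (real j / 2 - 1) (\<lambda>i. y i / sqrt (l i))) \<partial>leb k) = 1"
proof -
  define u where "u i = (1 / sqrt (l i)) *\<^sub>R orth_proj n H (v i)" for i
  have uH: "u i \<in> H" for i unfolding u_def by (intro subspace_scale orth_proj_in H)
  have PP: "inner_n n (orth_proj n H (v i)) (orth_proj n H (v i')) = inner_n n (orth_proj n H (v i)) (v i')" for i i'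
    using inner_orth_proj[OF H(1,2) orth_proj_in[OF H(1,2)], of "v i'" "v i"] by (simp add: inner_n_commute)
  have o: "onf n k u" unfolding onf_def
  proof (intro conjI allI impI)
    fix i show "u i \<in> Rn n" using uH H by auto
  next
    fix i i' assume i: "i < k" "i' < k"
    show "inner_n n (u i) (u i') = (if i = i' then 1 else 0)"
    proof (cases "i = i'")
      case True
      then show ?thesis using l[OF i(1)] by (simp add: u_def inner_n_scale PP)
    next
      case False
      then show ?thesis using v(2)[OF i False] by (simp add: u_def inner_n_scale PP)
    qed
  qed
  obtain w where w: "onb n (k + j) w H" "\<And>i. i < k \<Longrightarrow> w i = u i"
    using onf_extend[OF H(1,2) o uH] H(3) by auto
  have wv: "inner_n n (w p) (v i) = (if p = i then sqrt (l i) else 0)" if "p < k + j" "i < k" for p i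
  proof -
    have li: "sqrt (l i) > 0" using l(2)[OF that(2)] by simp
    have "orth_proj n H (v i) = sqrt (l i) *\<^sub>R u i" using li by (simp add: u_def)
    then have Pw: "orth_proj n H (v i) = sqrt (l i) *\<^sub>R w i" using w(2)[OF that(2)] by simp
    have "inner_n n (w p) (v i) = inner_n n (orth_proj n H (v i)) (w p)"
      using inner_orth_proj[OF H(1,2) onb_in[OF w(1) that(1)], of "v i"] by (simp add: inner_n_commute)
    also have "\<dots> = sqrt (l i) * inner_n n (w i) (w p)" unfolding Pw by (simp add: inner_n_scale)
    also have "inner_n n (w i) (w p) = (if i = p then 1 else 0)"
      using w(1) that by (simp add: onb_def onf_def)
    finally show ?thesis by simp
  qed
  have sl: "sqrt (l i) > 0" if "i < k" for i using l(2)[OF that] by simp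
  obtain C :: ennreal where C: "\<And>\<phi>. \<phi> \<in> borel_measurable borel \<Longrightarrow>
    (\<And>x y. x \<in> sphere_in n (Rn n) \<Longrightarrow> y \<in> sphere_in n (Rn n) \<Longrightarrow> \<forall>i<k. x i = y i \<Longrightarrow> \<phi> x = \<phi> y) \<Longrightarrow>
    (\<integral>\<^sup>+x. \<phi> x \<partial>sphere_measure n H) = C * (\<integral>\<^sup>+y. \<phi> (lift_k k v y) * ennreal (wt k (real j / 2 - 1) (\<lambda>i. y i / sqrt (l i))) \<partial>leb k)"
    using sphere_measure_density[OF w(1) j k v(1) sl wv] by blast
  have "prob_space (sphere_measure n H)"
    using sphere_measure_facts(1)[OF H(1,2)] H(3) j by (simp add: is_uniform_on_sphere_def)
  then have "(\<integral>\<^sup>+x. 1 \<partial>sphere_measure n H) = 1" by (simp add: prob_space.emeasure_space_1)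
  then have "C * (\<integral>\<^sup>+y. ennreal (wt k (real j / 2 - 1) (\<lambda>i. y i / sqrt (l i))) \<partial>leb k) = 1"
    using C[of "\<lambda>_. 1"] by simp
  moreover have "(\<integral>\<^sup>+x. \<phi> x \<partial>sphere_measure n H) = C * (\<integral>\<^sup>+y. \<phi> (lift_k k v y) * ennreal (wt k (real j / 2 - 1) (\<lambda>i. y i / sqrt (l i))) \<partial>leb k)"
    if "\<phi> \<in> borel_measurable borel" "dep_on_first n k \<phi>" for \<phi>
  proof (rule C[OF that(1)])
    fix x y assume "x \<in> sphere_in n (Rn n)" "y \<in> sphere_in n (Rn n)" "\<forall>i<k. x i = y i"
    then show "\<phi> x = \<phi> y"
      by (intro that(2)[unfolded dep_on_first_def, THEN bspec, THEN bspec, THEN mp])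
  qed
  ultimately show ?thesis by (intro exI[of _ C] conjI ballI impI)
qed

text \<open>The measures for different \<open>H\<close> are push-forwards of one Gaussian measure
  under maps jointly measurable in \<open>H\<close> and \<open>g\<close>, so measurability of
  partial integrals applies. For the complement the projection is the residual of
  \<open>g\<close>.\<close>

lemma nn_integral_sphere_measurable:
  assumes m: "1 \<le> m" "m < n" and F: "F \<in> borel_measurable borel"
  shows "(\<lambda>H. \<integral>\<^sup>+x. F x \<partial>sphere_measure n H) \<in> borel_measurable (Grassmannian_borel n m)"
    and "(\<lambda>H. \<integral>\<^sup>+x. F x \<partial>sphere_measure n (orth_compl n H)) \<in> borel_measurable (Grassmannian_borel n m)"
proof -
  interpret G: prob_space "gauss n" by (rule prob_space_gauss)
  let ?N = "Grassmannian_borel n m \<Otimes>\<^sub>M gauss n"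
  have 1: "fst \<in> ?N \<rightarrow>\<^sub>M Grassmannian_borel n m" by simp
  have 2: "snd \<in> borel_measurable ?N"
    using measurable_snd[of "Grassmannian_borel n m" "gauss n"] measurable_cong_sets[OF refl sets_gauss] by blast
  have P: "(\<lambda>p. orth_proj n (fst p) (snd p)) \<in> borel_measurable ?N" by (rule measurable_orth_proj[OF 1 2])
  have R: "(\<lambda>p. trunc n (snd p) - orth_proj n (fst p) (snd p)) \<in> borel_measurable ?N"
    by (intro measurable_add_seq(2) P measurable_compose[OF 2 measurable_trunc])
  have nrm: "(\<lambda>p. F ((1 / sqrt (inner_n n (h p) (h p))) *\<^sub>R h p)) \<in> borel_measurable ?N"
    if h: "h \<in> borel_measurable ?N" for h
  proof -
    note [measurable] = measurable_inner_n[OF h h, of n]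
    have q: "(\<lambda>p. 1 / sqrt (inner_n n (h p) (h p))) \<in> borel_measurable ?N" by measurable
    show ?thesis by (rule measurable_compose[OF measurable_scaleR_seq[OF q h] F])
  qed
  have "(\<lambda>H. \<integral>\<^sup>+g. F (sph n H g) \<partial>gauss n) \<in> borel_measurable (Grassmannian_borel n m)"
    using G.borel_measurable_nn_integral_fst[OF nrm[OF P]] by (simp add: sph_def)
  moreover have "(\<integral>\<^sup>+g. F (sph n H g) \<partial>gauss n) = (\<integral>\<^sup>+x. F x \<partial>sphere_measure n H)"
    if "H \<in> space (Grassmannian_borel n m)" for H
    using sphere_measure_facts(2)[of H n F] GrassmannianD[of H n m] that m F by simp
  ultimately show "(\<lambda>H. \<integral>\<^sup>+x. F x \<partial>sphere_measure n H) \<in> borel_measurable (Grassmannian_borel n m)"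
    by (rule measurable_cong[THEN iffD1, rotated])
  have "(\<lambda>H. \<integral>\<^sup>+g. F ((1 / sqrt (inner_n n (residual n H g) (residual n H g))) *\<^sub>R residual n H g) \<partial>gauss n) \<in> borel_measurable (Grassmannian_borel n m)"
    using G.borel_measurable_nn_integral_fst[OF nrm[OF R]] by (simp add: residual_def)
  moreover have "(\<integral>\<^sup>+g. F ((1 / sqrt (inner_n n (residual n H g) (residual n H g))) *\<^sub>R residual n H g) \<partial>gauss n)
      = (\<integral>\<^sup>+x. F x \<partial>sphere_measure n (orth_compl n H))"
    if "H \<in> space (Grassmannian_borel n m)" for H
  proof -
    have HG: "H \<in> Grassmannian n m" using that by simp
    note H = GrassmannianD[OF HG]
    note c = orth_compl_facts[OF H(1,2)]
    have "dim (orth_compl n H) \<ge> 1" using c(3) H(3) m by simp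
    then show ?thesis using sphere_measure_facts(2)[OF c(1,2) _ F] by (simp add: sph_def c(4) residual_def)
  qed
  ultimately show "(\<lambda>H. \<integral>\<^sup>+x. F x \<partial>sphere_measure n (orth_compl n H)) \<in> borel_measurable (Grassmannian_borel n m)"
    by (rule measurable_cong[THEN iffD1, rotated])
qed

text \<open>Extension by 0 makes \<open>f\<close> Borel on all sequences without changing its
  integrals. A divergent integral is 0 on both sides, so finiteness has to be checked wherever a
  lower bound is read off.\<close>

lemma sphere_integral_eq:
  assumes H: "subspace H" "H \<subseteq> Rn n" "dim H \<ge> 1"
    and f: "f \<in> borel_measurable (restrict_space borel (sphere_in n (Rn n)))" "\<And>x. x \<in> sphere_in n (Rn n) \<Longrightarrow> 0 \<le> f x"
  defines "fh \<equiv> (\<lambda>x. if x \<in> sphere_in n (Rn n) then f x else (0 :: real))"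
  shows "fh \<in> borel_measurable borel" "(\<integral>x. f x \<partial>sphere_measure n H) = enn2real (\<integral>\<^sup>+x. ennreal (fh x) \<partial>sphere_measure n H)"
proof -
  have n: "n \<ge> 1" using dim_le_n[OF H(1,2)] H(3) by linarith
  have S: "sphere_in n (Rn n) \<in> sets borel" by (rule borel_sphere_in[OF subspace_Rn order_refl n])
  show fm: "fh \<in> borel_measurable borel"
  proof -
    have "(\<lambda>x. indicator (sphere_in n (Rn n)) x *\<^sub>R f x) \<in> borel_measurable borel"
      using f(1) S by (subst (asm) borel_measurable_restrict_space_iff) auto
    moreover have "(\<lambda>x. indicator (sphere_in n (Rn n)) x *\<^sub>R f x) = fh" by (auto simp: fh_def indicator_def)
    ultimately show ?thesis by simp
  qed
  have u: "sets (sphere_measure n H) = sets (restrict_space borel (sphere_in n H))"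
    using sphere_measure_facts(1)[OF H] by (simp add: is_uniform_on_sphere_def)
  have sp: "space (sphere_measure n H) = sphere_in n H"
    using sets_eq_imp_space_eq[OF u] by (simp add: space_restrict_space)
  have sub: "sphere_in n H \<subseteq> sphere_in n (Rn n)" using n by (auto simp: sphere_in_iff)
  have "(\<integral>x. f x \<partial>sphere_measure n H) = (\<integral>x. fh x \<partial>sphere_measure n H)"
    using sub sp by (intro Bochner_Integration.integral_cong) (auto simp: fh_def)
  also have "\<dots> = enn2real (\<integral>\<^sup>+x. ennreal (fh x) \<partial>sphere_measure n H)"
    by (intro integral_eq_nn_integral) (use f(2) measurable_restrict_space1[OF fm, of "sphere_in n H"] measurable_cong_sets[OF u refl] in \<open>auto simp: fh_def\<close>)
  finally show "(\<integral>x. f x \<partial>sphere_measure n H) = enn2real (\<integral>\<^sup>+x. ennreal (fh x) \<partial>sphere_measure n H)" .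
qed

lemma balanced_subspace_product_lower:
  fixes f :: "(nat \<Rightarrow> real) \<Rightarrow> real"
  assumes k: "1 \<le> k" "k < m" and m: "m = n div 2" and H: "H \<in> Grassmannian n m"
    and f: "f \<in> borel_measurable (restrict_space borel (sphere_in n (Rn n)))" "\<And>x. x \<in> sphere_in n (Rn n) \<Longrightarrow> 0 \<le> f x"
    and f1: "(\<integral>x. f x \<partial>sphere_measure n (Rn n)) = 1"
    and fM: "esssup (sphere_measure n (Rn n)) (\<lambda>x. ereal \<bar>f x\<bar>) \<le> ereal M" and M: "M > 0"
    and dep: "\<And>x y. x \<in> sphere_in n (Rn n) \<Longrightarrow> y \<in> sphere_in n (Rn n) \<Longrightarrow> \<forall>i<k. x i = y i \<Longrightarrow> f x = f y"
    and \<epsilon>: "0 < \<epsilon>" "\<epsilon> \<le> 1 / 4" and b: "0 < b" "b \<le> 1 / 16"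
    and small: "(\<integral>\<^sup>+x. of_bool (unbalanced \<epsilon> (inner_n n (orth_proj n H x) (orth_proj n H x)) (inner_n n x x)) \<partial>gauss k)
         < ennreal (exp (- 6 * real k))"
  defines "a0 \<equiv> real (n - k) / 2 - 1" and "a1 \<equiv> real (m - k) / 2 - 1" and "a2 \<equiv> real (n - m - k) / 2 - 1"
  assumes a1: "a1 > 0"
    and num: "(2 * a1 / a0) ^ k \<ge> (99 / 100)" "2 * a0 * b\<^sup>2 \<le> (1 / 1000)" "32 * a2 * \<epsilon>\<^sup>2 * b + 64 * a2 * b\<^sup>2 \<le> (4 / 100)"
      "sqrt 2 ^ k * exp (- a0 * b / 2) \<le> (1 / 1000)" "M * (sqrt 2 ^ k * exp (- a0 * b / 2)) \<le> (1 / 1000)"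
  shows "sqrt ((\<integral>x. f x \<partial>sphere_measure n H) * (\<integral>x. f x \<partial>sphere_measure n (orth_compl n H))) \<ge> 0.9"
proof -
  let ?S = "sphere_in n (Rn n)"
  have kn: "k < n" "k \<le> n" "m < n" "1 \<le> m" using k m by auto
  note HD = GrassmannianD[OF H]
  note cD = orth_compl_facts[OF HD(1,2)]
  have d1: "dim H = k + (m - k)" "dim (orth_compl n H) = k + (n - m - k)" "dim (Rn n) = k + (n - k)"
    using HD(3) cD(3) k kn m by (auto simp: dim_Rn)
  have j: "m - k \<ge> 1" "n - m - k \<ge> 1" "n - k \<ge> 1" using k kn m by auto
  have dge: "dim H \<ge> 1" "dim (orth_compl n H) \<ge> 1" "dim (Rn n) \<ge> 1" using d1 j by auto
  obtain v where v: "onb n k v (Rn k)" "\<And>i i'. i < k \<Longrightarrow> i' < k \<Longrightarrow> i \<noteq> i' \<Longrightarrow> inner_n n (orth_proj n H (v i)) (v i') = 0"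
    using principal_vectors[OF HD(1,2) kn(2)] by blast
  define l where "l i = inner_n n (orth_proj n H (v i)) (v i)" for i
  have l: "\<bar>l i - 1 / 2\<bar> \<le> \<epsilon>" if "i < k" for i
    unfolding l_def by (rule principal_values_balanced[OF HD(1,2) kn(2) \<epsilon>(1) v small that])
  note lb = inverse_product_bound[OF l \<epsilon>(2)]
  have ov: "inner_n n (v i) (v i') = (if i = i' then 1 else 0)" if "i < k" "i' < k" for i i'
    using v(1) that by (simp add: onb_def onf_def)
  have vR: "v i \<in> Rn n" if "i < k" for i using v(1) that by (simp add: onb_def onf_def)
  have cP: "inner_n n (orth_proj n (orth_compl n H) (v i)) (v i') = (if i = i' then 1 else 0) - inner_n n (orth_proj n H (v i)) (v i')"
    if "i < k" "i' < k" for i i'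
    using ov[OF that] by (simp add: cD(4) trunc_Rn(2)[OF vR[OF that(1)]] inner_n_diff)
  have c1: "inner_n n (orth_proj n (orth_compl n H) (v i)) (v i') = 0" if "i < k" "i' < k" "i \<noteq> i'" for i i'
    using cP[OF that(1,2)] v(2)[OF that] that(3) by simp
  have c2: "inner_n n (orth_proj n (orth_compl n H) (v i)) (v i) = 1 - l i" if "i < k" for i
    using cP[OF that that] by (simp add: l_def)
  have P0: "orth_proj n (Rn n) (v i) = v i" if "i < k" for i
    by (rule orth_proj_self[OF subspace_Rn order_refl vR[OF that]])
  let ?B = "borel_measurable borel :: ((nat \<Rightarrow> real) \<Rightarrow> ennreal) set"
  obtain C1 :: ennreal where C1: "\<forall>\<phi>\<in>?B. dep_on_first n k \<phi> \<longrightarrow>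
      (\<integral>\<^sup>+x. \<phi> x \<partial>sphere_measure n H) = C1 * (\<integral>\<^sup>+y. \<phi> (lift_k k v y) * ennreal (wt k a1 (\<lambda>i. y i / sqrt (l i))) \<partial>leb k)"
      "C1 * (\<integral>\<^sup>+y. ennreal (wt k a1 (\<lambda>i. y i / sqrt (l i))) \<partial>leb k) = 1"
  proof -
    have "\<exists>C. (\<forall>\<phi>\<in>?B. dep_on_first n k \<phi> \<longrightarrow>
      (\<integral>\<^sup>+x. \<phi> x \<partial>sphere_measure n H) = C * (\<integral>\<^sup>+y. \<phi> (lift_k k v y) * ennreal (wt k a1 (\<lambda>i. y i / sqrt (l i))) \<partial>leb k)) \<and>
      C * (\<integral>\<^sup>+y. ennreal (wt k a1 (\<lambda>i. y i / sqrt (l i))) \<partial>leb k) = 1"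
      unfolding a1_def by (rule subspace_density[OF HD(1,2) d1(1) j(1) kn(1) v]) (simp_all add: l_def[symmetric] lb(4))
    then show ?thesis by (elim exE conjE) (rule that)
  qed
  obtain C2 :: ennreal where C2: "\<forall>\<phi>\<in>?B. dep_on_first n k \<phi> \<longrightarrow>
      (\<integral>\<^sup>+x. \<phi> x \<partial>sphere_measure n (orth_compl n H)) = C2 * (\<integral>\<^sup>+y. \<phi> (lift_k k v y) * ennreal (wt k a2 (\<lambda>i. y i / sqrt (1 - l i))) \<partial>leb k)"
      "C2 * (\<integral>\<^sup>+y. ennreal (wt k a2 (\<lambda>i. y i / sqrt (1 - l i))) \<partial>leb k) = 1"
  proof -
    have "\<exists>C. (\<forall>\<phi>\<in>?B. dep_on_first n k \<phi> \<longrightarrow>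
      (\<integral>\<^sup>+x. \<phi> x \<partial>sphere_measure n (orth_compl n H)) = C * (\<integral>\<^sup>+y. \<phi> (lift_k k v y) * ennreal (wt k a2 (\<lambda>i. y i / sqrt (1 - l i))) \<partial>leb k)) \<and>
      C * (\<integral>\<^sup>+y. ennreal (wt k a2 (\<lambda>i. y i / sqrt (1 - l i))) \<partial>leb k) = 1"
      unfolding a2_def by (rule subspace_density[OF cD(1,2) d1(2) j(2) kn(1) v(1)]) (simp_all add: c1 c2 lb(5))
    then show ?thesis by (elim exE conjE) (rule that)
  qed
  obtain C0 :: ennreal where C0: "\<forall>\<phi>\<in>?B. dep_on_first n k \<phi> \<longrightarrow>
      (\<integral>\<^sup>+x. \<phi> x \<partial>sphere_measure n (Rn n)) = C0 * (\<integral>\<^sup>+y. \<phi> (lift_k k v y) * ennreal (wt k a0 (\<lambda>i. y i / sqrt 1)) \<partial>leb k)"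
      "C0 * (\<integral>\<^sup>+y. ennreal (wt k a0 (\<lambda>i. y i / sqrt 1)) \<partial>leb k) = 1"
  proof -
    have "\<exists>C. (\<forall>\<phi>\<in>?B. dep_on_first n k \<phi> \<longrightarrow>
      (\<integral>\<^sup>+x. \<phi> x \<partial>sphere_measure n (Rn n)) = C * (\<integral>\<^sup>+y. \<phi> (lift_k k v y) * ennreal (wt k a0 (\<lambda>i. y i / sqrt 1)) \<partial>leb k)) \<and>
      C * (\<integral>\<^sup>+y. ennreal (wt k a0 (\<lambda>i. y i / sqrt 1)) \<partial>leb k) = 1"
      unfolding a0_def by (rule subspace_density[OF subspace_Rn order_refl d1(3) j(3) kn(1) v(1)]) (simp_all add: P0 ov)
    then show ?thesis by (elim exE conjE) (rule that)
  qed
  have wt0: "wt k a0 (\<lambda>i. y i / sqrt 1) = wt k a0 y" for y by simp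
  note C0' = C0[unfolded wt0]
  define fh where "fh = (\<lambda>x. if x \<in> ?S then f x else 0)"
  have ints: "(\<integral>x. f x \<partial>sphere_measure n H) = enn2real (\<integral>\<^sup>+x. ennreal (fh x) \<partial>sphere_measure n H)"
    "(\<integral>x. f x \<partial>sphere_measure n (orth_compl n H)) = enn2real (\<integral>\<^sup>+x. ennreal (fh x) \<partial>sphere_measure n (orth_compl n H))"
    "(\<integral>x. f x \<partial>sphere_measure n (Rn n)) = enn2real (\<integral>\<^sup>+x. ennreal (fh x) \<partial>sphere_measure n (Rn n))"
    unfolding fh_def
    using sphere_integral_eq(2)[OF HD(1,2) dge(1) f] sphere_integral_eq(2)[OF cD(1,2) dge(2) f]
      sphere_integral_eq(2)[OF subspace_Rn order_refl dge(3) f] by simp_all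
  have fhm [measurable]: "fh \<in> borel_measurable borel"
    unfolding fh_def by (rule sphere_integral_eq(1)[OF HD(1,2) dge(1) f])
  have fh0: "fh x \<ge> 0" for x using f(2) by (simp add: fh_def)
  have fh_eq: "fh x = fh y" if "x \<in> ?S" "y \<in> ?S" "\<forall>i<k. x i = y i" for x y
    using dep[OF that] that(1,2) by (simp add: fh_def)
  have fh_dep: "dep_on_first n k (\<lambda>x. ennreal (fh x))"
    unfolding dep_on_first_def by (intro ballI impI arg_cong[where f=ennreal] fh_eq)
  have fhM_dep: "dep_on_first n k (\<lambda>x. of_bool (fh x > M))"
    unfolding dep_on_first_def by (intro ballI impI arg_cong[where f="\<lambda>t. of_bool (t > M)"] fh_eq)
  have lm: "lift_k k v \<in> borel_measurable borel" by (rule measurable_lift_k)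
  define \<phi> where "\<phi> y = fh (lift_k k v y)" for y
  have \<phi>m: "\<phi> \<in> borel_measurable borel" unfolding \<phi>_def by (rule measurable_compose[OF lm fhm])
  \<comment> \<open>The essential bound lives on the sphere but is needed for almost all
    \<open>y\<close>. The event \<open>fh x > M\<close> is itself determined by the first
    \<open>k\<close> coordinates, so the density formula carries its null set over.\<close>
  have "AE x in sphere_measure n (Rn n). \<not> fh x > M"
  proof -
    have "AE x in sphere_measure n (Rn n). ereal \<bar>f x\<bar> \<le> esssup (sphere_measure n (Rn n)) (\<lambda>x. ereal \<bar>f x\<bar>)"
      by (rule esssup_AE)
    then show ?thesis
    proof eventually_elim
      case (elim x)
      then have "ereal \<bar>f x\<bar> \<le> ereal M" using fM by (rule order_trans)
      then have "f x \<le> M" by simp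
      then show ?case using M by (simp add: fh_def)
    qed
  qed
  then have "(\<integral>\<^sup>+x. of_bool (fh x > M) \<partial>sphere_measure n (Rn n)) = (\<integral>\<^sup>+x. 0 \<partial>sphere_measure n (Rn n))"
    by (intro nn_integral_cong_AE) (elim eventually_mono, simp)
  then have "(\<integral>\<^sup>+x. of_bool (fh x > M) \<partial>sphere_measure n (Rn n)) = 0" by simp
  moreover have ofm: "(\<lambda>x. of_bool (fh x > M) :: ennreal) \<in> borel_measurable borel" by measurable
  ultimately have "C0 * (\<integral>\<^sup>+y. of_bool (\<phi> y > M) * ennreal (wt k a0 y) \<partial>leb k) = 0"
    using C0'(1)[rule_format, OF ofm fhM_dep] by (simp add: \<phi>_def)
  moreover have "C0 \<noteq> 0" using C0'(2) by auto
  ultimately have "(\<integral>\<^sup>+y. of_bool (\<phi> y > M) * ennreal (wt k a0 y) \<partial>leb k) = 0" by simp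
  moreover have "(\<lambda>y. of_bool (\<phi> y > M) * ennreal (wt k a0 y)) \<in> borel_measurable (leb k)"
    using \<phi>m by measurable
  ultimately have "AE y in leb k. of_bool (\<phi> y > M) * ennreal (wt k a0 y) = 0"
    by (simp add: nn_integral_0_iff_AE)
  then have \<phi>M: "AE y in leb k. inner_n k y y < 1 \<longrightarrow> \<phi> y \<le> M"
  proof eventually_elim
    case (elim y)
    show ?case
    proof
      assume "inner_n k y y < 1"
      then have "ennreal (wt k a0 y) \<noteq> 0" by (simp add: wt_def)
      then show "\<phi> y \<le> M" using elim by (auto simp: not_less split: split_of_bool_asm)
    qed
  qed
  have "enn2real (\<integral>\<^sup>+x. ennreal (fh x) \<partial>sphere_measure n (Rn n)) = 1" using f1 ints(3) by simp
  \<comment> \<open>The real value 1 excludes an infinite integral, for which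
    \<open>enn2real\<close> would be 0.\<close>
  then have "(\<integral>\<^sup>+x. ennreal (fh x) \<partial>sphere_measure n (Rn n)) = 1"
    by (metis enn2real_top ennreal_1 ennreal_enn2real less_top zero_neq_one)
  then have \<phi>1: "C0 * (\<integral>\<^sup>+y. ennreal (\<phi> y) * ennreal (wt k a0 y) \<partial>leb k) = 1"
    using C0'(1)[rule_format, OF measurable_compose[OF fhm measurable_ennreal] fh_dep] by (simp add: \<phi>_def)
  have X1: "(\<integral>\<^sup>+x. ennreal (fh x) \<partial>sphere_measure n H) = C1 * (\<integral>\<^sup>+y. ennreal (\<phi> y) * ennreal (wt k a1 (\<lambda>i. y i / sqrt (l i))) \<partial>leb k)"
    using C1(1)[rule_format, OF measurable_compose[OF fhm measurable_ennreal] fh_dep] by (simp add: \<phi>_def)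
  have X2: "(\<integral>\<^sup>+x. ennreal (fh x) \<partial>sphere_measure n (orth_compl n H)) = C2 * (\<integral>\<^sup>+y. ennreal (\<phi> y) * ennreal (wt k a2 (\<lambda>i. y i / sqrt (1 - l i))) \<partial>leb k)"
    using C2(1)[rule_format, OF measurable_compose[OF fhm measurable_ennreal] fh_dep] by (simp add: \<phi>_def)
  \<comment> \<open>The first inequality is \<open>m \<le> n - m\<close>; for the second,
    \<open>n - m\<close> exceeds \<open>n / 2\<close> by at most 1 / 2.\<close>
  have a: "a1 \<le> a2" "2 * a2 \<le> a0" using k kn m by (auto simp: a0_def a1_def a2_def of_nat_diff field_simps)
  have \<phi>0: "\<phi> y \<ge> 0" for y by (simp add: \<phi>_def fh0)
  note D = density_product_lower[OF \<phi>m \<phi>0 \<phi>M M l \<epsilon>(2) a1 a b C0'(2) C1(2) C2(2) \<phi>1 num, folded X1 X2]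
  let ?X1 = "\<integral>\<^sup>+x. ennreal (fh x) \<partial>sphere_measure n H" and ?X2 = "\<integral>\<^sup>+x. ennreal (fh x) \<partial>sphere_measure n (orth_compl n H)"
  \<comment> \<open>Finiteness of both factors matters here, since \<open>enn2real\<close> sends
    infinity to 0.\<close>
  have "(81 / 100) \<le> enn2real (?X1 * ?X2)"
    using enn2real_mono[OF D(3)] D(1,2) by (simp add: ennreal_mult_less_top)
  then have "81 / 100 \<le> (\<integral>x. f x \<partial>sphere_measure n H) * (\<integral>x. f x \<partial>sphere_measure n (orth_compl n H))"
    by (simp add: ints(1,2) enn2real_mult)
  then show ?thesis by (intro real_le_rsqrt) (simp add: power2_eq_square)
qed

section \<open>The constants\<close>

lemma exp_neg_le_inverse:
  assumes "x \<ge> 0"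
  shows "exp (- x) \<le> 1 / (1 + x :: real)"
proof -
  have "1 + x \<le> exp x" by (rule exp_ge_add_one_self)
  then have "1 / exp x \<le> 1 / (1 + x)" using assms by (intro divide_left_mono) auto
  then show ?thesis by (simp add: exp_minus inverse_eq_divide)
qed

lemma sqrt2_power_le_exp: "sqrt 2 ^ k \<le> exp (real k)"
proof -
  have "sqrt 2 \<le> 2" by (rule real_le_lsqrt) auto
  also have "(2 :: real) \<le> exp 1" using exp_ge_add_one_self[of "1 :: real"] by simp
  finally have "sqrt 2 ^ k \<le> exp 1 ^ k" by (intro power_mono) auto
  then show ?thesis by (simp add: exp_of_nat_mult[symmetric])
qed

text \<open>Every quantity is measured against \<open>r\<close>. The 24 in \<epsilon> makes
  \<open>\<epsilon>\<^sup>2 * real m / 4\<close> at least \<open>2 * r\<close>, which pays for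
  \<open>6 * real k\<close> and leaves \<open>r\<close>. The factor \<open>1 / 10 ^ 4\<close> in
  \<open>b\<close> makes \<open>real n * \<epsilon>\<^sup>2 * b\<close>, which does not depend on
  \<open>n\<close>, small enough. The tail exponent \<open>a0 * b / 2\<close> is then still at least
  \<open>r / 80000\<close> and outweighs both the bound on \<open>f\<close>, of exponent
  \<open>r / 10 ^ 6\<close>, and \<open>sqrt 2 ^ k\<close>.\<close>

lemma numeric_bounds:
  fixes n k m :: nat and r :: real
  assumes r: "r = sqrt (real n)" and k: "1 \<le> k" "real k \<le> 1 / 10 ^ 8 * r" and m: "m = n div 2"
  defines "\<epsilon> \<equiv> sqrt (24 / r)" and "b \<equiv> 1 / 10 ^ 4 / r"
  defines "a0 \<equiv> real (n - k) / 2 - 1" and "a1 \<equiv> real (m - k) / 2 - 1" and "a2 \<equiv> real (n - m - k) / 2 - 1"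
  shows "k < m" "0 < \<epsilon>" "\<epsilon> \<le> 1 / 4" "0 < b" "b \<le> 1 / 16" "a1 > 0" "(2 * a1 / a0) ^ k \<ge> 99 / 100"
    "2 * a0 * b\<^sup>2 \<le> 1 / 1000" "32 * a2 * \<epsilon>\<^sup>2 * b + 64 * a2 * b\<^sup>2 \<le> 4 / 100"
    "sqrt 2 ^ k * exp (- a0 * b / 2) \<le> 1 / 1000"
    "exp (1 / 10 ^ 6 * r) * (sqrt 2 ^ k * exp (- a0 * b / 2)) \<le> 1 / 1000"
    "6 * real k - \<epsilon>\<^sup>2 * real m / 4 \<le> - r"
proof -
  have k': "1 \<le> real k" using k by simp
  have kr: "real k \<le> r / 100000000" using k(2) by simp
  \<comment> \<open>For smaller \<open>n\<close> there is no admissible \<open>k\<close>, so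
    \<open>n\<close> is at least 10^16 and all estimates may be asymptotic.\<close>
  then have r8: "100000000 \<le> r" using k' by linarith
  then have r0: "r > 0" by simp
  have nr: "real n = r * r" using r by simp
  have n8: "100000000 * r \<le> real n" unfolding nr using r8 r0 by (intro mult_right_mono) auto
  have m_bounds: "real n / 2 - 1 / 2 \<le> real m" "real m \<le> real n / 2" using m by linarith+
  have "real k < real m" using kr m_bounds n8 r8 by linarith
  then show km: "k < m" by simp
  have a_eq: "a0 = real n / 2 - real k / 2 - 1" "a1 = real m / 2 - real k / 2 - 1"
    "a2 = real n / 2 - real m / 2 - real k / 2 - 1"
    using km m by (simp_all add: a0_def a1_def a2_def of_nat_diff field_simps)
  have e2: "\<epsilon>\<^sup>2 = 24 / r" using r0 by (simp add: \<epsilon>_def)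
  show "0 < \<epsilon>" using r0 by (simp add: \<epsilon>_def)
  show "\<epsilon> \<le> 1 / 4" unfolding \<epsilon>_def using r0 r8 by (intro real_le_lsqrt) (simp_all add: power2_eq_square divide_simps)
  show b0: "0 < b" using r0 by (simp add: b_def)
  show "b \<le> 1 / 16" using r8 r0 by (simp add: b_def divide_simps)
  have nb: "real n * b = r / 10000" "real n * b\<^sup>2 = 1 / 100000000"
    unfolding nr b_def using r0 by (simp_all add: power2_eq_square)
  have a0_bounds: "real n / 4 \<le> a0" "a0 \<le> real n / 2" using kr n8 r8 k' unfolding a_eq by - (linarith+)
  have a2_bounds: "0 \<le> a2" "a2 \<le> real n / 4" using kr n8 r8 m_bounds k' unfolding a_eq by - (linarith+)
  show a1: "a1 > 0" using kr n8 r8 m_bounds unfolding a_eq by linarith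
  have "a0 * b\<^sup>2 \<le> real n / 2 * b\<^sup>2" using a0_bounds by (intro mult_right_mono) auto
  then show "2 * a0 * b\<^sup>2 \<le> 1 / 1000" using nb by simp
  show "32 * a2 * \<epsilon>\<^sup>2 * b + 64 * a2 * b\<^sup>2 \<le> 4 / 100"
  proof -
    have "a2 * b\<^sup>2 \<le> real n / 4 * b\<^sup>2" using a2_bounds by (intro mult_right_mono) auto
    then have 1: "a2 * b\<^sup>2 \<le> 1 / 100000000" using nb by simp
    have "a2 * \<epsilon>\<^sup>2 * b \<le> real n / 4 * \<epsilon>\<^sup>2 * b" using a2_bounds b0 by (intro mult_right_mono) auto
    also have "\<dots> = (real n * b) / 4 * (24 / r)" by (simp add: e2)
    also have "\<dots> = 6 / 10000" unfolding nb using r0 by simp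
    finally show ?thesis using 1 by simp
  qed
  have exp_ab: "- a0 * b / 2 \<le> - r / 80000"
  proof -
    have "real n / 4 * b \<le> a0 * b" using a0_bounds b0 by (intro mult_right_mono) auto
    then show ?thesis using nb by simp
  qed
  have tau: "sqrt 2 ^ k * exp (- a0 * b / 2) \<le> exp (r / 100000000 - r / 80000)"
  proof -
    have "sqrt 2 ^ k * exp (- a0 * b / 2) \<le> exp (real k) * exp (- a0 * b / 2)"
      using sqrt2_power_le_exp[of k] by (intro mult_right_mono) auto
    also have "\<dots> \<le> exp (r / 100000000 - r / 80000)"
      unfolding exp_add[symmetric] exp_le_cancel_iff using exp_ab kr by linarith
    finally show ?thesis .
  qed
  have small: "exp (- 1000) \<le> (1 / 1000 :: real)" using exp_neg_le_inverse[of 1000] by simp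
  have "exp (r / 100000000 - r / 80000) \<le> exp (- 1000)" using r8 by simp
  then show "sqrt 2 ^ k * exp (- a0 * b / 2) \<le> 1 / 1000" using tau small by linarith
  have "exp (1 / 10 ^ 6 * r) * (sqrt 2 ^ k * exp (- a0 * b / 2)) \<le> exp (1 / 10 ^ 6 * r) * exp (r / 100000000 - r / 80000)"
    using tau by (intro mult_left_mono) auto
  also have "\<dots> \<le> exp (- 1000)" unfolding exp_add[symmetric] exp_le_cancel_iff using r8 by simp
  finally show "exp (1 / 10 ^ 6 * r) * (sqrt 2 ^ k * exp (- a0 * b / 2)) \<le> 1 / 1000" using small by linarith
  show "(2 * a1 / a0) ^ k \<ge> 99 / 100"
  proof -
    \<comment> \<open>The ratio \<open>2 * a1 / a0\<close> falls short of 1 by O (k / n), and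
      Bernoulli's inequality turns its \<open>k\<close>-th power into a loss of O (k^2 / n); hence
      the restriction of \<open>k\<close> to the order of sqrt n.\<close>
    define x where "x = 8 * real k / real n"
    have a0p: "a0 > 0" using a0_bounds n8 r8 by linarith
    have np: "real n > 0" using n8 r8 by linarith
    have "(1 - x) * a0 \<le> 2 * a1"
    proof -
      have "x * a0 \<ge> x * (real n / 4)" using a0_bounds k' np by (intro mult_left_mono) (auto simp: x_def)
      moreover have "x * (real n / 4) = 2 * real k" using np by (simp add: x_def)
      ultimately have "(1 - x) * a0 \<le> a0 - 2 * real k" by (simp add: algebra_simps)
      also have "\<dots> = real n / 2 - real k / 2 - 1 - 2 * real k" by (simp add: a_eq)
      also have "\<dots> \<le> real m - real k - 2" using m_bounds k' by linarith
      also have "\<dots> = 2 * a1" by (simp add: a_eq)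
      finally show ?thesis .
    qed
    then have "1 - x \<le> 2 * a1 / a0" using a0p by (simp add: pos_le_divide_eq)
    moreover have x1: "real k * x \<le> 1 / 100" "x \<le> 1"
    proof -
      have "real k * real k \<le> (r / 100000000) * (r / 100000000)" using kr k' by (intro mult_mono) auto
      then have "real k * real k * 10000000000000000 \<le> r * r" by simp
      moreover have "0 \<le> real k * real k" by simp
      ultimately have "8 * (real k * real k) \<le> real n / 100" unfolding nr by linarith
      then show "real k * x \<le> 1 / 100" using np by (simp add: x_def divide_simps)
      show "x \<le> 1" using kr n8 r8 np by (simp add: x_def)
    qed
    ultimately have "(1 - x) ^ k \<le> (2 * a1 / a0) ^ k" by (intro power_mono) auto
    moreover have "1 + real k * (- x) \<le> (1 + (- x)) ^ k" using x1 by (intro Bernoulli_inequality) auto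
    ultimately show ?thesis using x1 by simp
  qed
  show "6 * real k - \<epsilon>\<^sup>2 * real m / 4 \<le> - r"
  proof -
    have "real n / 3 \<le> real m" using m_bounds n8 r8 by linarith
    then have "24 / r * (real n / 3) \<le> \<epsilon>\<^sup>2 * real m" unfolding e2 using r0 by (intro mult_left_mono) auto
    moreover have "24 / r * (real n / 3) = 8 * r" unfolding nr using r0 by simp
    moreover have "6 * real k \<le> r" using kr r0 by linarith
    ultimately show ?thesis by simp
  qed
qed

text \<open>Lets the lower bound pass from a subset to the set in the theorem;
  \<open>measure\<close> of a non-measurable set would be 0.\<close>

lemma product_set_measurable:
  assumes m: "1 \<le> m" "m < n"
    and f: "f \<in> borel_measurable (restrict_space borel (sphere_in n (Rn n)))" "\<And>x. x \<in> sphere_in n (Rn n) \<Longrightarrow> 0 \<le> f x"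
  shows "{H \<in> Grassmannian n m. sqrt ((\<integral>x. f x \<partial>sphere_measure n H) * (\<integral>x. f x \<partial>sphere_measure n (orth_compl n H))) \<ge> c}
    \<in> sets (Grassmannian_borel n m)"
proof -
  define fh where "fh = (\<lambda>x. if x \<in> sphere_in n (Rn n) then f x else 0)"
  have n: "dim (Rn n) \<ge> 1" using m by (simp add: dim_Rn)
  have fhm: "(\<lambda>x. ennreal (fh x)) \<in> borel_measurable borel"
    using sphere_integral_eq(1)[OF subspace_Rn order_refl n f] by (simp add: fh_def)
  define q where "q H = enn2real (\<integral>\<^sup>+x. ennreal (fh x) \<partial>sphere_measure n H) * enn2real (\<integral>\<^sup>+x. ennreal (fh x) \<partial>sphere_measure n (orth_compl n H))" for H
  have qm: "q \<in> borel_measurable (Grassmannian_borel n m)"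
    unfolding q_def by (intro borel_measurable_times borel_measurable_enn2real nn_integral_sphere_measurable[OF m fhm])
  have q: "q H = (\<integral>x. f x \<partial>sphere_measure n H) * (\<integral>x. f x \<partial>sphere_measure n (orth_compl n H))"
    if "H \<in> Grassmannian n m" for H
  proof -
    note HD = GrassmannianD[OF that]
    note cD = orth_compl_facts[OF HD(1,2)]
    have "dim H \<ge> 1" "dim (orth_compl n H) \<ge> 1" using HD(3) cD(3) m by auto
    then show ?thesis
      using sphere_integral_eq(2)[OF HD(1,2) _ f] sphere_integral_eq(2)[OF cD(1,2) _ f] by (simp add: q_def fh_def)
  qed
  have "{H \<in> space (Grassmannian_borel n m). sqrt (q H) \<ge> c} \<in> sets (Grassmannian_borel n m)"
    using measurable_compose[OF qm borel_measurable_sqrt] by measurable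
  also have "{H \<in> space (Grassmannian_borel n m). sqrt (q H) \<ge> c} =
      {H \<in> Grassmannian n m. sqrt ((\<integral>x. f x \<partial>sphere_measure n H) * (\<integral>x. f x \<partial>sphere_measure n (orth_compl n H))) \<ge> c}"
    using q by auto
  finally show ?thesis .
qed

theorem theorem1p2:
  shows "\<exists>\<alpha>\<^sub>1 \<alpha>\<^sub>2 \<alpha>\<^sub>3 :: real. \<alpha>\<^sub>1 > 0 \<and> \<alpha>\<^sub>2 > 0 \<and> \<alpha>\<^sub>3 > 0 \<and>
    (\<forall>(n::nat) (k::nat) (f :: (nat \<Rightarrow> real) \<Rightarrow> real).
       n \<ge> 2 \<longrightarrow> 1 \<le> k \<longrightarrow> real k \<le> \<alpha>\<^sub>1 * sqrt (real n) \<longrightarrow>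
       f \<in> borel_measurable (restrict_space borel (sphere_in n (Rn n))) \<longrightarrow>
       (\<forall>x\<in>sphere_in n (Rn n). f x \<ge> 0) \<longrightarrow>
       esssup (sphere_measure n (Rn n)) (\<lambda>x. ereal \<bar>f x\<bar>) \<le> ereal (exp (\<alpha>\<^sub>2 * sqrt (real n))) \<longrightarrow>
       (\<integral>x. f x \<partial>sphere_measure n (Rn n)) = 1 \<longrightarrow>
       (\<forall>x\<in>sphere_in n (Rn n). \<forall>y\<in>sphere_in n (Rn n). (\<forall>i<k. x i = y i) \<longrightarrow> f x = f y) \<longrightarrow>
       measure (Haar_Grassmannian n (n div 2))
         {H \<in> Grassmannian n (n div 2).
            sqrt ((\<integral>x. f x \<partial>sphere_measure n H) *
                  (\<integral>x. f x \<partial>sphere_measure n (orth_compl n H))) \<ge> 0.9}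
       \<ge> 1 - \<alpha>\<^sub>3 * exp (- sqrt (real n)))"
\<comment> \<open>The third witness, 3, is the constant of the Gaussian concentration bound, carried
  through Markov's inequality. The other two are small enough for
  \<open>numeric_bounds\<close>.\<close>
proof (rule exI[of _ "1 / 10 ^ 8"], rule exI[of _ "1 / 10 ^ 6"], rule exI[of _ 3], intro conjI allI impI)
  fix n k :: nat and f :: "(nat \<Rightarrow> real) \<Rightarrow> real"
  assume k: "1 \<le> k" "real k \<le> 1 / 10 ^ 8 * sqrt (real n)"
    and f: "f \<in> borel_measurable (restrict_space borel (sphere_in n (Rn n)))" "\<forall>x\<in>sphere_in n (Rn n). f x \<ge> 0"
    and fM: "esssup (sphere_measure n (Rn n)) (\<lambda>x. ereal \<bar>f x\<bar>) \<le> ereal (exp (1 / 10 ^ 6 * sqrt (real n)))"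
    and f1: "(\<integral>x. f x \<partial>sphere_measure n (Rn n)) = 1"
    and dep: "\<forall>x\<in>sphere_in n (Rn n). \<forall>y\<in>sphere_in n (Rn n). (\<forall>i<k. x i = y i) \<longrightarrow> f x = f y"
  define m where "m = n div 2"
  define r where "r = sqrt (real n)"
  let ?M = "Haar_Grassmannian n m"
  let ?T = "{H \<in> Grassmannian n m. sqrt ((\<integral>x. f x \<partial>sphere_measure n H) * (\<integral>x. f x \<partial>sphere_measure n (orth_compl n H))) \<ge> 0.9}"
  note N = numeric_bounds[OF r_def k[folded r_def] m_def]
  have km: "k < m" "k \<le> n" "1 \<le> m" "m < n" "m \<le> n" using N(1) k(1) m_def by auto
  have f0: "0 \<le> f x" if "x \<in> sphere_in n (Rn n)" for x using f(2) that by blast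
  have fdep: "f x = f y" if "x \<in> sphere_in n (Rn n)" "y \<in> sphere_in n (Rn n)" "\<forall>i<k. x i = y i" for x y
    using dep[THEN bspec, THEN bspec, THEN mp, OF that] .
  have \<epsilon>1: "sqrt (24 / r) \<le> 1" using N(3) by linarith
  obtain A where A: "A \<in> sets ?M" "measure ?M A \<ge> 1 - 3 * exp (6 * real k - (sqrt (24 / r))\<^sup>2 * m / 4)"
    "\<And>H. H \<in> A \<Longrightarrow> H \<in> Grassmannian n m \<and>
       (\<integral>\<^sup>+x. of_bool (unbalanced (sqrt (24 / r)) (inner_n n (orth_proj n H x) (orth_proj n H x)) (inner_n n x x)) \<partial>gauss k)
         < ennreal (exp (- 6 * real k))"
    using Haar_balanced_subspaces[OF m_def k(1) km(2) N(2) \<epsilon>1] by blast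
  have "H \<in> ?T" if "H \<in> A" for H
  proof -
    have H: "H \<in> Grassmannian n m" and small: "(\<integral>\<^sup>+x. of_bool (unbalanced (sqrt (24 / r)) (inner_n n (orth_proj n H x) (orth_proj n H x)) (inner_n n x x)) \<partial>gauss k)
         < ennreal (exp (- 6 * real k))"
      using A(3)[OF that] by auto
    have "sqrt ((\<integral>x. f x \<partial>sphere_measure n H) * (\<integral>x. f x \<partial>sphere_measure n (orth_compl n H))) \<ge> 0.9"
      by (rule balanced_subspace_product_lower[OF k(1) km(1) m_def H f(1) f0 f1 fM[folded r_def] exp_gt_zero fdep N(2-5) small N(6-11)])
    with H show ?thesis by simp
  qed
  then have AT: "A \<subseteq> ?T" by blast
  have haar: "is_Haar_Grassmannian n m ?M" by (rule is_Haar_Haar_Grassmannian[OF km(5)])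
  interpret prob_space ?M using haar by (simp add: is_Haar_Grassmannian_def)
  have T: "?T \<in> sets ?M"
    using product_set_measurable[OF km(3,4) f(1) f0, of "0.9"] haar unfolding is_Haar_Grassmannian_def by (elim conjE) (simp only:)
  have "exp (6 * real k - (sqrt (24 / r))\<^sup>2 * m / 4) \<le> exp (- r)" using N(12) by simp
  then have "1 - 3 * exp (- r) \<le> measure ?M A" using A(2) by linarith
  also have "\<dots> \<le> measure ?M ?T" by (rule finite_measure_mono[OF AT T])
  finally show "measure (Haar_Grassmannian n (n div 2))
         {H \<in> Grassmannian n (n div 2).
            sqrt ((\<integral>x. f x \<partial>sphere_measure n H) *
                  (\<integral>x. f x \<partial>sphere_measure n (orth_compl n H))) \<ge> 0.9}
       \<ge> 1 - 3 * exp (- sqrt (real n))" by (simp add: m_def r_def)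
qed simp_all

end
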